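(* Let $(u,p)\in (X_h,Q_h)$ be a solution of the finite element steady Navier-Stokes system: for all $(v,q)\in (X_h,Q_h)$, $$\nu(\nabla u,\nabla v)+b(u,u,v)-(p,\nabla\cdot v)+\gamma(\nabla\cdot u,\nabla\cdot v)=\langle f,v\rangle,\qquad (\nabla\cdot u,q)=0 .$$ Let $I_H(u)$ be known and let $(u_{k-1},p_{k-1})\in (X_h,Q_h)$ be given. Assume that $\nu\|\nabla(u_{k-1}-u)\|^2\le \|\nabla u\|^2$, and that the parameters satisfy $$H\le \min\left\{\frac{1}{\alpha^2R},\ \frac{101}{204\sqrt2\,C_1\alpha^2}\right\},\qquad \max\left\{\nu\alpha^2,\ \frac{\nu}{2C_1^2H^2}\right\}\le \mu,\qquad \gamma\ge \max\left\{2\mu^2C_1^6C_P^2H^2\nu^{-1},\ \nu\right\}.$$ Let $(u_k,p_k)\in (X_h,Q_h)$ be produced from $(u_{k-1},p_{k-1})$ by one step of the CDA-IPY algorithm (with exact data $I_H u$) described in the context. Then, with $\lambda=\min\{\mu,\frac{\nu}{2C_1^2H^2}\}=\frac{\nu}{2C_1^2H^2}$, $$\frac{\nu}{4}\|\nabla(u-u_k)\|^2+\lambda\|u-u_k\|^2+\frac{\gamma^{-1}}{2}\|p-p_k\|^2\le \alpha^2HR\left(\frac{\nu}{4}\|\nabla(u-u_{k-1})\|^2+\lambda\|u-u_{k-1}\|^2+\frac{\gamma^{-1}}{2}\|p-p_{k-1}\|^2\right).$$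
   Context: Domain and spaces: $\Omega\subset\mathbb{R}^d$, $d\in\{2,3\}$, is a bounded domain; $\|\cdot\|$ and $(\cdot,\cdot)$ denote the $L^2(\Omega)$ norm and inner product (for scalar, vector or matrix fields). $X=H_0^1(\Omega)$ (velocities, $\mathbb{R}^d$-valued), $Q=L_0^2(\Omega)$ (mean-zero $L^2$ functions). $X'$ is the dual of $X$ with pairing $\langle\cdot,\cdot\rangle$ and dual norm $\|\cdot\|_{-1}$ (with respect to $\|\nabla\cdot\|$ on $X$). $C_P>0$ is the Poincaré-Friedrichs constant: $\|v\|\le C_P\|\nabla v\|$ for all $v\in X$. Let $\tau_h$ be a regular conforming triangulation of $\Omega$ with maximum element diameter $h$, and $(X_h,Q_h)\subset(X,Q)$ finite element spaces of piecewise polynomials on $\tau_h$ satisfying the inf-sup condition $$\inf_{q\in Q_h}\sup_{v\in X_h}\frac{(\nabla\cdot v,q)}{\|q\|\,\|\nabla v\|}\ge\beta>0$$ with $\beta$ independent of $h$. Nonlinear form: $b(\chi,v,w)=\frac12(\chi\cdot\nabla v,w)-\frac12(\chi\cdot\nabla w,v)$ on $X\times X\times X$. $M$ is a constant depending only on $\Omega$ such that $b(u,w,v)\le M\|u\|^{1/2}\|\nabla u\|^{1/2}\|\nabla w\|\|\nabla v\|$ and $b(u,w,v)\le M\|\nabla u\|\|\nabla w\|\|\nabla v\|$ for all $u,w,v\in X$. Data and parameters: $\nu>0$ is the viscosity, $f\in X'=H^{-1}(\Omega)$ the forcing, $\gamma\ge0$ the grad-div parameter, $\mu\ge 0$ the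 nudging parameter, and $\alpha=M\nu^{-2}\|f\|_{-1}$ (no smallness condition such as $\alpha<1$ is assumed). Interpolant: $\tau_H$ is a coarse mesh of $\Omega$ with characteristic spacing $H>0$, whose nodes are also nodes of $\tau_h$. $I_H$ is a (linear) interpolation operator on $\Omega$ (e.g. the $L^2$ projection onto piecewise constants on $\tau_H$) for which there is a constant $C_1$ independent of $H$ with $\|I_Hv-v\|\le C_1H\|\nabla v\|$ and $\|I_Hv\|\le C_1\|v\|$ for all $v\in X$. Constant: $R:=204\sqrt2\,\nu^{-1}C_1\beta^{-2}+24\sqrt2\,\nu^{-1/2}C_1\beta^{-2}+204\sqrt2\,C_1\beta^{-2}$. CDA-IPY algorithm, step $k$, given $(u_{k-1},p_{k-1})\in(X_h,Q_h)$: (k.1) Find $z_k\in X_h$ such that for all $v\in X_h$, $$\nu(\nabla z_k,\nabla v)+\gamma(\nabla\cdot z_k,\nabla\cdot v)+b(u_{k-1},z_k,v)+\mu(I_Hz_k,I_Hv)=\langle f,v\rangle+\mu(I_Hu,I_Hv)+(p_{k-1},\nabla\cdot v).$$ (k.2) Find $(w_k,\delta_k^p)\in(X_h,Q_h)$ such that for all $(v,q)\in(X_h,Q_h)$, $$\nu(\nabla w_k,\nabla v)+\gamma(\nabla\cdot w_k,\nabla\cdot v)-(\delta_k^p,\nabla\cdot v)+\mu(I_Hw_k,I_Hv)=0,\qquad (\nabla\cdot w_k,q)=-(\nabla\cdot z_k,q).$$ (k.3) Set $p_k:=p_{k-1}+\delta_k^p$ and find $u_k\in X_h$ such that for all $v\in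 X_h$, $$\nu(\nabla u_k,\nabla v)+\gamma(\nabla\cdot u_k,\nabla\cdot v)+b(u_{k-1},u_k,v)+\mu(I_Hu_k,I_Hv)=\langle f,v\rangle+\mu(I_Hu,I_Hv)+(p_k,\nabla\cdot v).$$ *)

theory Defs
  imports "HOL-Analysis.Analysis"
begin

section \<open>Square-integrable fields\<close>

text \<open>
  Elements of function spaces are represented by functions on the whole of \<^typ>\<open>real^'n\<close>, of
  which only the restriction to the domain, up to null sets, matters.  Scalar, vector and
  matrix fields are all covered by a value type of class \<^class>\<open>euclidean_space\<close>; on matrices
  the inner product is the Frobenius one.
\<close>

definition L2 :: "(real^'n) set \<Rightarrow> (real^'n \<Rightarrow> 'a::euclidean_space) set" where
  "L2 \<Omega> = {u. u \<in> borel_measurable (lebesgue_on \<Omega>) \<and>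
               integrable (lebesgue_on \<Omega>) (\<lambda>x. (norm (u x))\<^sup>2)}"

definition l2_inner ::
  "(real^'n) set \<Rightarrow> (real^'n \<Rightarrow> 'a::euclidean_space) \<Rightarrow> (real^'n \<Rightarrow> 'a) \<Rightarrow> real" where
  "l2_inner \<Omega> u v = (\<integral>x. u x \<bullet> v x \<partial>(lebesgue_on \<Omega>))"

definition l2_norm :: "(real^'n) set \<Rightarrow> (real^'n \<Rightarrow> 'a::euclidean_space) \<Rightarrow> real" where
  "l2_norm \<Omega> u = sqrt (l2_inner \<Omega> u u)"

definition L20 :: "(real^'n) set \<Rightarrow> (real^'n \<Rightarrow> real) set" where
  "L20 \<Omega> = {q \<in> L2 \<Omega>. (\<integral>x. q x \<partial>(lebesgue_on \<Omega>)) = 0}"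


section \<open>Weak derivatives and Sobolev spaces\<close>

definition pderiv_at :: "'n \<Rightarrow> (real^'n \<Rightarrow> real) \<Rightarrow> real^'n \<Rightarrow> real" where
  "pderiv_at j \<phi> x = frechet_derivative \<phi> (at x) (axis j 1)"

fun iter_pderiv :: "'n list \<Rightarrow> (real^'n \<Rightarrow> real) \<Rightarrow> real^'n \<Rightarrow> real" where
  "iter_pderiv [] \<phi> = \<phi>"
| "iter_pderiv (j # js) \<phi> = pderiv_at j (iter_pderiv js \<phi>)"

definition test_function :: "(real^'n) set \<Rightarrow> (real^'n \<Rightarrow> real) \<Rightarrow> bool" where
  "test_function \<Omega> \<phi> \<longleftrightarrow>
     (\<forall>js x. iter_pderiv js \<phi> differentiable (at x)) \<and>
     compact (closure {x. \<phi> x \<noteq> 0}) \<and> closure {x. \<phi> x \<noteq> 0} \<subseteq> \<Omega>"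

definition has_weak_pderiv ::
  "(real^'n) set \<Rightarrow> 'n \<Rightarrow> (real^'n \<Rightarrow> real) \<Rightarrow> (real^'n \<Rightarrow> real) \<Rightarrow> bool" where
  "has_weak_pderiv \<Omega> j u g \<longleftrightarrow>
     (\<forall>\<phi>. test_function \<Omega> \<phi> \<longrightarrow> l2_inner \<Omega> u (pderiv_at j \<phi>) = - l2_inner \<Omega> g \<phi>)"

definition H1 :: "(real^'n) set \<Rightarrow> (real^'n \<Rightarrow> real) set" where
  "H1 \<Omega> = {u \<in> L2 \<Omega>. \<forall>j. \<exists>g\<in>L2 \<Omega>. has_weak_pderiv \<Omega> j u g}"

text \<open>Weak derivatives are unique only almost everywhere; some representative is chosen.\<close>

definition weak_pderiv :: "(real^'n) set \<Rightarrow> 'n \<Rightarrow> (real^'n \<Rightarrow> real) \<Rightarrow> real^'n \<Rightarrow> real" where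
  "weak_pderiv \<Omega> j u = (SOME g. g \<in> L2 \<Omega> \<and> has_weak_pderiv \<Omega> j u g)"

definition h1_norm :: "(real^'n) set \<Rightarrow> (real^'n \<Rightarrow> real) \<Rightarrow> real" where
  "h1_norm \<Omega> u = sqrt ((l2_norm \<Omega> u)\<^sup>2 + (\<Sum>j\<in>UNIV. (l2_norm \<Omega> (weak_pderiv \<Omega> j u))\<^sup>2))"

text \<open>The closure of the test functions in the \<open>H\<^sup>1\<close> norm.\<close>

definition H10 :: "(real^'n) set \<Rightarrow> (real^'n \<Rightarrow> real) set" where
  "H10 \<Omega> = {u \<in> H1 \<Omega>. \<exists>\<phi>. (\<forall>k. test_function \<Omega> (\<phi> k)) \<and>
                 (\<lambda>k::nat. h1_norm \<Omega> (\<lambda>x. \<phi> k x - u x)) \<longlonglongrightarrow> 0}"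

definition velocity_space :: "(real^'n) set \<Rightarrow> (real^'n \<Rightarrow> real^'n) set" where
  "velocity_space \<Omega> = {u. \<forall>i. (\<lambda>x. u x $ i) \<in> H10 \<Omega>}"

definition wgrad :: "(real^'n) set \<Rightarrow> (real^'n \<Rightarrow> real^'n) \<Rightarrow> real^'n \<Rightarrow> real^'n^'n" where
  "wgrad \<Omega> u x = (\<chi> i j. weak_pderiv \<Omega> j (\<lambda>y. u y $ i) x)"

definition wdiv :: "(real^'n) set \<Rightarrow> (real^'n \<Rightarrow> real^'n) \<Rightarrow> real^'n \<Rightarrow> real" where
  "wdiv \<Omega> u x = (\<Sum>i\<in>UNIV. weak_pderiv \<Omega> i (\<lambda>y. u y $ i) x)"

definition in_dual :: "(real^'n) set \<Rightarrow> ((real^'n \<Rightarrow> real^'n) \<Rightarrow> real) \<Rightarrow> bool" where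
  "in_dual \<Omega> f \<longleftrightarrow>
     (\<forall>v\<in>velocity_space \<Omega>. \<forall>w\<in>velocity_space \<Omega>. \<forall>a b.
        f (\<lambda>x. a *\<^sub>R v x + b *\<^sub>R w x) = a * f v + b * f w) \<and>
     (\<exists>C. \<forall>v\<in>velocity_space \<Omega>. \<bar>f v\<bar> \<le> C * l2_norm \<Omega> (wgrad \<Omega> v))"

definition dual_norm :: "(real^'n) set \<Rightarrow> ((real^'n \<Rightarrow> real^'n) \<Rightarrow> real) \<Rightarrow> real" where
  "dual_norm \<Omega> f =
     (SUP v\<in>{v \<in> velocity_space \<Omega>. l2_norm \<Omega> (wgrad \<Omega> v) \<noteq> 0}.
        f v / l2_norm \<Omega> (wgrad \<Omega> v))"

text \<open>With \<open>(\<nabla>v)\<^sub>i\<^sub>j = \<partial>\<^sub>j v\<^sub>i\<close>, the convective derivative \<open>(\<chi> \<cdot> \<nabla>) v\<close> is the matrix-vector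
  product of \<open>\<nabla>v\<close> and \<open>\<chi>\<close>.\<close>

definition convection ::
  "(real^'n) set \<Rightarrow> (real^'n \<Rightarrow> real^'n) \<Rightarrow> (real^'n \<Rightarrow> real^'n) \<Rightarrow> (real^'n \<Rightarrow> real^'n) \<Rightarrow> real" where
  "convection \<Omega> c v w =
     1/2 * l2_inner \<Omega> (\<lambda>x. wgrad \<Omega> v x *v c x) w - 1/2 * l2_inner \<Omega> (\<lambda>x. wgrad \<Omega> w x *v c x) v"


section \<open>Meshes and finite element spaces\<close>

definition bounded_domain :: "(real^'n) set \<Rightarrow> bool" where
  "bounded_domain \<Omega> \<longleftrightarrow> open \<Omega> \<and> connected \<Omega> \<and> bounded \<Omega> \<and> \<Omega> \<noteq> {}"

definition mesh_nodes :: "(real^'n) set set \<Rightarrow> (real^'n) set" where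
  "mesh_nodes \<tau> = {x. \<exists>T\<in>\<tau>. x extreme_point_of T}"

text \<open>The library's \<^const>\<open>triangulation\<close> is a finite set of simplices, of possibly different
  dimensions, any two of which meet in a common face.  Regularity bounds the ratio of the
  diameter to the inner radius of the elements by \<open>\<sigma>\<close>.\<close>

definition regular_triangulation ::
  "(real^'n) set \<Rightarrow> real \<Rightarrow> real \<Rightarrow> (real^'n) set set \<Rightarrow> bool" where
  "regular_triangulation \<Omega> \<sigma> h \<tau> \<longleftrightarrow>
     triangulation \<tau> \<and> (\<forall>T\<in>\<tau>. int CARD('n) simplex T \<and> interior T \<subseteq> \<Omega>) \<and>
     \<Union>\<tau> = closure \<Omega> \<and>
     \<sigma> > 0 \<and> (\<forall>T\<in>\<tau>. \<exists>x r. r > 0 \<and> ball x r \<subseteq> T \<and> diameter T \<le> \<sigma> * r) \<and>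
     h = Max (diameter ` \<tau>)"

text \<open>A coarse mesh may consist of arbitrary convex polytopes.  That \<open>H\<close> is its characteristic
  spacing means that the element diameters are comparable to \<open>H\<close>.\<close>

definition coarse_mesh ::
  "(real^'n) set \<Rightarrow> real \<Rightarrow> real \<Rightarrow> real \<Rightarrow> (real^'n) set set \<Rightarrow> bool" where
  "coarse_mesh \<Omega> c\<^sub>0 c\<^sub>1 H \<tau> \<longleftrightarrow>
     finite \<tau> \<and> (\<forall>K\<in>\<tau>. polytope K \<and> interior K \<noteq> {} \<and> interior K \<subseteq> \<Omega>) \<and>
     pairwise (\<lambda>K L. interior K \<inter> interior L = {}) \<tau> \<and> \<Union>\<tau> = closure \<Omega> \<and>
     c\<^sub>0 > 0 \<and> (\<forall>K\<in>\<tau>. c\<^sub>0 * H \<le> diameter K \<and> diameter K \<le> c\<^sub>1 * H)"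

definition poly_degree_le :: "nat \<Rightarrow> (real^'n \<Rightarrow> 'a::real_vector) \<Rightarrow> bool" where
  "poly_degree_le m P \<longleftrightarrow>
     (\<exists>c. \<forall>x. P x = (\<Sum>a\<in>{a::'n \<Rightarrow> nat. sum a UNIV \<le> m}. (\<Prod>i\<in>UNIV. (x $ i) ^ a i) *\<^sub>R c a))"

text \<open>The uniform bound on the polynomial degree makes the space finite-dimensional up to null sets.\<close>

definition finite_element_space ::
  "(real^'n) set set \<Rightarrow> (real^'n \<Rightarrow> 'a::real_vector) set \<Rightarrow> bool" where
  "finite_element_space \<tau> V \<longleftrightarrow>
     (\<lambda>x. 0) \<in> V \<and> (\<forall>u\<in>V. \<forall>v\<in>V. \<forall>a b. (\<lambda>x. a *\<^sub>R u x + b *\<^sub>R v x) \<in> V) \<and>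
     (\<exists>m. \<forall>u\<in>V. \<forall>T\<in>\<tau>. \<exists>P. poly_degree_le m P \<and> (\<forall>x\<in>interior T. u x = P x))"

text \<open>The infimum is over a non-empty set: for a trivial pressure space it would be infinite
  and \<open>\<beta>\<close> arbitrary.\<close>

definition inf_sup_condition ::
  "(real^'n) set \<Rightarrow> (real^'n \<Rightarrow> real^'n) set \<Rightarrow> (real^'n \<Rightarrow> real) set \<Rightarrow> real \<Rightarrow> bool" where
  "inf_sup_condition \<Omega> X\<^sub>h Q\<^sub>h \<beta> \<longleftrightarrow>
     \<beta> > 0 \<and> (\<exists>q\<in>Q\<^sub>h. l2_norm \<Omega> q \<noteq> 0) \<and>
     ereal \<beta> \<le> (INF q\<in>{q \<in> Q\<^sub>h. l2_norm \<Omega> q \<noteq> 0}.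
                  SUP v\<in>{v \<in> X\<^sub>h. l2_norm \<Omega> (wgrad \<Omega> v) \<noteq> 0}.
                    ereal (l2_inner \<Omega> (wdiv \<Omega> v) q / (l2_norm \<Omega> q * l2_norm \<Omega> (wgrad \<Omega> v))))"

text \<open>Linearity is that of an operator between spaces of equivalence classes, hence almost
  everywhere.\<close>

definition interpolation_operator ::
  "(real^'n) set \<Rightarrow> real \<Rightarrow> real \<Rightarrow> ((real^'n \<Rightarrow> real^'n) \<Rightarrow> (real^'n \<Rightarrow> real^'n)) \<Rightarrow> bool" where
  "interpolation_operator \<Omega> H C\<^sub>1 I\<^sub>H \<longleftrightarrow>
     (\<forall>v\<in>velocity_space \<Omega>. I\<^sub>H v \<in> L2 \<Omega>) \<and>
     (\<forall>v\<in>velocity_space \<Omega>. \<forall>w\<in>velocity_space \<Omega>. \<forall>a b.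
        AE x in lebesgue_on \<Omega>. I\<^sub>H (\<lambda>y. a *\<^sub>R v y + b *\<^sub>R w y) x = a *\<^sub>R I\<^sub>H v x + b *\<^sub>R I\<^sub>H w x) \<and>
     (\<forall>v\<in>velocity_space \<Omega>. l2_norm \<Omega> (\<lambda>x. I\<^sub>H v x - v x) \<le> C\<^sub>1 * H * l2_norm \<Omega> (wgrad \<Omega> v)) \<and>
     (\<forall>v\<in>velocity_space \<Omega>. l2_norm \<Omega> (I\<^sub>H v) \<le> C\<^sub>1 * l2_norm \<Omega> v)"


section \<open>The discrete problem and the CDA-IPY step\<close>

definition steady_NSE_solution ::
  "(real^'n) set \<Rightarrow> (real^'n \<Rightarrow> real^'n) set \<Rightarrow> (real^'n \<Rightarrow> real) set \<Rightarrow> real \<Rightarrow> real \<Rightarrow>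
   ((real^'n \<Rightarrow> real^'n) \<Rightarrow> real) \<Rightarrow> (real^'n \<Rightarrow> real^'n) \<Rightarrow> (real^'n \<Rightarrow> real) \<Rightarrow> bool" where
  "steady_NSE_solution \<Omega> X\<^sub>h Q\<^sub>h \<nu> \<gamma> f u p \<longleftrightarrow>
     u \<in> X\<^sub>h \<and> p \<in> Q\<^sub>h \<and>
     (\<forall>v\<in>X\<^sub>h. \<nu> * l2_inner \<Omega> (wgrad \<Omega> u) (wgrad \<Omega> v) + convection \<Omega> u u v
        - l2_inner \<Omega> p (wdiv \<Omega> v) + \<gamma> * l2_inner \<Omega> (wdiv \<Omega> u) (wdiv \<Omega> v) = f v) \<and>
     (\<forall>q\<in>Q\<^sub>h. l2_inner \<Omega> (wdiv \<Omega> u) q = 0)"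

text \<open>Steps 1 and 3 of the algorithm are the same linear problem, with different pressures:
  \<open>z\<close> is the velocity with convecting field \<open>c\<close>, pressure \<open>r\<close> and data \<open>I\<^sub>H u\<close>.\<close>

definition nudged_Picard_velocity ::
  "(real^'n) set \<Rightarrow> (real^'n \<Rightarrow> real^'n) set \<Rightarrow> real \<Rightarrow> real \<Rightarrow> real \<Rightarrow>
   ((real^'n \<Rightarrow> real^'n) \<Rightarrow> real) \<Rightarrow> ((real^'n \<Rightarrow> real^'n) \<Rightarrow> (real^'n \<Rightarrow> real^'n)) \<Rightarrow>
   (real^'n \<Rightarrow> real^'n) \<Rightarrow> (real^'n \<Rightarrow> real^'n) \<Rightarrow> (real^'n \<Rightarrow> real) \<Rightarrow> (real^'n \<Rightarrow> real^'n) \<Rightarrow> bool" where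
  "nudged_Picard_velocity \<Omega> X\<^sub>h \<nu> \<gamma> \<mu> f I\<^sub>H u c r z \<longleftrightarrow>
     z \<in> X\<^sub>h \<and>
     (\<forall>v\<in>X\<^sub>h. \<nu> * l2_inner \<Omega> (wgrad \<Omega> z) (wgrad \<Omega> v) + \<gamma> * l2_inner \<Omega> (wdiv \<Omega> z) (wdiv \<Omega> v)
          + convection \<Omega> c z v + \<mu> * l2_inner \<Omega> (I\<^sub>H z) (I\<^sub>H v)
        = f v + \<mu> * l2_inner \<Omega> (I\<^sub>H u) (I\<^sub>H v) + l2_inner \<Omega> r (wdiv \<Omega> v))"

definition CDA_IPY_step ::
  "(real^'n) set \<Rightarrow> (real^'n \<Rightarrow> real^'n) set \<Rightarrow> (real^'n \<Rightarrow> real) set \<Rightarrow> real \<Rightarrow> real \<Rightarrow> real \<Rightarrow>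
   ((real^'n \<Rightarrow> real^'n) \<Rightarrow> real) \<Rightarrow> ((real^'n \<Rightarrow> real^'n) \<Rightarrow> (real^'n \<Rightarrow> real^'n)) \<Rightarrow>
   (real^'n \<Rightarrow> real^'n) \<Rightarrow> (real^'n \<Rightarrow> real^'n) \<Rightarrow> (real^'n \<Rightarrow> real) \<Rightarrow>
   (real^'n \<Rightarrow> real^'n) \<Rightarrow> (real^'n \<Rightarrow> real) \<Rightarrow> bool" where
  "CDA_IPY_step \<Omega> X\<^sub>h Q\<^sub>h \<nu> \<gamma> \<mu> f I\<^sub>H u u_old p_old u_new p_new \<longleftrightarrow>
     (\<exists>z w \<delta>.
        nudged_Picard_velocity \<Omega> X\<^sub>h \<nu> \<gamma> \<mu> f I\<^sub>H u u_old p_old z \<and>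
        w \<in> X\<^sub>h \<and> \<delta> \<in> Q\<^sub>h \<and>
        (\<forall>v\<in>X\<^sub>h. \<nu> * l2_inner \<Omega> (wgrad \<Omega> w) (wgrad \<Omega> v) + \<gamma> * l2_inner \<Omega> (wdiv \<Omega> w) (wdiv \<Omega> v)
             - l2_inner \<Omega> \<delta> (wdiv \<Omega> v) + \<mu> * l2_inner \<Omega> (I\<^sub>H w) (I\<^sub>H v) = 0) \<and>
        (\<forall>q\<in>Q\<^sub>h. l2_inner \<Omega> (wdiv \<Omega> w) q = - l2_inner \<Omega> (wdiv \<Omega> z) q) \<and>
        p_new = (\<lambda>x. p_old x + \<delta> x) \<and>
        nudged_Picard_velocity \<Omega> X\<^sub>h \<nu> \<gamma> \<mu> f I\<^sub>H u u_old p_new u_new)"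

definition rate_constant :: "real \<Rightarrow> real \<Rightarrow> real \<Rightarrow> real" where
  "rate_constant \<nu> C\<^sub>1 \<beta> =
     204 * sqrt 2 * \<nu> powi (-1) * C\<^sub>1 * \<beta> powi (-2)
     + 24 * sqrt 2 * \<nu> powr (-1/2) * C\<^sub>1 * \<beta> powi (-2)
     + 204 * sqrt 2 * C\<^sub>1 * \<beta> powi (-2)"

definition weighted_error ::
  "(real^'n) set \<Rightarrow> real \<Rightarrow> real \<Rightarrow> real \<Rightarrow> (real^'n \<Rightarrow> real^'n) \<Rightarrow> (real^'n \<Rightarrow> real) \<Rightarrow> real" where
  "weighted_error \<Omega> \<nu> lam \<gamma> e r =
     \<nu> / 4 * (l2_norm \<Omega> (wgrad \<Omega> e))\<^sup>2 + lam * (l2_norm \<Omega> e)\<^sup>2 + inverse \<gamma> / 2 * (l2_norm \<Omega> r)\<^sup>2"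

end

theory Submission
  imports Defs
begin

text \<open>
  Write \<open>\<epsilon> = p - p\<^sub>k\<close>, \<open>e\<^sub>z = u - z\<^sub>k\<close>, \<open>x = e\<^sub>z - w\<^sub>k\<close>, and \<open>B\<close> for the symmetric form consisting of the
  viscous, grad-div and nudging terms.  Subtracting the equations of the steps from the
  Navier-Stokes equations gives
    \<open>B(x,v) = (\<epsilon>, div v) - l(v)\<close> with \<open>l(v) = b(u\<^sub>k\<^sub>-\<^sub>1, e\<^sub>z, v) + b(u - u\<^sub>k\<^sub>-\<^sub>1, u, v)\<close>,
  and the second step makes \<open>x\<close> discretely divergence free, so that \<open>(\<epsilon>, div x) = 0\<close>.  Hence the
  functional \<open>(\<epsilon>, div \<cdot>)\<close> is \<open>l\<close> evaluated after the \<open>B\<close>-orthogonal projection away from \<open>x\<close>, and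
  its norm with respect to \<open>B\<close> is at most that of \<open>l\<close> (\<open>constrained_functional_bound\<close>).  Since
  \<open>B(v,v)\<close> is at most \<open>25/4 \<gamma> \<parallel>\<nabla>v\<parallel>\<^sup>2\<close>, the inf-sup condition turns a bound of \<open>l\<close> into a bound of
  \<open>\<gamma>\<^sup>-\<^sup>1 \<parallel>\<epsilon>\<parallel>\<^sup>2\<close> with a single factor \<open>\<beta>\<^sup>-\<^sup>2\<close>, and testing the last step with \<open>u - u\<^sub>k\<close> bounds the velocity
  error by the pressure error.

  The contraction factor \<open>\<alpha>\<^sup>2 H\<close> comes from the two convective terms in \<open>l\<close>.  The interpolation
  property of \<open>I\<^sub>H\<close> gives \<open>\<nu> \<parallel>v\<parallel> \<parallel>\<nabla>v\<parallel> \<le> sqrt 2 C\<^sub>1 H (\<nu> \<parallel>\<nabla>v\<parallel>\<^sup>2 + \<mu> \<parallel>I\<^sub>H v\<parallel>\<^sup>2)\<close>, so a factor \<open>H\<close> appears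
  whenever \<open>\<parallel>v\<parallel>\<^sup>1\<^sup>/\<^sup>2 \<parallel>\<nabla>v\<parallel>\<^sup>1\<^sup>/\<^sup>2\<close> replaces \<open>\<parallel>\<nabla>v\<parallel>\<close> for a controlled argument \<open>v\<close> of \<open>b\<close>; for the old velocity
  error the weight \<open>\<lambda>\<close> in the error norm has the same effect.  The bound defining
  \<open>M\<close> allows this replacement in the first argument only, which serves \<open>b(u - u\<^sub>k\<^sub>-\<^sub>1, u, v)\<close>; in
  \<open>b(u\<^sub>k\<^sub>-\<^sub>1, e\<^sub>z, v)\<close> the first argument does not become small.  The decisive observation
  (\<open>convection_axis_cyclic\<close>) is that for scalar components the skew-symmetric form is half the
  difference of two of the three integrals \<open>\<integral> \<partial>\<^sub>j a \<phi> \<psi>\<close>, \<open>\<integral> a \<partial>\<^sub>j\<phi> \<psi>\<close>, \<open>\<integral> a \<phi> \<partial>\<^sub>j\<psi>\<close>.  Inserting the third one writes it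
  as a sum of two values of the same form whose first arguments are \<open>\<phi>\<close> and \<open>\<psi>\<close>.  Therefore the
  bound with the very same constant \<open>M\<close> yields (\<open>convection_interpolation\<close>, in \<open>d\<close> dimensions)
    \<open>b(c,w,v) \<le> sqrt d M \<parallel>\<nabla>c\<parallel> (\<parallel>w\<parallel>\<^sup>1\<^sup>/\<^sup>2 \<parallel>\<nabla>w\<parallel>\<^sup>1\<^sup>/\<^sup>2 \<parallel>\<nabla>v\<parallel> + \<parallel>v\<parallel>\<^sup>1\<^sup>/\<^sup>2 \<parallel>\<nabla>v\<parallel>\<^sup>1\<^sup>/\<^sup>2 \<parallel>\<nabla>w\<parallel>)\<close>.
  The splitting requires each of the three integrals to exist; finite element functions are
  bounded, being piecewise polynomials on a bounded domain, and this makes the products integrable.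

  Weak derivatives are arbitrary representatives, so even their linearity rests on uniqueness
  almost everywhere, that is, on the fundamental lemma of the calculus of variations.  It is proved
  with smooth bumps that increase to the indicator functions of boxes.
\<close>

section \<open>Square-integrable fields as a semi-inner product space\<close>

lemma L2_measurable: "u \<in> L2 \<Omega> \<Longrightarrow> u \<in> borel_measurable (lebesgue_on \<Omega>)"
  by (simp add: L2_def)

lemma integrable_inner_L2:
  assumes "u \<in> L2 \<Omega>" "v \<in> L2 \<Omega>"
  shows "integrable (lebesgue_on \<Omega>) (\<lambda>x. u x \<bullet> v x)"
proof (rule Bochner_Integration.integrable_bound)
  show "integrable (lebesgue_on \<Omega>) (\<lambda>x. (norm (u x))\<^sup>2 + (norm (v x))\<^sup>2)"
    using assms by (simp add: L2_def)
  show "(\<lambda>x. u x \<bullet> v x) \<in> borel_measurable (lebesgue_on \<Omega>)"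
    using assms[THEN L2_measurable] by measurable
  have "norm (a \<bullet> b) \<le> norm ((norm a)\<^sup>2 + (norm b)\<^sup>2)" for a b :: 'b
  proof -
    have "\<bar>a \<bullet> b\<bar> \<le> norm a * norm b" by (rule Cauchy_Schwarz_ineq2)
    moreover have "2 * (norm a * norm b) \<le> (norm a)\<^sup>2 + (norm b)\<^sup>2"
      using sum_squares_bound[of "norm a" "norm b"] by simp
    moreover have "0 \<le> norm a * norm b" by simp
    ultimately show ?thesis unfolding real_norm_def by linarith
  qed
  then show "AE x in lebesgue_on \<Omega>. norm (u x \<bullet> v x) \<le> norm ((norm (u x))\<^sup>2 + (norm (v x))\<^sup>2)"
    by simp
qed

lemma L2_lincomb:
  assumes "u \<in> L2 \<Omega>" "v \<in> L2 \<Omega>"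
  shows "(\<lambda>x. a *\<^sub>R u x + b *\<^sub>R v x) \<in> L2 \<Omega>"
proof -
  have "(norm (a *\<^sub>R p + b *\<^sub>R q))\<^sup>2 = a\<^sup>2 * (p \<bullet> p) + 2 * a * b * (p \<bullet> q) + b\<^sup>2 * (q \<bullet> q)" for p q :: 'b
    unfolding power2_norm_eq_inner
    by (simp add: inner_add_left inner_add_right inner_commute algebra_simps power2_eq_square)
  moreover have "integrable (lebesgue_on \<Omega>)
      (\<lambda>x. a\<^sup>2 * (u x \<bullet> u x) + 2 * a * b * (u x \<bullet> v x) + b\<^sup>2 * (v x \<bullet> v x))"
    by (intro Bochner_Integration.integrable_add integrable_mult_right integrable_inner_L2 assms)
  moreover have "(\<lambda>x. a *\<^sub>R u x + b *\<^sub>R v x) \<in> borel_measurable (lebesgue_on \<Omega>)"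
    using assms[THEN L2_measurable] by measurable
  ultimately show ?thesis
    by (simp add: L2_def)
qed

lemma L2_zero: "(\<lambda>x. 0) \<in> L2 \<Omega>"
  by (simp add: L2_def)

lemma l2_inner_commute: "l2_inner \<Omega> u v = l2_inner \<Omega> v u"
  by (simp add: l2_inner_def inner_commute)

lemma l2_inner_cong_AE:
  assumes "u \<in> borel_measurable (lebesgue_on \<Omega>)" "v \<in> borel_measurable (lebesgue_on \<Omega>)"
    "w \<in> borel_measurable (lebesgue_on \<Omega>)" "AE x in lebesgue_on \<Omega>. u x = v x"
  shows "l2_inner \<Omega> u w = l2_inner \<Omega> v w"
  unfolding l2_inner_def
proof (rule integral_cong_AE)
  show "(\<lambda>x. u x \<bullet> w x) \<in> borel_measurable (lebesgue_on \<Omega>)"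
    "(\<lambda>x. v x \<bullet> w x) \<in> borel_measurable (lebesgue_on \<Omega>)"
    using assms by measurable
  show "AE x in lebesgue_on \<Omega>. u x \<bullet> w x = v x \<bullet> w x"
    using assms(4) by (auto elim: AE_mp)
qed

lemma l2_inner_lincomb_left:
  assumes "u \<in> L2 \<Omega>" "v \<in> L2 \<Omega>" "w \<in> L2 \<Omega>"
  shows "l2_inner \<Omega> (\<lambda>x. a *\<^sub>R u x + b *\<^sub>R v x) w = a * l2_inner \<Omega> u w + b * l2_inner \<Omega> v w"
  unfolding l2_inner_def
  by (simp add: inner_add_left integrable_inner_L2 assms)

lemma l2_inner_lincomb_left_AE:
  assumes "u \<in> L2 \<Omega>" "v \<in> L2 \<Omega>" "w \<in> L2 \<Omega>" "y \<in> L2 \<Omega>"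
    "AE x in lebesgue_on \<Omega>. y x = a *\<^sub>R u x + b *\<^sub>R v x"
  shows "l2_inner \<Omega> y w = a * l2_inner \<Omega> u w + b * l2_inner \<Omega> v w"
  using l2_inner_cong_AE[of y \<Omega> "\<lambda>x. a *\<^sub>R u x + b *\<^sub>R v x" w] l2_inner_lincomb_left[of u \<Omega> v w a b]
    L2_lincomb[of u \<Omega> v a b] assms
  by (simp add: L2_measurable)

lemma l2_inner_self_nonneg: "0 \<le> l2_inner \<Omega> u u"
  unfolding l2_inner_def by simp

lemma l2_norm_nonneg [simp]: "0 \<le> l2_norm \<Omega> u"
  by (simp add: l2_norm_def l2_inner_self_nonneg)

lemma l2_norm_squared: "(l2_norm \<Omega> u)\<^sup>2 = l2_inner \<Omega> u u"
  by (simp add: l2_norm_def l2_inner_self_nonneg)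

lemma l2_inner_lincomb_self:
  assumes "u \<in> L2 \<Omega>" "v \<in> L2 \<Omega>"
  shows "l2_inner \<Omega> (\<lambda>x. a *\<^sub>R u x + b *\<^sub>R v x) (\<lambda>x. a *\<^sub>R u x + b *\<^sub>R v x)
     = a\<^sup>2 * l2_inner \<Omega> u u + 2 * a * b * l2_inner \<Omega> u v + b\<^sup>2 * l2_inner \<Omega> v v"
proof -
  note L = L2_lincomb[OF assms, of a b]
  show ?thesis
    using l2_inner_lincomb_left[OF assms L, of a b]
      l2_inner_lincomb_left[OF assms assms(1), of a b] l2_inner_lincomb_left[OF assms assms(2), of a b]
    by (simp add: l2_inner_commute[of \<Omega> u "\<lambda>x. a *\<^sub>R u x + b *\<^sub>R v x"]
        l2_inner_commute[of \<Omega> v "\<lambda>x. a *\<^sub>R u x + b *\<^sub>R v x"] l2_inner_commute[of \<Omega> v u]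
        power2_eq_square algebra_simps)
qed

text \<open>The usual discriminant argument.  Since \<open>l2_inner\<close> is only positive semidefinite on functions,
  the case of a null vector \<open>v\<close> is treated separately.\<close>

lemma l2_Cauchy_Schwarz:
  assumes "u \<in> L2 \<Omega>" "v \<in> L2 \<Omega>"
  shows "\<bar>l2_inner \<Omega> u v\<bar> \<le> l2_norm \<Omega> u * l2_norm \<Omega> v"
proof -
  define A B C where "A = l2_inner \<Omega> u u" and "B = l2_inner \<Omega> u v" and "C = l2_inner \<Omega> v v"
  have q: "0 \<le> a\<^sup>2 * A + 2 * a * b * B + b\<^sup>2 * C" for a b
    using l2_inner_lincomb_self[OF assms, of a b]
      l2_inner_self_nonneg[of \<Omega> "\<lambda>x. a *\<^sub>R u x + b *\<^sub>R v x"]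
    by (simp add: A_def B_def C_def)
  have A: "0 \<le> A" and C: "0 \<le> C" by (simp_all add: A_def C_def l2_inner_self_nonneg)
  have "B\<^sup>2 \<le> A * C"
  proof (cases "C = 0")
    case True
    have "B = 0"
    proof (rule ccontr)
      assume "B \<noteq> 0"
      then show False
        using q[of 1 "- (A + 1) / (2 * B)"] A True by (simp add: field_simps)
    qed
    then show ?thesis using True by simp
  next
    case False
    then have "0 < C" using C by simp
    have "0 \<le> C * (A * C - B\<^sup>2)"
      using q[of C "- B"] by (simp add: power2_eq_square algebra_simps)
    then show ?thesis using \<open>0 < C\<close> by (simp add: zero_le_mult_iff)
  qed
  then have "\<bar>B\<bar> \<le> sqrt (A * C)" using real_le_rsqrt[of "\<bar>B\<bar>" "A * C"] by simp
  then show ?thesis by (simp add: l2_norm_def real_sqrt_mult A_def B_def C_def)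
qed

lemma l2_norm_triangle:
  assumes "u \<in> L2 \<Omega>" "v \<in> L2 \<Omega>"
  shows "l2_norm \<Omega> (\<lambda>x. u x + v x) \<le> l2_norm \<Omega> u + l2_norm \<Omega> v"
proof (rule power2_le_imp_le)
  have "(l2_norm \<Omega> (\<lambda>x. u x + v x))\<^sup>2 = l2_inner \<Omega> u u + 2 * l2_inner \<Omega> u v + l2_inner \<Omega> v v"
    using l2_inner_lincomb_self[OF assms, of 1 1] by (simp add: l2_norm_squared)
  also have "\<dots> \<le> (l2_norm \<Omega> u)\<^sup>2 + 2 * (l2_norm \<Omega> u * l2_norm \<Omega> v) + (l2_norm \<Omega> v)\<^sup>2"
    using l2_Cauchy_Schwarz[OF assms] by (simp add: l2_norm_squared)
  also have "\<dots> = (l2_norm \<Omega> u + l2_norm \<Omega> v)\<^sup>2" by (simp add: power2_sum)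
  finally show "(l2_norm \<Omega> (\<lambda>x. u x + v x))\<^sup>2 \<le> (l2_norm \<Omega> u + l2_norm \<Omega> v)\<^sup>2" .
qed (simp add: l2_norm_nonneg)

lemma l2_norm_diff_commute: "l2_norm \<Omega> (\<lambda>x. u x - v x) = l2_norm \<Omega> (\<lambda>x. v x - u x)"
  by (simp add: l2_norm_def l2_inner_def inner_diff_left inner_diff_right inner_commute algebra_simps)

section \<open>Smooth bump functions supported in boxes\<close>

text \<open>Only \<open>p = 1\<close>, \<open>k = 0\<close> is of interest; the polynomial and the negative power of
  \<open>(t - a) * (b - t)\<close> make the family closed under differentiation.\<close>

definition bump_factor :: "real \<Rightarrow> real \<Rightarrow> real \<Rightarrow> real poly \<Rightarrow> nat \<Rightarrow> real \<Rightarrow> real" where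
  "bump_factor a b c p k t =
     (if a < t \<and> t < b
      then poly p t * inverse ((t - a) * (b - t)) ^ k * exp (- c / ((t - a) * (b - t))) else 0)"

lemma power_le_fact_mult_exp:
  fixes y :: real
  assumes "0 \<le> y"
  shows "y ^ n \<le> fact n * exp y"
proof -
  have "(\<Sum>k\<in>{n}. y ^ k /\<^sub>R fact k) \<le> (\<Sum>k. y ^ k /\<^sub>R fact k)"
    using assms by (intro sum_le_suminf summable_exp_generic) auto
  then have "y ^ n / fact n \<le> exp y" by (simp add: exp_def divide_inverse_commute)
  then show ?thesis by (simp add: field_simps)
qed

text \<open>The exponential beats every negative power of \<open>r = (t - a) * (b - t)\<close>, so the function is even
  bounded by a multiple of \<open>r\<^sup>2\<close>; this gives derivative zero at the end points.\<close>

lemma bump_factor_quadratic_bound: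
  assumes "0 < c"
  obtains C where "\<And>t x. \<not> (a < x \<and> x < b) \<Longrightarrow> \<bar>bump_factor a b c p k t\<bar> \<le> C * (t - x)\<^sup>2"
proof -
  obtain P where P: "\<And>t. t \<in> {a..b} \<Longrightarrow> \<bar>poly p t\<bar> \<le> P"
  proof -
    have "compact (poly p ` {a..b})"
      by (intro compact_continuous_image continuous_intros compact_Icc)
    then obtain P where "\<forall>y\<in>poly p ` {a..b}. norm y \<le> P"
      using bounded_iff compact_imp_bounded by blast
    then show ?thesis using that[of P] by simp
  qed
  define F where "F = fact (k + 2) / c ^ (k + 2)"
  have F: "0 \<le> F" using assms by (simp add: F_def)
  show ?thesis
  proof (rule that[of "\<bar>P\<bar> * F * (b - a)\<^sup>2"])
    fix t x assume x: "\<not> (a < x \<and> x < b)"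
    show "\<bar>bump_factor a b c p k t\<bar> \<le> \<bar>P\<bar> * F * (b - a)\<^sup>2 * (t - x)\<^sup>2"
    proof (cases "a < t \<and> t < b")
      case False
      then have "bump_factor a b c p k t = 0" by (simp only: bump_factor_def if_False)
      then show ?thesis using F by simp
    next
      case True
      define r where "r = (t - a) * (b - t)"
      have r: "0 < r" using True by (simp add: r_def)
      have "(c / r) ^ (k + 2) \<le> fact (k + 2) * exp (c / r)"
        using assms r by (intro power_le_fact_mult_exp) simp
      then have "c ^ (k + 2) \<le> fact (k + 2) * exp (c / r) * r ^ (k + 2)"
        using r by (simp add: power_divide divide_le_eq del: power_Suc)
      then have "c ^ (k + 2) * exp (- c / r) \<le> fact (k + 2) * exp (c / r) * r ^ (k + 2) * exp (- c / r)"
        by (intro mult_right_mono) auto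
      also have "\<dots> = fact (k + 2) * r ^ (k + 2) * (exp (c / r) * exp (- c / r))" by (simp only: mult_ac)
      also have "exp (c / r) * exp (- c / r) = 1" by (simp flip: exp_add)
      finally have "exp (- c / r) * c ^ (k + 2) \<le> fact (k + 2) * r ^ (k + 2)" by (simp only: mult.commute mult_1)
      then have "exp (- c / r) \<le> fact (k + 2) * r ^ (k + 2) / c ^ (k + 2)"
        using assms by (intro mult_imp_le_div_pos) simp_all
      then have "exp (- c / r) \<le> F * r ^ (k + 2)" by (simp only: F_def times_divide_eq_left)
      then have "inverse r ^ k * exp (- c / r) \<le> inverse r ^ k * (F * r ^ (k + 2))"
        using r by (intro mult_left_mono) auto
      also have "\<dots> = F * r\<^sup>2 * (inverse r * r) ^ k"
        by (simp only: power_add power_mult_distrib mult_ac)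
      also have "\<dots> = F * r\<^sup>2" using r by simp
      finally have 1: "inverse r ^ k * exp (- c / r) \<le> F * r\<^sup>2" .
      have "r \<le> (b - a) * \<bar>t - x\<bar>"
      proof (cases "x \<le> a")
        case True': True
        have "(t - a) * (b - t) \<le> \<bar>t - x\<bar> * (b - a)"
          using True True' by (intro mult_mono) auto
        then show ?thesis by (simp add: r_def mult.commute)
      next
        case False
        have "(t - a) * (b - t) \<le> (b - a) * \<bar>t - x\<bar>"
          using True False x by (intro mult_mono) auto
        then show ?thesis by (simp add: r_def)
      qed
      then have "r\<^sup>2 \<le> ((b - a) * \<bar>t - x\<bar>)\<^sup>2" using r by (intro power_mono) auto
      then have 2: "r\<^sup>2 \<le> (b - a)\<^sup>2 * (t - x)\<^sup>2" by (simp add: power_mult_distrib)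
      have "\<bar>bump_factor a b c p k t\<bar> = \<bar>poly p t\<bar> * (inverse r ^ k * exp (- c / r))"
        using True r by (simp add: bump_factor_def r_def abs_mult)
      also have "\<dots> \<le> \<bar>P\<bar> * (F * r\<^sup>2)"
        using P[of t] True r by (intro mult_mono[OF _ 1]) auto
      also have "\<dots> \<le> \<bar>P\<bar> * (F * ((b - a)\<^sup>2 * (t - x)\<^sup>2))"
        using 2 F by (intro mult_left_mono) auto
      finally show ?thesis by (simp add: mult_ac)
    qed
  qed
qed

lemma bump_factor_has_derivative:
  assumes "0 < c"
  shows "\<exists>q l. \<forall>t. (bump_factor a b c p k has_real_derivative bump_factor a b c q l t) (at t)"
proof -
  define R where "R = [:- a, 1:] * [:b, - 1:]"
  define q where "q = pderiv p * R ^ 2 - smult (of_nat k) (p * R * pderiv R) + smult c (p * pderiv R)"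
  have R: "poly R t = (t - a) * (b - t)" for t by (simp add: R_def algebra_simps)
  have "(bump_factor a b c p k has_real_derivative bump_factor a b c q (k + 2) t) (at t)" for t
  proof (cases "a < t \<and> t < b")
    case True
    define r where "r = poly R t"
    have r: "r > 0" using True by (simp add: R r_def)
    define i p' R' e where "i = inverse r" and "p' = poly (pderiv p) t" and "R' = poly (pderiv R) t"
      and "e = exp (- c * i)"
    have ri: "r * i = 1" using r by (simp add: i_def)
    have dI: "((\<lambda>t. inverse (poly R t)) has_real_derivative - (i * R' * i)) (at t)"
      using DERIV_inverse'[OF poly_DERIV[of R t]] r by (simp add: i_def r_def R'_def)
    have dE: "((\<lambda>t. exp (- c * inverse (poly R t))) has_real_derivative e * (- c * - (i * R' * i))) (at t)"
      using DERIV_chain2[OF DERIV_exp DERIV_cmult[OF dI, of "- c"]] by (simp add: e_def i_def r_def)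
    have "((\<lambda>t. poly p t * inverse (poly R t) ^ k * exp (- c * inverse (poly R t))) has_real_derivative
        (p' * i ^ k + (real k * (- (i * R' * i) * i ^ (k - Suc 0))) * poly p t) * e
          + (e * (- c * - (i * R' * i))) * (poly p t * i ^ k)) (at t)"
      using DERIV_mult[OF DERIV_mult[OF poly_DERIV[of p t] DERIV_power[OF dI, of k]] dE]
      by (simp add: i_def r_def p'_def e_def)
    also have "(p' * i ^ k + (real k * (- (i * R' * i) * i ^ (k - Suc 0))) * poly p t) * e
          + (e * (- c * - (i * R' * i))) * (poly p t * i ^ k)
        = poly q t * i ^ (k + 2) * e"
    proof -
      have k: "real k * (i * i ^ (k - Suc 0)) = real k * i ^ k" by (cases k) simp_all
      have "poly q t * i\<^sup>2 = p' * (r * i)\<^sup>2 - real k * poly p t * R' * (r * i) * i + c * poly p t * R' * i\<^sup>2"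
        by (simp add: q_def p'_def R'_def r_def power2_eq_square algebra_simps)
      also have "\<dots> = p' - real k * poly p t * R' * i + c * poly p t * R' * i\<^sup>2"
        by (simp add: ri)
      finally have "poly q t * i ^ (k + 2) * e
          = (p' - real k * poly p t * R' * i + c * poly p t * R' * i\<^sup>2) * i ^ k * e"
        by (metis mult.assoc mult.commute power_add)
      also have "\<dots> = (p' * i ^ k - (real k * i ^ k) * poly p t * R' * i + c * poly p t * R' * i\<^sup>2 * i ^ k) * e"
        by (simp add: algebra_simps)
      also have "\<dots> = (p' * i ^ k + (real k * (- (i * R' * i) * i ^ (k - Suc 0))) * poly p t) * e
          + (e * (- c * - (i * R' * i))) * (poly p t * i ^ k)"
        unfolding k[symmetric] by (simp add: algebra_simps power2_eq_square)
      finally show ?thesis ..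
    qed
    finally have "((\<lambda>t. poly p t * inverse (poly R t) ^ k * exp (- c / poly R t)) has_real_derivative
        poly q t * inverse r ^ (k + 2) * exp (- c / r)) (at t)"
      by (simp only: divide_inverse i_def e_def)
    then have "((\<lambda>t. poly p t * inverse (poly R t) ^ k * exp (- c / poly R t)) has_real_derivative
        bump_factor a b c q (k + 2) t) (at t)"
      using True by (simp add: bump_factor_def r_def R)
    then show ?thesis
    proof (rule has_field_derivative_transform_within_open[where S = "{a<..<b}"])
      show "t \<in> {a<..<b}" using True by simp
    qed (auto simp: bump_factor_def R)
  next
    case False
    obtain C where C: "\<And>t x. \<not> (a < x \<and> x < b) \<Longrightarrow> \<bar>bump_factor a b c p k t\<bar> \<le> C * (t - x)\<^sup>2"
      using bump_factor_quadratic_bound[OF assms] by metis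
    have 0: "bump_factor a b c q l t = 0" for q l using False by (simp only: bump_factor_def if_False)
    have "(\<lambda>h. (bump_factor a b c p k (t + h) - bump_factor a b c p k t) / h) \<midarrow>0\<rightarrow> 0"
    proof (rule Lim_null_comparison)
      show "\<forall>\<^sub>F h in at 0. norm ((bump_factor a b c p k (t + h) - bump_factor a b c p k t) / h) \<le> C * \<bar>h\<bar>"
      proof (rule eventuallyI)
        fix h :: real
        have "\<bar>bump_factor a b c p k (t + h)\<bar> \<le> C * h\<^sup>2" using C[OF False, of "t + h"] by simp
        then show "norm ((bump_factor a b c p k (t + h) - bump_factor a b c p k t) / h) \<le> C * \<bar>h\<bar>"
          by (cases "h = 0") (simp_all add: 0 abs_divide divide_le_eq power2_eq_square mult.assoc)
      qed
      show "((\<lambda>h. C * \<bar>h\<bar>) \<longlongrightarrow> 0) (at 0)" by (auto intro!: tendsto_eq_intros)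
    qed
    then show ?thesis by (simp only: DERIV_def 0)
  qed
  then show ?thesis by blast
qed

text \<open>A partial derivative of a product of functions of single coordinates changes only one
  factor, so smoothness reduces to one dimension.  The classes \<open>\<K> i\<close> are those from which
  the \<open>i\<close>-th factor is taken.\<close>

lemma tensor_product_iter_pderiv:
  fixes s :: "'n::finite \<Rightarrow> real \<Rightarrow> real" and \<K> :: "'n \<Rightarrow> (real \<Rightarrow> real) set"
  assumes closed: "\<And>i f. f \<in> \<K> i \<Longrightarrow> \<exists>f'\<in>\<K> i. \<forall>t. (f has_real_derivative f' t) (at t)"
    and "\<And>i. s i \<in> \<K> i"
  shows "\<exists>s'. (\<forall>i. s' i \<in> \<K> i) \<and> iter_pderiv js (\<lambda>x. \<Prod>i\<in>UNIV. s i (x $ i)) = (\<lambda>x. \<Prod>i\<in>UNIV. s' i (x $ i))"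
    and "iter_pderiv js (\<lambda>x. \<Prod>i\<in>UNIV. s i (x $ i)) differentiable (at x)"
proof -
  have deriv: "\<exists>g. (\<forall>i. g i \<in> \<K> i) \<and> (\<forall>x. ((\<lambda>x. \<Prod>i\<in>UNIV. f i (x $ i)) has_derivative
       (\<lambda>y. \<Sum>i\<in>UNIV. g i (x $ i) * y $ i * (\<Prod>j\<in>UNIV - {i}. f j (x $ j)))) (at x))"
    if f: "\<And>i. f i \<in> \<K> i" for f
  proof -
    obtain g where g: "\<And>i. g i \<in> \<K> i" "\<And>i t. (f i has_real_derivative g i t) (at t)"
      using bchoice[of UNIV "\<lambda>i f'. f' \<in> \<K> i \<and> (\<forall>t. (f i has_real_derivative f' t) (at t))"] closed[OF f]
      by blast
    have "((\<lambda>x. f i (x $ i)) has_derivative (\<lambda>y. g i (x $ i) * y $ i)) (at x)" for i x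
    proof -
      have "((\<lambda>x. x $ i) has_derivative (\<lambda>y. y $ i)) (at x)"
        by (intro bounded_linear_imp_has_derivative bounded_linear_vec_nth)
      from has_derivative_compose[OF this g(2)[of i "x $ i", unfolded has_field_derivative_def]]
      show ?thesis .
    qed
    then have "((\<lambda>x. \<Prod>i\<in>UNIV. f i (x $ i)) has_derivative
       (\<lambda>y. \<Sum>i\<in>UNIV. g i (x $ i) * y $ i * (\<Prod>j\<in>UNIV - {i}. f j (x $ j)))) (at x)" for x
      by (intro has_derivative_prod) 
    then show ?thesis using g(1) by blast
  qed
  have step: "\<exists>s'. (\<forall>i. s' i \<in> \<K> i) \<and> pderiv_at j (\<lambda>x. \<Prod>i\<in>UNIV. f i (x $ i)) = (\<lambda>x. \<Prod>i\<in>UNIV. s' i (x $ i))"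
    if f: "\<And>i. f i \<in> \<K> i" for f j
  proof -
    obtain g where g: "\<And>i. g i \<in> \<K> i" "\<And>x. ((\<lambda>x. \<Prod>i\<in>UNIV. f i (x $ i)) has_derivative
       (\<lambda>y. \<Sum>i\<in>UNIV. g i (x $ i) * y $ i * (\<Prod>j\<in>UNIV - {i}. f j (x $ j)))) (at x)"
      using deriv[OF f] by blast
    have "pderiv_at j (\<lambda>x. \<Prod>i\<in>UNIV. f i (x $ i)) x = (\<Prod>i\<in>UNIV. (f(j := g j)) i (x $ i))" for x
    proof -
      have "pderiv_at j (\<lambda>x. \<Prod>i\<in>UNIV. f i (x $ i)) x
          = (\<Sum>i\<in>UNIV. g i (x $ i) * axis j 1 $ i * (\<Prod>j\<in>UNIV - {i}. f j (x $ j)))"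
        unfolding pderiv_at_def by (simp add: frechet_derivative_at[OF g(2), symmetric])
      also have "\<dots> = (\<Sum>i\<in>UNIV. if i = j then g j (x $ j) * (\<Prod>i\<in>UNIV - {j}. f i (x $ i)) else 0)"
        by (intro sum.cong) (auto simp: axis_def)
      also have "\<dots> = g j (x $ j) * (\<Prod>i\<in>UNIV - {j}. f i (x $ i))" by simp
      also have "\<dots> = (\<Prod>i\<in>UNIV. (f(j := g j)) i (x $ i))"
        by (subst prod.remove[of UNIV j]) auto
      finally show ?thesis .
    qed
    then have "(\<forall>i. (f(j := g j)) i \<in> \<K> i) \<and> pderiv_at j (\<lambda>x. \<Prod>i\<in>UNIV. f i (x $ i)) = (\<lambda>x. \<Prod>i\<in>UNIV. (f(j := g j)) i (x $ i))"
      using f g(1) by auto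
    then show ?thesis by blast
  qed
  show *: "\<exists>s'. (\<forall>i. s' i \<in> \<K> i) \<and> iter_pderiv js (\<lambda>x. \<Prod>i\<in>UNIV. s i (x $ i)) = (\<lambda>x. \<Prod>i\<in>UNIV. s' i (x $ i))"
  proof (induction js)
    case Nil
    then show ?case using assms(2) by (auto intro!: exI[of _ s])
  next
    case (Cons j js)
    then show ?case using step by fastforce
  qed
  then obtain s' where s': "\<And>i. s' i \<in> \<K> i"
    "iter_pderiv js (\<lambda>x. \<Prod>i\<in>UNIV. s i (x $ i)) = (\<lambda>x. \<Prod>i\<in>UNIV. s' i (x $ i))" by blast
  then show "iter_pderiv js (\<lambda>x. \<Prod>i\<in>UNIV. s i (x $ i)) differentiable (at x)"
    using deriv[OF s'(1)] unfolding differentiable_def s'(2) by blast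
qed

definition box_bump :: "real^'n \<Rightarrow> real^'n \<Rightarrow> real \<Rightarrow> real^'n \<Rightarrow> real" where
  "box_bump a b c x = (\<Prod>i\<in>UNIV. bump_factor (a $ i) (b $ i) c 1 0 (x $ i))"

lemma box_bump_inside: "x \<in> box a b \<Longrightarrow>
    box_bump a b c x = (\<Prod>i\<in>UNIV. exp (- c / ((x $ i - a $ i) * (b $ i - x $ i))))"
  by (simp add: box_bump_def bump_factor_def mem_box_cart)

lemma box_bump_outside: "x \<notin> box a b \<Longrightarrow> box_bump a b c x = 0"
  by (auto simp: box_bump_def bump_factor_def mem_box_cart)

lemma box_bump_bounds:
  assumes "0 < c"
  shows "0 \<le> box_bump a b c x" "box_bump a b c x \<le> 1"
  using assms
  by (auto simp: box_bump_def bump_factor_def intro!: prod_nonneg prod_le_1)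

lemma test_function_box_bump:
  fixes a b :: "real^'n"
  assumes "0 < c" "cbox a b \<subseteq> \<Omega>"
  shows "test_function \<Omega> (box_bump a b c)"
proof -
  define \<K> where "\<K> i = {bump_factor (a $ i) (b $ i) c p k | p k. True}" for i
  have "iter_pderiv js (box_bump a b c) differentiable (at x)" for js x
    unfolding box_bump_def
  proof (rule tensor_product_iter_pderiv(2)[of \<K>])
    show "\<exists>f'\<in>\<K> i. \<forall>t. (f has_real_derivative f' t) (at t)" if "f \<in> \<K> i" for i f
      using that bump_factor_has_derivative[OF assms(1)] unfolding \<K>_def by blast
    show "bump_factor (a $ i) (b $ i) c 1 0 \<in> \<K> i" for i unfolding \<K>_def by blast
  qed
  moreover have "{x. box_bump a b c x \<noteq> 0} \<subseteq> cbox a b"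
    using box_bump_outside[of _ a b c] box_subset_cbox[of a b] by blast
  then have supp: "closure {x. box_bump a b c x \<noteq> 0} \<subseteq> cbox a b"
    by (rule closure_minimal) (rule closed_cbox)
  moreover have "compact (closure {x. box_bump a b c x \<noteq> 0})"
    using bounded_subset[OF bounded_cbox supp] by (simp add: compact_eq_bounded_closed)
  ultimately show ?thesis using assms(2) unfolding test_function_def by blast
qed

lemma box_bump_tendsto_indicator:
  "(\<lambda>m. box_bump a b (1 / real (Suc m)) x) \<longlonglongrightarrow> indicator (box a b) x"
proof (cases "x \<in> box a b")
  case True
  have 0: "(\<lambda>m. 1 / real (Suc m)) \<longlonglongrightarrow> 0"
    by (rule LIMSEQ_Suc[OF lim_1_over_n])
  have lim: "(\<lambda>m. exp (- (1 / real (Suc m)) / r)) \<longlonglongrightarrow> 1" if "r \<noteq> 0" for r :: real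
    using tendsto_exp[OF tendsto_divide[OF tendsto_minus[OF 0] tendsto_const[of r] that]] by simp
  have "(\<lambda>m. \<Prod>i\<in>UNIV. exp (- (1 / real (Suc m)) / ((x $ i - a $ i) * (b $ i - x $ i))))
      \<longlonglongrightarrow> (\<Prod>i\<in>(UNIV::'a set). 1)"
  proof (intro tendsto_prod)
    fix i
    have "(x $ i - a $ i) * (b $ i - x $ i) \<noteq> 0" using True by (auto simp: mem_box_cart dest: spec[of _ i])
    from lim[OF this] show "(\<lambda>m. exp (- (1 / real (Suc m)) / ((x $ i - a $ i) * (b $ i - x $ i)))) \<longlonglongrightarrow> 1" .
  qed
  then show ?thesis using True by (simp only: box_bump_inside indicator_simps prod.neutral_const)
next
  case False
  then show ?thesis by (simp add: box_bump_outside)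
qed

section \<open>The fundamental lemma and the linearity of weak derivatives\<close>

text \<open>Boxes form an intersection-stable generator of the Borel sets, and Lebesgue sets differ from
  Borel sets by null sets, so the integral of \<open>h\<close> vanishes over every Lebesgue set.\<close>

lemma integral_zero_on_boxes_imp_AE_zero:
  fixes h :: "'a::euclidean_space \<Rightarrow> real"
  assumes h: "integrable lebesgue h" and box: "\<And>a b. (\<integral>x. indicator (box a b) x * h x \<partial>lebesgue) = 0"
    and UNIV: "integral\<^sup>L lebesgue h = 0"
  shows "AE x in lebesgue. h x = 0"
proof (rule density_unique_real[OF h, of "\<lambda>x. 0"])
  show "integrable lebesgue (\<lambda>x::'a. 0::real)" by simp
  have borel: "(\<integral>x. indicator A x * h x \<partial>lebesgue) = 0" if A: "A \<in> sets borel" for A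
  proof -
    have int: "integrable lebesgue (\<lambda>x. indicator A x * h x)" if "A \<in> sets borel" for A
      using integrable_mult_indicator[OF _ h, of A] that by simp
    have "Int_stable (range (\<lambda>(a, b). box a b :: 'a set))"
      by (auto simp: Int_stable_def box_Int_box)
    moreover have "range (\<lambda>(a, b). box a b :: 'a set) \<subseteq> Pow UNIV" by simp
    moreover have "A \<in> sigma_sets UNIV (range (\<lambda>(a, b). box a b))"
      using A unfolding borel_eq_box by simp
    ultimately show ?thesis
    proof (induction rule: sigma_sets_induct_disjoint)
      case (basic A)
      then show ?case using box by auto
    next
      case empty
      then show ?case by simp
    next
      case (compl A)
      then have "A \<in> sets borel" by (simp add: borel_eq_box)
      have "(\<integral>x. indicator (UNIV - A) x * h x \<partial>lebesgue) = (\<integral>x. h x - indicator A x * h x \<partial>lebesgue)"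
        by (intro Bochner_Integration.integral_cong) (auto simp: indicator_def)
      also have "\<dots> = 0" using compl UNIV h int[OF \<open>A \<in> sets borel\<close>] by simp
      finally show ?case .
    next
      case (union F)
      then have F: "F i \<in> sets borel" for i by (auto simp: borel_eq_box)
      have "(LINT x:(\<Union>i. F i)|lebesgue. h x) = (\<Sum>i. (LINT x:(F i)|lebesgue. h x))"
      proof (rule lebesgue_integral_countable_add)
        show "F i \<in> sets lebesgue" for i using F by simp
        show "F i \<inter> F j = {}" if "i \<noteq> j" for i j using union(1) that by (auto simp: disjoint_family_on_def)
        have "(\<Union>i. F i) \<in> sets borel" using F by blast
        then show "set_integrable lebesgue (\<Union>i. F i) h" using int by (simp add: set_integrable_def)
      qed
      then show ?case using union(3) by (simp add: set_lebesgue_integral_def)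
    qed
  qed
  fix A :: "'a set" assume "A \<in> sets lebesgue"
  then obtain C T where CT: "fsigma C" "T \<in> null_sets lebesgue" "C \<union> T = A" "disjnt C T"
    by (rule lebesgue_set_almost_fsigma)
  have C: "C \<in> sets borel" using CT(1)
  proof cases
    case (1 F)
    then have "F n \<in> sets borel" for n by (auto intro: borel_closed)
    then show ?thesis unfolding \<open>C = \<Union> (range F)\<close> by blast
  qed
  have "(\<integral>x. indicator A x * h x \<partial>lebesgue) = (\<integral>x. indicator C x * h x \<partial>lebesgue)"
  proof (rule integral_cong_AE)
    show "(\<lambda>x. indicator A x * h x) \<in> borel_measurable lebesgue"
      "(\<lambda>x. indicator C x * h x) \<in> borel_measurable lebesgue"
      using h C \<open>A \<in> sets lebesgue\<close> by (auto intro!: borel_measurable_times borel_measurable_indicator)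
    show "AE x in lebesgue. indicator A x * h x = indicator C x * h x"
      using AE_not_in[OF CT(2)] by eventually_elim (use CT(3) in \<open>auto simp: indicator_def\<close>)
  qed
  then show "set_lebesgue_integral lebesgue A h = set_lebesgue_integral lebesgue A (\<lambda>x. 0)"
    using borel[OF C] by (simp add: set_lebesgue_integral_def)
qed

text \<open>Testing with bumps that increase to the indicator of a box shows that \<open>g\<close> has integral zero
  over every box whose closure lies in \<open>\<Omega>\<close>; countably many closed boxes cover \<open>\<Omega>\<close>.\<close>

theorem fundamental_lemma_calculus_of_variations:
  fixes g :: "real^'n \<Rightarrow> real"
  assumes "open \<Omega>" and g: "integrable (lebesgue_on \<Omega>) g"
    and test: "\<And>\<phi>. test_function \<Omega> \<phi> \<Longrightarrow> l2_inner \<Omega> g \<phi> = 0"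
  shows "AE x in lebesgue_on \<Omega>. g x = 0"
proof -
  have \<Omega>: "\<Omega> \<in> sets lebesgue" using \<open>open \<Omega>\<close> by simp
  define h where "h x = indicator \<Omega> x * g x" for x
  have h: "integrable lebesgue h"
    using g \<Omega> by (simp add: h_def[abs_def] integrable_restrict_space)
  have box_zero: "(\<integral>x. indicator (box a b) x * h x \<partial>lebesgue) = 0" if ab: "cbox a b \<subseteq> \<Omega>" for a b
  proof -
    have "(\<lambda>m. l2_inner \<Omega> g (box_bump a b (1 / real (Suc m))))
        \<longlonglongrightarrow> (\<integral>x. g x * indicator (box a b) x \<partial>lebesgue_on \<Omega>)"
      unfolding l2_inner_def inner_real_def
    proof (rule integral_dominated_convergence[where w = "\<lambda>x. \<bar>g x\<bar>"])
      have gm: "g \<in> borel_measurable (lebesgue_on \<Omega>)" using g by simp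
      have "box a b \<inter> \<Omega> \<in> sets (lebesgue_on \<Omega>)" by (intro sets_restrict_space_iff[THEN iffD2]) (auto simp: \<Omega>)
      then have "indicat_real (box a b) \<in> borel_measurable (lebesgue_on \<Omega>)"
        by (simp add: borel_measurable_indicator_iff Int_commute)
      then show "(\<lambda>x. g x * indicator (box a b) x) \<in> borel_measurable (lebesgue_on \<Omega>)"
        using gm by (rule borel_measurable_times[rotated])
      show "(\<lambda>x. g x * box_bump a b (1 / real (Suc m)) x) \<in> borel_measurable (lebesgue_on \<Omega>)" for m
      proof -
        have "test_function \<Omega> (box_bump a b (1 / real (Suc m)))"
          using ab by (intro test_function_box_bump) auto
        then have "iter_pderiv [] (box_bump a b (1 / real (Suc m))) differentiable at x" for x
          unfolding test_function_def by blast
        then have "continuous_on \<Omega> (box_bump a b (1 / real (Suc m)))"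
          by (intro differentiable_imp_continuous_on) (simp add: differentiable_on_def differentiable_at_withinI)
        then show ?thesis
          using gm continuous_imp_measurable_on_sets_lebesgue[OF _ \<Omega>] by (intro borel_measurable_times)
      qed
      show "integrable (lebesgue_on \<Omega>) (\<lambda>x. \<bar>g x\<bar>)" using g by simp
      show "AE x in lebesgue_on \<Omega>. (\<lambda>m. g x * box_bump a b (1 / real (Suc m)) x) \<longlonglongrightarrow> g x * indicator (box a b) x"
        by (intro AE_I2 tendsto_mult_left box_bump_tendsto_indicator)
      show "AE x in lebesgue_on \<Omega>. norm (g x * box_bump a b (1 / real (Suc m)) x) \<le> \<bar>g x\<bar>" for m
        using box_bump_bounds[of "1 / real (Suc m)" a b]
        by (intro AE_I2) (auto simp: abs_mult intro!: mult_left_le)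
    qed
    moreover have "l2_inner \<Omega> g (box_bump a b (1 / real (Suc m))) = 0" for m
      using ab by (intro test test_function_box_bump) auto
    ultimately have "(\<integral>x. g x * indicator (box a b) x \<partial>lebesgue_on \<Omega>) = 0"
      using LIMSEQ_unique[OF _ tendsto_const] by force
    then show ?thesis
      using \<Omega> by (simp add: integral_restrict_space h_def mult_ac)
  qed
  have cbox: "AE x in lebesgue. x \<in> cbox c d \<longrightarrow> g x = 0" if cd: "cbox c d \<subseteq> \<Omega>" for c d
  proof -
    have "AE x in lebesgue. indicator (box c d) x * h x = 0"
    proof (rule integral_zero_on_boxes_imp_AE_zero)
      show "integrable lebesgue (\<lambda>x. indicator (box c d) x * h x)"
        using integrable_mult_indicator[OF _ h, of "box c d"] by simp
      show "(\<integral>x. indicator (box c d) x * h x \<partial>lebesgue) = 0" by (rule box_zero[OF cd])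
      show "(\<integral>x. indicator (box a b) x * (indicator (box c d) x * h x) \<partial>lebesgue) = 0" for a b
      proof -
        obtain a' b' where ab': "box a b \<inter> box c d = box a' b'" "cbox a b \<inter> cbox c d = cbox a' b'"
          using box_Int_box Int_interval by blast
        have "cbox a' b' \<subseteq> \<Omega>" using ab'(2) cd by blast
        then show ?thesis
          using box_zero[of a' b'] by (simp add: mult.assoc[symmetric] indicator_inter_arith[symmetric] ab'(1))
      qed
    qed
    moreover have "AE x in lebesgue. x \<notin> cbox c d - box c d"
      using negligible_frontier_interval by (intro AE_not_in) (simp add: negligible_iff_null_sets)
    ultimately show ?thesis
    proof eventually_elim
      case (elim x)
      then show ?case using cd by (auto simp: h_def indicator_def split: if_splits)
    qed
  qed
  obtain \<D> where \<D>: "countable \<D>" "\<D> \<subseteq> Pow \<Omega>" "\<And>X. X \<in> \<D> \<Longrightarrow> \<exists>a b. X = cbox a b" "\<Union>\<D> = \<Omega>"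
    using open_countable_Union_open_cbox[OF \<open>open \<Omega>\<close>] by metis
  have "AE x in lebesgue. \<forall>X\<in>\<D>. x \<in> X \<longrightarrow> g x = 0"
  proof (rule AE_ball_countable'[OF _ \<D>(1)])
    fix X assume "X \<in> \<D>"
    then obtain a b where "X = cbox a b" "cbox a b \<subseteq> \<Omega>" using \<D>(2,3) by blast
    then show "AE x in lebesgue. x \<in> X \<longrightarrow> g x = 0" using cbox by simp
  qed
  then have "AE x in lebesgue. x \<in> \<Omega> \<longrightarrow> g x = 0"
    by eventually_elim (use \<D>(4) in blast)
  then show ?thesis using \<Omega> by (simp add: AE_restrict_space_iff)
qed

lemma bounded_L2:
  assumes "open \<Omega>" "bounded \<Omega>" "f \<in> borel_measurable (lebesgue_on \<Omega>)"
    and "AE x in lebesgue_on \<Omega>. norm (f x) \<le> C"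
  shows "f \<in> L2 \<Omega>"
proof -
  interpret finite_measure "lebesgue_on \<Omega>"
    using assms by (intro finite_measure_lebesgue_on lmeasurable_open)
  have "integrable (lebesgue_on \<Omega>) (\<lambda>x. (norm (f x))\<^sup>2)"
  proof (rule integrable_const_bound[of _ "C\<^sup>2"])
    show "AE x in lebesgue_on \<Omega>. norm ((norm (f x))\<^sup>2) \<le> C\<^sup>2"
      using assms(4) by eventually_elim (simp add: power_mono)
    show "(\<lambda>x. (norm (f x))\<^sup>2) \<in> borel_measurable (lebesgue_on \<Omega>)" using assms(3) by measurable
  qed
  then show ?thesis using assms(3) by (simp add: L2_def)
qed

lemma continuous_L2:
  fixes f :: "real^'n \<Rightarrow> 'a::euclidean_space"
  assumes "open \<Omega>" "bounded \<Omega>" "continuous_on UNIV f"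
  shows "f \<in> L2 \<Omega>"
proof -
  have "compact (f ` closure \<Omega>)"
    using assms by (intro compact_continuous_image continuous_on_subset[OF assms(3)]) (auto simp: compact_closure)
  then obtain C where C: "\<And>x. x \<in> closure \<Omega> \<Longrightarrow> norm (f x) \<le> C"
    using compact_imp_bounded bounded_iff by (metis imageI)
  show ?thesis
  proof (rule bounded_L2[OF assms(1,2)])
    show "f \<in> borel_measurable (lebesgue_on \<Omega>)"
      using assms by (intro continuous_imp_measurable_on_sets_lebesgue continuous_on_subset[OF assms(3)]) auto
    show "AE x in lebesgue_on \<Omega>. norm (f x) \<le> C"
      using C closure_subset by (intro AE_I2) auto
  qed
qed

lemma test_function_L2:
  assumes "open \<Omega>" "bounded \<Omega>" "test_function \<Omega> \<phi>"
  shows "\<phi> \<in> L2 \<Omega>" and "pderiv_at j \<phi> \<in> L2 \<Omega>"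
proof -
  have "iter_pderiv js \<phi> differentiable at x" for js x using assms(3) by (simp add: test_function_def)
  from this[of "[]"] this[of "[j]"] have "continuous_on UNIV \<phi>" "continuous_on UNIV (pderiv_at j \<phi>)"
    by (auto intro!: differentiable_imp_continuous_on simp: differentiable_on_def)
  then show "\<phi> \<in> L2 \<Omega>" "pderiv_at j \<phi> \<in> L2 \<Omega>" using assms by (auto intro: continuous_L2)
qed

text \<open>Splitting the integrals needs that a test function and its derivatives are square integrable
  over the bounded set \<open>\<Omega>\<close>.\<close>

lemma has_weak_pderiv_lincomb:
  fixes u :: "real^'n \<Rightarrow> real"
  assumes "open \<Omega>" "bounded \<Omega>" "u \<in> L2 \<Omega>" "v \<in> L2 \<Omega>" "g \<in> L2 \<Omega>" "h \<in> L2 \<Omega>"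
    and "has_weak_pderiv \<Omega> j u g" "has_weak_pderiv \<Omega> j v h"
  shows "has_weak_pderiv \<Omega> j (\<lambda>x. a * u x + b * v x) (\<lambda>x. a * g x + b * h x)"
  unfolding has_weak_pderiv_def
proof (intro allI impI)
  fix \<phi> assume t: "test_function \<Omega> \<phi>"
  note \<phi> = test_function_L2[OF assms(1,2) t]
  show "l2_inner \<Omega> (\<lambda>x. a * u x + b * v x) (pderiv_at j \<phi>) = - l2_inner \<Omega> (\<lambda>x. a * g x + b * h x) \<phi>"
    using l2_inner_lincomb_left[OF assms(3,4) \<phi>(2)[of j], where a = a and b = b] l2_inner_lincomb_left[OF assms(5,6) \<phi>(1), where a = a and b = b]
      assms(7,8) t by (simp add: has_weak_pderiv_def)
qed

lemma L2_integrable: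
  fixes g :: "real^'n \<Rightarrow> real"
  assumes "open \<Omega>" "bounded \<Omega>" "g \<in> L2 \<Omega>"
  shows "integrable (lebesgue_on \<Omega>) g"
  using integrable_inner_L2[OF assms(3) continuous_L2[OF assms(1,2), of "\<lambda>x. 1"]] by simp

lemma has_weak_pderiv_unique:
  fixes u :: "real^'n \<Rightarrow> real"
  assumes "open \<Omega>" "bounded \<Omega>" "g \<in> L2 \<Omega>" "h \<in> L2 \<Omega>"
    and "has_weak_pderiv \<Omega> j u g" "has_weak_pderiv \<Omega> j u h"
  shows "AE x in lebesgue_on \<Omega>. g x = h x"
proof -
  have L: "(\<lambda>x. 1 *\<^sub>R g x + (-1) *\<^sub>R h x) \<in> L2 \<Omega>" using assms by (intro L2_lincomb)
  have "AE x in lebesgue_on \<Omega>. 1 *\<^sub>R g x + (-1) *\<^sub>R h x = 0"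
  proof (rule fundamental_lemma_calculus_of_variations[OF assms(1) L2_integrable[OF assms(1,2) L]])
    fix \<phi> assume t: "test_function \<Omega> \<phi>"
    show "l2_inner \<Omega> (\<lambda>x. 1 *\<^sub>R g x + (-1) *\<^sub>R h x) \<phi> = 0"
      using l2_inner_lincomb_left[OF assms(3,4) test_function_L2(1)[OF assms(1,2) t], of 1 "-1"] assms(5,6) t
      unfolding has_weak_pderiv_def by simp
  qed
  then show ?thesis by simp
qed

lemma weak_pderiv_H1:
  assumes "u \<in> H1 \<Omega>"
  shows "weak_pderiv \<Omega> j u \<in> L2 \<Omega>" "has_weak_pderiv \<Omega> j u (weak_pderiv \<Omega> j u)"
proof -
  have "\<exists>g. g \<in> L2 \<Omega> \<and> has_weak_pderiv \<Omega> j u g" using assms by (auto simp: H1_def)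
  from someI_ex[OF this] show "weak_pderiv \<Omega> j u \<in> L2 \<Omega>" "has_weak_pderiv \<Omega> j u (weak_pderiv \<Omega> j u)"
    by (auto simp: weak_pderiv_def)
qed

lemma
  fixes u :: "real^'n \<Rightarrow> real"
  assumes "open \<Omega>" "bounded \<Omega>" "u \<in> H1 \<Omega>" "v \<in> H1 \<Omega>"
  shows H1_lincomb: "(\<lambda>x. a * u x + b * v x) \<in> H1 \<Omega>"
    and weak_pderiv_lincomb: "AE x in lebesgue_on \<Omega>. weak_pderiv \<Omega> j (\<lambda>x. a * u x + b * v x) x
       = a * weak_pderiv \<Omega> j u x + b * weak_pderiv \<Omega> j v x"
proof -
  have uv: "u \<in> L2 \<Omega>" "v \<in> L2 \<Omega>" using assms by (auto simp: H1_def)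
  note du = weak_pderiv_H1[OF assms(3)] and dv = weak_pderiv_H1[OF assms(4)]
  have d: "(\<lambda>x. a * weak_pderiv \<Omega> i u x + b * weak_pderiv \<Omega> i v x) \<in> L2 \<Omega>" for i
    using L2_lincomb[OF du(1) dv(1)] by simp
  note w = has_weak_pderiv_lincomb[OF assms(1,2) uv du(1) dv(1) du(2) dv(2), where a = a and b = b]
  show H1: "(\<lambda>x. a * u x + b * v x) \<in> H1 \<Omega>"
    using L2_lincomb[OF uv, of a b] d w unfolding H1_def by auto
  note dw = weak_pderiv_H1[OF H1]
  show "AE x in lebesgue_on \<Omega>. weak_pderiv \<Omega> j (\<lambda>x. a * u x + b * v x) x
       = a * weak_pderiv \<Omega> j u x + b * weak_pderiv \<Omega> j v x"
    by (rule has_weak_pderiv_unique[OF assms(1,2) dw(1) d dw(2) w])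
qed

lemma
  fixes \<Omega> :: "(real^'n) set"
  assumes "open \<Omega>" "bounded \<Omega>"
  shows zero_H10: "(\<lambda>x. 0) \<in> H10 \<Omega>"
    and l2_norm_weak_pderiv_zero: "l2_norm \<Omega> (weak_pderiv \<Omega> j (\<lambda>x. 0)) = 0"
proof -
  have wd: "has_weak_pderiv \<Omega> j (\<lambda>x. 0) (\<lambda>x. 0)" for j by (simp add: has_weak_pderiv_def l2_inner_def)
  then have H1: "(\<lambda>x. 0) \<in> H1 \<Omega>" using L2_zero unfolding H1_def by blast
  have norm: "l2_norm \<Omega> (weak_pderiv \<Omega> j (\<lambda>x. 0)) = 0" for j
  proof -
    have "AE x in lebesgue_on \<Omega>. weak_pderiv \<Omega> j (\<lambda>x. 0) x = 0"
      by (rule has_weak_pderiv_unique[OF assms weak_pderiv_H1(1)[OF H1] L2_zero weak_pderiv_H1(2)[OF H1] wd])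
    then have "l2_inner \<Omega> (weak_pderiv \<Omega> j (\<lambda>x. 0)) (weak_pderiv \<Omega> j (\<lambda>x. 0)) = l2_inner \<Omega> (\<lambda>x. 0) (weak_pderiv \<Omega> j (\<lambda>x. 0))"
      by (intro l2_inner_cong_AE L2_measurable weak_pderiv_H1(1)[OF H1] L2_zero)
    then show ?thesis by (simp add: l2_norm_def l2_inner_def)
  qed
  then show "l2_norm \<Omega> (weak_pderiv \<Omega> j (\<lambda>x. 0)) = 0" .
  have "iter_pderiv js (\<lambda>x::real^'n. 0) = (\<lambda>x. 0)" for js
    by (induction js) (auto simp: pderiv_at_def)
  then have "test_function \<Omega> (\<lambda>x. 0)" by (simp add: test_function_def)
  moreover have "h1_norm \<Omega> (\<lambda>x. 0) = 0" using norm by (simp add: h1_norm_def l2_norm_def l2_inner_def)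
  ultimately show "(\<lambda>x. 0) \<in> H10 \<Omega>" using H1 by (auto simp: H10_def intro!: exI[of _ "\<lambda>k x. 0"])
qed

section \<open>Velocity fields and the boundedness of finite element functions\<close>

lemma borel_measurable_vec_componentwise:
  fixes u :: "'a \<Rightarrow> 'b::euclidean_space^'m"
  assumes "\<And>i. (\<lambda>x. u x $ i) \<in> borel_measurable M"
  shows "u \<in> borel_measurable M"
proof (subst borel_measurable_euclidean_space, intro ballI)
  fix b :: "'b^'m" assume "b \<in> Basis"
  then obtain i c where b: "b = axis i c" by (auto simp: Basis_vec_def)
  have "(\<lambda>x. u x $ i \<bullet> c) \<in> borel_measurable M" using assms[of i] by measurable
  then show "(\<lambda>x. u x \<bullet> b) \<in> borel_measurable M" by (simp add: b inner_axis)
qed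

lemma L2_componentwise:
  fixes u :: "real^'n \<Rightarrow> 'b::euclidean_space^'m"
  assumes "\<And>i. (\<lambda>x. u x $ i) \<in> L2 \<Omega>"
  shows "u \<in> L2 \<Omega>"
proof -
  have "(norm (u x))\<^sup>2 = (\<Sum>i\<in>UNIV. (norm (u x $ i))\<^sup>2)" for x
    by (simp add: norm_vec_def L2_set_def sum_nonneg)
  moreover have "integrable (lebesgue_on \<Omega>) (\<lambda>x. \<Sum>i\<in>UNIV. (norm (u x $ i))\<^sup>2)"
    using assms by (simp add: L2_def)
  ultimately show ?thesis
    using assms borel_measurable_vec_componentwise[of u "lebesgue_on \<Omega>"] by (simp add: L2_def)
qed

lemma l2_inner_componentwise:
  fixes u v :: "real^'n \<Rightarrow> 'b::euclidean_space^'m"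
  assumes "\<And>i. (\<lambda>x. u x $ i) \<in> L2 \<Omega>" "\<And>i. (\<lambda>x. v x $ i) \<in> L2 \<Omega>"
  shows "l2_inner \<Omega> u v = (\<Sum>i\<in>UNIV. l2_inner \<Omega> (\<lambda>x. u x $ i) (\<lambda>x. v x $ i))"
  unfolding l2_inner_def inner_vec_def
  by (intro Bochner_Integration.integral_sum integrable_inner_L2 assms)

lemma l2_norm_componentwise:
  fixes u :: "real^'n \<Rightarrow> 'b::euclidean_space^'m"
  assumes "\<And>i. (\<lambda>x. u x $ i) \<in> L2 \<Omega>"
  shows "(l2_norm \<Omega> u)\<^sup>2 = (\<Sum>i\<in>UNIV. (l2_norm \<Omega> (\<lambda>x. u x $ i))\<^sup>2)"
  by (simp add: l2_norm_squared l2_inner_componentwise assms)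

definition grad_norm :: "(real^'n) set \<Rightarrow> (real^'n \<Rightarrow> real) \<Rightarrow> real" where
  "grad_norm \<Omega> \<phi> = sqrt (\<Sum>j\<in>UNIV. (l2_norm \<Omega> (weak_pderiv \<Omega> j \<phi>))\<^sup>2)"

lemma grad_norm_nonneg: "0 \<le> grad_norm \<Omega> \<phi>"
  by (simp add: grad_norm_def sum_nonneg)

lemma velocity_space_component:
  assumes "v \<in> velocity_space \<Omega>"
  shows "(\<lambda>x. v x $ i) \<in> H10 \<Omega>" "(\<lambda>x. v x $ i) \<in> H1 \<Omega>" "(\<lambda>x. v x $ i) \<in> L2 \<Omega>"
  using assms by (auto simp: velocity_space_def H10_def H1_def)

lemma velocity_space_L2:
  assumes "v \<in> velocity_space \<Omega>"
  shows "v \<in> L2 \<Omega>" "wgrad \<Omega> v \<in> L2 \<Omega>" "wdiv \<Omega> v \<in> L2 \<Omega>"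
proof -
  note v = velocity_space_component[OF assms]
  note dv = weak_pderiv_H1(1)[OF v(2)]
  show "v \<in> L2 \<Omega>" by (rule L2_componentwise[OF v(3)])
  show "wgrad \<Omega> v \<in> L2 \<Omega>"
    using dv by (intro L2_componentwise) (simp add: wgrad_def)
  have "(\<lambda>x. \<Sum>i\<in>A. weak_pderiv \<Omega> i (\<lambda>y. v y $ i) x) \<in> L2 \<Omega>" if "finite A" for A
    using that
  proof induction
    case empty
    then show ?case by (simp add: L2_zero)
  next
    case (insert i A)
    then show ?case using L2_lincomb[OF dv[of i i] insert.IH, of 1 1] by simp
  qed
  then show "wdiv \<Omega> v \<in> L2 \<Omega>" by (simp add: wdiv_def[abs_def])
qed

lemma l2_norm_wgrad_squared:
  assumes "v \<in> velocity_space \<Omega>"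
  shows "(l2_norm \<Omega> (wgrad \<Omega> v))\<^sup>2 = (\<Sum>i\<in>UNIV. (grad_norm \<Omega> (\<lambda>x. v x $ i))\<^sup>2)"
proof -
  note dv = weak_pderiv_H1(1)[OF velocity_space_component(2)[OF assms]]
  have row: "(\<lambda>x. wgrad \<Omega> v x $ i) \<in> L2 \<Omega>" for i
    using dv by (intro L2_componentwise) (simp add: wgrad_def)
  have "(l2_norm \<Omega> (\<lambda>x. wgrad \<Omega> v x $ i))\<^sup>2 = (grad_norm \<Omega> (\<lambda>x. v x $ i))\<^sup>2" for i
    using dv[of _ i] by (subst l2_norm_componentwise) (simp_all add: wgrad_def grad_norm_def sum_nonneg)
  then show ?thesis using l2_norm_componentwise[OF row] by simp
qed

text \<open>The divergence is the trace of the gradient, to which the pointwise Cauchy-Schwarz inequality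
  applies.\<close>

lemma l2_norm_wdiv_le:
  fixes v :: "real^'n \<Rightarrow> real^'n"
  assumes "v \<in> velocity_space \<Omega>"
  shows "(l2_norm \<Omega> (wdiv \<Omega> v))\<^sup>2 \<le> real CARD('n) * (l2_norm \<Omega> (wgrad \<Omega> v))\<^sup>2"
proof -
  have "(wdiv \<Omega> v x)\<^sup>2 \<le> real CARD('n) * (wgrad \<Omega> v x \<bullet> wgrad \<Omega> v x)" for x
  proof -
    have "(\<Sum>i\<in>UNIV. 1 * (wgrad \<Omega> v x $ i $ i))\<^sup>2
        \<le> (\<Sum>i\<in>(UNIV::'n set). 1\<^sup>2) * (\<Sum>i\<in>UNIV. (wgrad \<Omega> v x $ i $ i)\<^sup>2)"
      by (rule Cauchy_Schwarz_ineq_sum)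
    also have "(\<Sum>i\<in>UNIV. (wgrad \<Omega> v x $ i $ i)\<^sup>2) \<le> (\<Sum>i\<in>UNIV. \<Sum>j\<in>UNIV. (wgrad \<Omega> v x $ i $ j)\<^sup>2)"
    proof (rule sum_mono)
      fix i :: 'n
      show "(wgrad \<Omega> v x $ i $ i)\<^sup>2 \<le> (\<Sum>j\<in>UNIV. (wgrad \<Omega> v x $ i $ j)\<^sup>2)"
        by (rule member_le_sum[of i UNIV "\<lambda>j. (wgrad \<Omega> v x $ i $ j)\<^sup>2"]) auto
    qed
    finally show ?thesis
      by (simp add: wdiv_def wgrad_def inner_vec_def power2_eq_square)
  qed
  then have "(\<integral>x. wdiv \<Omega> v x \<bullet> wdiv \<Omega> v x \<partial>lebesgue_on \<Omega>)
      \<le> (\<integral>x. real CARD('n) * (wgrad \<Omega> v x \<bullet> wgrad \<Omega> v x) \<partial>lebesgue_on \<Omega>)"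
    using velocity_space_L2[OF assms]
    by (intro integral_mono integrable_inner_L2 integrable_mult_right) (simp_all add: power2_eq_square)
  then show ?thesis by (simp add: l2_norm_squared l2_inner_def)
qed

lemma wgrad_lincomb:
  assumes "open \<Omega>" "bounded \<Omega>" "u \<in> velocity_space \<Omega>" "v \<in> velocity_space \<Omega>"
  shows "AE x in lebesgue_on \<Omega>. wgrad \<Omega> (\<lambda>y. a *\<^sub>R u y + b *\<^sub>R v y) x = a *\<^sub>R wgrad \<Omega> u x + b *\<^sub>R wgrad \<Omega> v x"
proof -
  have "AE x in lebesgue_on \<Omega>. \<forall>i\<in>UNIV. \<forall>j\<in>UNIV. weak_pderiv \<Omega> j (\<lambda>y. a * u y $ i + b * v y $ i) x
       = a * weak_pderiv \<Omega> j (\<lambda>y. u y $ i) x + b * weak_pderiv \<Omega> j (\<lambda>y. v y $ i) x"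
    using assms by (intro AE_finite_allI weak_pderiv_lincomb velocity_space_component) auto
  then show ?thesis
    by eventually_elim (simp add: wgrad_def vec_eq_iff)
qed

lemma wdiv_eq_trace: "wdiv \<Omega> v x = (\<Sum>i\<in>UNIV. wgrad \<Omega> v x $ i $ i)"
  by (simp add: wdiv_def wgrad_def)

lemma wdiv_lincomb:
  assumes "open \<Omega>" "bounded \<Omega>" "u \<in> velocity_space \<Omega>" "v \<in> velocity_space \<Omega>"
  shows "AE x in lebesgue_on \<Omega>. wdiv \<Omega> (\<lambda>y. a *\<^sub>R u y + b *\<^sub>R v y) x = a *\<^sub>R wdiv \<Omega> u x + b *\<^sub>R wdiv \<Omega> v x"
  using wgrad_lincomb[OF assms, of a b]
  by eventually_elim (simp add: wdiv_eq_trace sum.distrib sum_distrib_left)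

definition essentially_bounded :: "(real^'n) set \<Rightarrow> (real^'n \<Rightarrow> 'a::euclidean_space) \<Rightarrow> bool" where
  "essentially_bounded \<Omega> u \<longleftrightarrow> (\<exists>C. AE x in lebesgue_on \<Omega>. norm (u x) \<le> C)"

lemma essentially_bounded_component:
  fixes u :: "real^'n \<Rightarrow> 'a::euclidean_space^'m"
  assumes "essentially_bounded \<Omega> u"
  shows "essentially_bounded \<Omega> (\<lambda>x. u x $ i)"
proof -
  obtain C where "AE x in lebesgue_on \<Omega>. norm (u x) \<le> C" using assms by (auto simp: essentially_bounded_def)
  then have "AE x in lebesgue_on \<Omega>. norm (u x $ i) \<le> C"
    by eventually_elim (rule order_trans[OF Finite_Cartesian_Product.norm_nth_le])
  then show ?thesis by (auto simp: essentially_bounded_def)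
qed

lemma continuous_on_poly_degree_le:
  fixes P :: "real^'n \<Rightarrow> 'a::real_normed_vector"
  assumes "poly_degree_le m P"
  shows "continuous_on S P"
proof -
  obtain c where "P = (\<lambda>x. \<Sum>a\<in>{a::'n \<Rightarrow> nat. sum a UNIV \<le> m}. (\<Prod>i\<in>UNIV. (x $ i) ^ a i) *\<^sub>R c a)"
    using assms unfolding poly_degree_le_def by blast
  then show ?thesis
    by (simp only:) (intro continuous_on_sum continuous_on_scaleR continuous_on_prod continuous_on_power
        continuous_on_component continuous_on_const continuous_on_id)
qed

text \<open>A polynomial is bounded on each of the finitely many simplices, and the boundaries of the
  simplices form a null set.\<close>

lemma finite_element_essentially_bounded:
  fixes u :: "real^'n \<Rightarrow> 'a::euclidean_space"
  assumes "regular_triangulation \<Omega> \<sigma> h \<tau>" "finite_element_space \<tau> V" "u \<in> V"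
    and \<Omega>: "open \<Omega>" "bounded \<Omega>"
  shows "essentially_bounded \<Omega> u"
proof -
  have fin: "finite \<tau>" and cover: "\<Union>\<tau> = closure \<Omega>" and simplex: "\<And>T. T \<in> \<tau> \<Longrightarrow> int CARD('n) simplex T"
    using assms(1) by (auto simp: regular_triangulation_def triangulation_def)
  have "\<exists>C. \<forall>x\<in>interior T. norm (u x) \<le> C" if "T \<in> \<tau>" for T
  proof -
    obtain m P where P: "poly_degree_le m P" "\<And>x. x \<in> interior T \<Longrightarrow> u x = P x"
      using assms(2,3) \<open>T \<in> \<tau>\<close> unfolding finite_element_space_def by blast
    have "compact T" using simplex[OF that] by (rule compact_simplex)
    then have "compact (P ` T)" using P(1) by (intro compact_continuous_image continuous_on_poly_degree_le)
    then obtain C where "\<And>x. x \<in> T \<Longrightarrow> norm (P x) \<le> C"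
      using compact_imp_bounded[of "P ` T"] unfolding bounded_iff by blast
    then have "\<forall>x\<in>interior T. norm (u x) \<le> C" using P(2) interior_subset[of T] by auto
    then show ?thesis ..
  qed
  then have "\<forall>T\<in>\<tau>. \<exists>C. \<forall>x\<in>interior T. norm (u x) \<le> C" by blast
  from bchoice[OF this] obtain C where C: "\<And>T x. T \<in> \<tau> \<Longrightarrow> x \<in> interior T \<Longrightarrow> norm (u x) \<le> C T" by blast
  have "AE x in lebesgue. \<forall>T\<in>\<tau>. x \<notin> frontier T"
  proof (rule AE_ball_countable')
    fix T assume "T \<in> \<tau>"
    then have "negligible (frontier T)" using simplex by (intro negligible_convex_frontier convex_simplex)
    then show "AE x in lebesgue. x \<notin> frontier T" by (intro AE_not_in) (simp add: negligible_iff_null_sets)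
  qed (use fin in \<open>rule countable_finite\<close>)
  then have "AE x in lebesgue. x \<in> \<Omega> \<longrightarrow> norm (u x) \<le> (\<Sum>T\<in>\<tau>. \<bar>C T\<bar>)"
  proof eventually_elim
    case (elim x)
    show ?case
    proof
      assume "x \<in> \<Omega>"
      then obtain T where T: "T \<in> \<tau>" "x \<in> T" using cover closure_subset by blast
      then have "x \<in> interior T" using elim using closure_subset[of T] by (auto simp: frontier_def)
      then have "norm (u x) \<le> \<bar>C T\<bar>" using C[OF T(1)] by (meson abs_ge_self order_trans)
      also have "\<dots> \<le> (\<Sum>T\<in>\<tau>. \<bar>C T\<bar>)" using T(1) fin by (intro member_le_sum) auto
      finally show "norm (u x) \<le> (\<Sum>T\<in>\<tau>. \<bar>C T\<bar>)" .
    qed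
  qed
  then show ?thesis using \<Omega> by (auto simp: essentially_bounded_def AE_restrict_space_iff)
qed

section \<open>The convective form\<close>

text \<open>Boundedness makes products of two components and a weak derivative of a third integrable,
  so that \<^const>\<open>convection\<close> may be expanded into integrals of such products.\<close>

definition bounded_velocities :: "(real^'n) set \<Rightarrow> (real^'n \<Rightarrow> real^'n) set" where
  "bounded_velocities \<Omega> = {u \<in> velocity_space \<Omega>. essentially_bounded \<Omega> u}"

definition transport :: "(real^'n) set \<Rightarrow> 'n \<Rightarrow> (real^'n \<Rightarrow> real) \<Rightarrow> (real^'n \<Rightarrow> real) \<Rightarrow> (real^'n \<Rightarrow> real) \<Rightarrow> real" where
  "transport \<Omega> j a \<phi> \<psi> = (\<integral>x. a x * weak_pderiv \<Omega> j \<phi> x * \<psi> x \<partial>lebesgue_on \<Omega>)"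

lemma transport_commute: "transport \<Omega> j a \<phi> \<psi> = transport \<Omega> j \<psi> \<phi> a"
  by (simp add: transport_def mult_ac)

lemma transport_zero [simp]: "transport \<Omega> j (\<lambda>x. 0) \<phi> \<psi> = 0" "transport \<Omega> j a \<phi> (\<lambda>x. 0) = 0"
  by (simp_all add: transport_def)

lemma integrable_transport:
  fixes a :: "real^'n \<Rightarrow> real"
  assumes \<Omega>: "open \<Omega>" "bounded \<Omega>"
    and a: "essentially_bounded \<Omega> a" "a \<in> L2 \<Omega>" and \<psi>: "essentially_bounded \<Omega> \<psi>" "\<psi> \<in> L2 \<Omega>"
    and \<phi>: "\<phi> \<in> H1 \<Omega>"
  shows "integrable (lebesgue_on \<Omega>) (\<lambda>x. a x * weak_pderiv \<Omega> j \<phi> x * \<psi> x)"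
proof -
  obtain A B where A: "AE x in lebesgue_on \<Omega>. \<bar>a x\<bar> \<le> A" and B: "AE x in lebesgue_on \<Omega>. \<bar>\<psi> x\<bar> \<le> B"
    using a(1) \<psi>(1) by (auto simp: essentially_bounded_def)
  note d = L2_integrable[OF \<Omega> weak_pderiv_H1(1)[OF \<phi>, of j]]
  show ?thesis
  proof (rule Bochner_Integration.integrable_bound)
    show "integrable (lebesgue_on \<Omega>) (\<lambda>x. (A * B) * weak_pderiv \<Omega> j \<phi> x)" using d by simp
    show "(\<lambda>x. a x * weak_pderiv \<Omega> j \<phi> x * \<psi> x) \<in> borel_measurable (lebesgue_on \<Omega>)"
      using L2_measurable[OF a(2)] L2_measurable[OF \<psi>(2)] d by measurable
    show "AE x in lebesgue_on \<Omega>. norm (a x * weak_pderiv \<Omega> j \<phi> x * \<psi> x) \<le> norm ((A * B) * weak_pderiv \<Omega> j \<phi> x)"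
      using A B
    proof eventually_elim
      case (elim x)
      have "\<bar>a x\<bar> * \<bar>\<psi> x\<bar> \<le> A * B" using elim by (intro mult_mono) auto
      also have "\<dots> \<le> \<bar>A * B\<bar>" by simp
      finally have "(\<bar>a x\<bar> * \<bar>\<psi> x\<bar>) * \<bar>weak_pderiv \<Omega> j \<phi> x\<bar> \<le> \<bar>A * B\<bar> * \<bar>weak_pderiv \<Omega> j \<phi> x\<bar>"
        by (rule mult_right_mono) simp
      then show ?case by (simp only: real_norm_def abs_mult mult_ac)
    qed
  qed
qed

lemma transport_lincomb:
  fixes a :: "real^'n \<Rightarrow> real"
  assumes \<Omega>: "open \<Omega>" "bounded \<Omega>"
    and a: "essentially_bounded \<Omega> a" "a \<in> L2 \<Omega>" and \<psi>: "essentially_bounded \<Omega> \<psi>" "\<psi> \<in> L2 \<Omega>"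
    and \<phi>: "\<phi> \<in> H1 \<Omega>" "\<phi>' \<in> H1 \<Omega>"
  shows "transport \<Omega> j a (\<lambda>x. c * \<phi> x + d * \<phi>' x) \<psi> = c * transport \<Omega> j a \<phi> \<psi> + d * transport \<Omega> j a \<phi>' \<psi>"
proof -
  note int = integrable_transport[OF \<Omega> a \<psi> \<phi>(1), of j] integrable_transport[OF \<Omega> a \<psi> \<phi>(2), of j]
  note am = L2_measurable[OF a(2)] and \<psi>m = L2_measurable[OF \<psi>(2)]
  have "(\<lambda>x. c * \<phi> x + d * \<phi>' x) \<in> H1 \<Omega>"
    by (rule H1_lincomb[OF \<Omega> \<phi>])
  note m = this[THEN weak_pderiv_H1(1), THEN L2_measurable, of j]
  note m' = weak_pderiv_H1(1)[OF \<phi>(1), THEN L2_measurable, of j] weak_pderiv_H1(1)[OF \<phi>(2), THEN L2_measurable, of j]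
  have "transport \<Omega> j a (\<lambda>x. c * \<phi> x + d * \<phi>' x) \<psi>
    = (\<integral>x. c * (a x * weak_pderiv \<Omega> j \<phi> x * \<psi> x) + d * (a x * weak_pderiv \<Omega> j \<phi>' x * \<psi> x) \<partial>lebesgue_on \<Omega>)"
    unfolding transport_def
  proof (rule integral_cong_AE)
    show "AE x in lebesgue_on \<Omega>. a x * weak_pderiv \<Omega> j (\<lambda>x. c * \<phi> x + d * \<phi>' x) x * \<psi> x
        = c * (a x * weak_pderiv \<Omega> j \<phi> x * \<psi> x) + d * (a x * weak_pderiv \<Omega> j \<phi>' x * \<psi> x)"
      using weak_pderiv_lincomb[OF \<Omega> \<phi>, of j c d] by eventually_elim (simp add: algebra_simps)
    show "(\<lambda>x. a x * weak_pderiv \<Omega> j (\<lambda>x. c * \<phi> x + d * \<phi>' x) x * \<psi> x) \<in> borel_measurable (lebesgue_on \<Omega>)"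
      using am \<psi>m m by measurable
    show "(\<lambda>x. c * (a x * weak_pderiv \<Omega> j \<phi> x * \<psi> x) + d * (a x * weak_pderiv \<Omega> j \<phi>' x * \<psi> x)) \<in> borel_measurable (lebesgue_on \<Omega>)"
      using am \<psi>m m' by measurable
  qed
  then show ?thesis using int by (simp add: transport_def)
qed

lemma transport_lincomb_left:
  fixes a :: "real^'n \<Rightarrow> real"
  assumes \<Omega>: "open \<Omega>" "bounded \<Omega>"
    and a: "essentially_bounded \<Omega> a" "a \<in> L2 \<Omega>" and a': "essentially_bounded \<Omega> a'" "a' \<in> L2 \<Omega>"
    and \<psi>: "essentially_bounded \<Omega> \<psi>" "\<psi> \<in> L2 \<Omega>" and \<phi>: "\<phi> \<in> H1 \<Omega>"
  shows "transport \<Omega> j (\<lambda>x. c * a x + d * a' x) \<phi> \<psi> = c * transport \<Omega> j a \<phi> \<psi> + d * transport \<Omega> j a' \<phi> \<psi>"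
proof -
  note int = integrable_transport[OF \<Omega> a \<psi> \<phi>, of j] integrable_transport[OF \<Omega> a' \<psi> \<phi>, of j]
  have "transport \<Omega> j (\<lambda>x. c * a x + d * a' x) \<phi> \<psi>
    = (\<integral>x. c * (a x * weak_pderiv \<Omega> j \<phi> x * \<psi> x) + d * (a' x * weak_pderiv \<Omega> j \<phi> x * \<psi> x) \<partial>lebesgue_on \<Omega>)"
    unfolding transport_def by (intro Bochner_Integration.integral_cong) (simp_all add: algebra_simps)
  then show ?thesis using int by (simp add: transport_def)
qed

lemma bounded_velocities_component:
  assumes "u \<in> bounded_velocities \<Omega>"
  shows "essentially_bounded \<Omega> (\<lambda>x. u x $ i)" "(\<lambda>x. u x $ i) \<in> L2 \<Omega>" "(\<lambda>x. u x $ i) \<in> H1 \<Omega>" "(\<lambda>x. u x $ i) \<in> H10 \<Omega>"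
  using assms velocity_space_component essentially_bounded_component by (auto simp: bounded_velocities_def)

lemma convection_eq_transport:
  fixes u v w :: "real^'n \<Rightarrow> real^'n"
  assumes \<Omega>: "open \<Omega>" "bounded \<Omega>"
    and u: "u \<in> bounded_velocities \<Omega>" and v: "v \<in> bounded_velocities \<Omega>" and w: "w \<in> bounded_velocities \<Omega>"
  shows "convection \<Omega> u w v = (\<Sum>i\<in>UNIV. \<Sum>j\<in>UNIV.
     (transport \<Omega> j (\<lambda>x. u x $ j) (\<lambda>x. w x $ i) (\<lambda>x. v x $ i)
      - transport \<Omega> j (\<lambda>x. u x $ j) (\<lambda>x. v x $ i) (\<lambda>x. w x $ i)) / 2)"
proof -
  have *: "l2_inner \<Omega> (\<lambda>x. wgrad \<Omega> w x *v u x) v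
     = (\<Sum>i\<in>UNIV. \<Sum>j\<in>UNIV. transport \<Omega> j (\<lambda>x. u x $ j) (\<lambda>x. w x $ i) (\<lambda>x. v x $ i))"
    if v: "v \<in> bounded_velocities \<Omega>" and w: "w \<in> bounded_velocities \<Omega>" for v w
  proof -
    have int: "integrable (lebesgue_on \<Omega>) (\<lambda>x. u x $ j * weak_pderiv \<Omega> j (\<lambda>x. w x $ i) x * v x $ i)" for i j
      by (intro integrable_transport[OF \<Omega>] bounded_velocities_component u v w)
    have "l2_inner \<Omega> (\<lambda>x. wgrad \<Omega> w x *v u x) v
      = (\<integral>x. (\<Sum>i\<in>UNIV. \<Sum>j\<in>UNIV. u x $ j * weak_pderiv \<Omega> j (\<lambda>x. w x $ i) x * v x $ i) \<partial>lebesgue_on \<Omega>)"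
      unfolding l2_inner_def inner_vec_def matrix_vector_mult_def wgrad_def
      by (simp add: sum_distrib_left mult_ac)
    also have "\<dots> = (\<Sum>i\<in>UNIV. \<Sum>j\<in>UNIV. transport \<Omega> j (\<lambda>x. u x $ j) (\<lambda>x. w x $ i) (\<lambda>x. v x $ i))"
      unfolding transport_def using int by simp
    finally show ?thesis .
  qed
  show ?thesis
    unfolding convection_def *[OF v w] *[OF w v]
    by (simp add: sum_subtractf diff_divide_distrib sum_divide_distrib)
qed

lemma convection_antisym: "convection \<Omega> u w v = - convection \<Omega> u v w"
  by (simp add: convection_def)

lemma bounded_velocities_axis:
  fixes \<Omega> :: "(real^'n) set"
  assumes "open \<Omega>" "bounded \<Omega>" "\<phi> \<in> H10 \<Omega>" "essentially_bounded \<Omega> \<phi>"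
  shows "(\<lambda>x. axis k (\<phi> x)) \<in> bounded_velocities \<Omega>"
proof -
  have "(\<lambda>x. axis k (\<phi> x) $ i) = (if i = k then \<phi> else (\<lambda>x. 0))" for i by (auto simp: axis_def)
  then have "(\<lambda>x. axis k (\<phi> x)) \<in> velocity_space \<Omega>"
    using assms(3) zero_H10[OF assms(1,2)] by (simp add: velocity_space_def)
  then show ?thesis
    using assms(4)
    by (simp add: bounded_velocities_def essentially_bounded_def norm_eq_sqrt_inner inner_axis_axis)
qed

lemma axis_component: "(\<lambda>x. axis k (\<phi> x) $ i) = (if i = k then \<phi> else (\<lambda>x. 0))"
  by (auto simp: axis_def)

lemma convection_axis:
  fixes \<Omega> :: "(real^'n) set"
  assumes \<Omega>: "open \<Omega>" "bounded \<Omega>"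
    and "\<And>f. f \<in> {a, \<phi>, \<psi>} \<Longrightarrow> f \<in> H10 \<Omega> \<and> essentially_bounded \<Omega> f"
  shows "convection \<Omega> (\<lambda>x. axis j (a x)) (\<lambda>x. axis k (\<phi> x)) (\<lambda>x. axis k (\<psi> x))
    = (transport \<Omega> j a \<phi> \<psi> - transport \<Omega> j a \<psi> \<phi>) / 2"
proof -
  define D where "D = (transport \<Omega> j a \<phi> \<psi> - transport \<Omega> j a \<psi> \<phi>) / 2"
  have "convection \<Omega> (\<lambda>x. axis j (a x)) (\<lambda>x. axis k (\<phi> x)) (\<lambda>x. axis k (\<psi> x))
    = (\<Sum>i\<in>UNIV. if i = k then (\<Sum>l\<in>UNIV. if l = j then D else 0) else 0)"
  proof -
    have b: "(\<lambda>x. axis l (f x)) \<in> bounded_velocities \<Omega>" if "f \<in> {a, \<phi>, \<psi>}" for f l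
      using assms(3)[OF that] by (intro bounded_velocities_axis \<Omega>) auto
    show ?thesis
      unfolding convection_eq_transport[OF \<Omega> b[of a j, simplified] b[of \<psi> k, simplified] b[of \<phi> k, simplified]]
        axis_component
    proof (intro sum.cong refl)
      fix i
      show "(\<Sum>l\<in>UNIV. (transport \<Omega> l (if l = j then a else (\<lambda>x. 0)) (if i = k then \<phi> else (\<lambda>x. 0)) (if i = k then \<psi> else (\<lambda>x. 0))
          - transport \<Omega> l (if l = j then a else (\<lambda>x. 0)) (if i = k then \<psi> else (\<lambda>x. 0)) (if i = k then \<phi> else (\<lambda>x. 0))) / 2)
        = (if i = k then (\<Sum>l\<in>UNIV. if l = j then D else 0) else 0)"
      proof (cases "i = k")
        case True
        show ?thesis unfolding True simp_thms if_True by (intro sum.cong refl) (simp add: D_def)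
      qed simp
    qed
  qed
  also have "\<dots> = D" by simp
  finally show ?thesis by (simp add: D_def)
qed

text \<open>With \<open>D\<^sub>a\<close>, \<open>D\<^sub>\<phi>\<close>, \<open>D\<^sub>\<psi>\<close> the integrals of \<open>a \<phi> \<psi>\<close> with the derivative \<open>\<partial>\<^sub>j\<close> on the indicated factor, the
  three forms are \<open>(D\<^sub>\<phi> - D\<^sub>\<psi>) / 2\<close>, \<open>(D\<^sub>\<phi> - D\<^sub>a) / 2\<close> and \<open>(D\<^sub>a - D\<^sub>\<psi>) / 2\<close>.  This moves \<open>\<phi>\<close> and \<open>\<psi>\<close> into
  the first argument, where the bound of \<^const>\<open>convection\<close> gains half a derivative.\<close>

lemma convection_axis_cyclic:
  fixes \<Omega> :: "(real^'n) set"
  assumes \<Omega>: "open \<Omega>" "bounded \<Omega>"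
    and f: "\<And>f. f \<in> {a, \<phi>, \<psi>} \<Longrightarrow> f \<in> H10 \<Omega> \<and> essentially_bounded \<Omega> f"
  shows "convection \<Omega> (\<lambda>x. axis j (a x)) (\<lambda>x. axis k (\<phi> x)) (\<lambda>x. axis k (\<psi> x))
    = convection \<Omega> (\<lambda>x. axis j (\<psi> x)) (\<lambda>x. axis k (\<phi> x)) (\<lambda>x. axis k (a x))
    + convection \<Omega> (\<lambda>x. axis j (\<phi> x)) (\<lambda>x. axis k (a x)) (\<lambda>x. axis k (\<psi> x))"
proof -
  have "convection \<Omega> (\<lambda>x. axis j (a x)) (\<lambda>x. axis k (\<phi> x)) (\<lambda>x. axis k (\<psi> x))
      = (transport \<Omega> j a \<phi> \<psi> - transport \<Omega> j a \<psi> \<phi>) / 2"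
    by (rule convection_axis[OF \<Omega> f])
  moreover have "convection \<Omega> (\<lambda>x. axis j (\<psi> x)) (\<lambda>x. axis k (\<phi> x)) (\<lambda>x. axis k (a x))
      = (transport \<Omega> j \<psi> \<phi> a - transport \<Omega> j \<psi> a \<phi>) / 2"
    by (rule convection_axis[OF \<Omega> f]) auto
  moreover have "convection \<Omega> (\<lambda>x. axis j (\<phi> x)) (\<lambda>x. axis k (a x)) (\<lambda>x. axis k (\<psi> x))
      = (transport \<Omega> j \<phi> a \<psi> - transport \<Omega> j \<phi> \<psi> a) / 2"
    by (rule convection_axis[OF \<Omega> f]) auto
  ultimately show ?thesis
    using transport_commute[of \<Omega> j \<psi> \<phi> a] transport_commute[of \<Omega> j \<psi> a \<phi>] transport_commute[of \<Omega> j \<phi> \<psi> a]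
    by (simp add: field_simps)
qed

lemma l2_norm_axis: "l2_norm \<Omega> (\<lambda>x. axis k (\<phi> x) :: real^'m) = l2_norm \<Omega> \<phi>"
  by (simp add: l2_norm_def l2_inner_def inner_axis_axis)

lemma grad_norm_zero:
  fixes \<Omega> :: "(real^'n) set"
  assumes "open \<Omega>" "bounded \<Omega>"
  shows "grad_norm \<Omega> (\<lambda>x. 0) = 0"
  by (simp add: grad_norm_def l2_norm_weak_pderiv_zero[OF assms])

lemma l2_norm_wgrad_axis:
  fixes \<Omega> :: "(real^'n) set"
  assumes "open \<Omega>" "bounded \<Omega>" "(\<lambda>x. axis k (\<phi> x)) \<in> velocity_space \<Omega>"
  shows "l2_norm \<Omega> (wgrad \<Omega> (\<lambda>x. axis k (\<phi> x))) = grad_norm \<Omega> \<phi>"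
proof -
  have "(l2_norm \<Omega> (wgrad \<Omega> (\<lambda>x. axis k (\<phi> x))))\<^sup>2 = (\<Sum>i\<in>UNIV. if i = k then (grad_norm \<Omega> \<phi>)\<^sup>2 else 0)"
    unfolding l2_norm_wgrad_squared[OF assms(3)]
    by (intro sum.cong) (simp_all add: axis_component grad_norm_zero[OF assms(1,2)])
  then show ?thesis by (simp add: l2_norm_nonneg grad_norm_nonneg)
qed

lemma convection_lincomb_middle:
  fixes u v w :: "real^'n \<Rightarrow> real^'n"
  assumes \<Omega>: "open \<Omega>" "bounded \<Omega>"
    and u: "u \<in> bounded_velocities \<Omega>" and v: "v \<in> bounded_velocities \<Omega>" and w: "w \<in> bounded_velocities \<Omega>"
    and w': "w' \<in> bounded_velocities \<Omega>" and l: "(\<lambda>x. a *\<^sub>R w x + b *\<^sub>R w' x) \<in> bounded_velocities \<Omega>"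
  shows "convection \<Omega> u (\<lambda>x. a *\<^sub>R w x + b *\<^sub>R w' x) v = a * convection \<Omega> u w v + b * convection \<Omega> u w' v"
proof -
  note c = bounded_velocities_component
  have 1: "transport \<Omega> j (\<lambda>x. u x $ j) (\<lambda>x. a * w x $ i + b * w' x $ i) (\<lambda>x. v x $ i)
    = a * transport \<Omega> j (\<lambda>x. u x $ j) (\<lambda>x. w x $ i) (\<lambda>x. v x $ i)
      + b * transport \<Omega> j (\<lambda>x. u x $ j) (\<lambda>x. w' x $ i) (\<lambda>x. v x $ i)" for i j
    by (rule transport_lincomb[OF \<Omega> c(1,2)[OF u] c(1,2)[OF v] c(3)[OF w] c(3)[OF w']])
  have 2: "transport \<Omega> j (\<lambda>x. u x $ j) (\<lambda>x. v x $ i) (\<lambda>x. a * w x $ i + b * w' x $ i)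
    = a * transport \<Omega> j (\<lambda>x. u x $ j) (\<lambda>x. v x $ i) (\<lambda>x. w x $ i)
      + b * transport \<Omega> j (\<lambda>x. u x $ j) (\<lambda>x. v x $ i) (\<lambda>x. w' x $ i)" for i j
    unfolding transport_commute[of \<Omega> j "\<lambda>x. u x $ j"]
    by (rule transport_lincomb_left[OF \<Omega> c(1,2)[OF w] c(1,2)[OF w'] c(1,2)[OF u] c(3)[OF v]])
  show ?thesis
    by (simp add: convection_eq_transport[OF \<Omega> u v l] convection_eq_transport[OF \<Omega> u v w]
        convection_eq_transport[OF \<Omega> u v w'] 1 2 sum_distrib_left flip: sum.distrib)
       (simp add: algebra_simps add_divide_distrib diff_divide_distrib)
qed

lemma convection_lincomb_left:
  fixes u v w :: "real^'n \<Rightarrow> real^'n"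
  assumes \<Omega>: "open \<Omega>" "bounded \<Omega>"
    and u: "u \<in> bounded_velocities \<Omega>" and u': "u' \<in> bounded_velocities \<Omega>"
    and l: "(\<lambda>x. a *\<^sub>R u x + b *\<^sub>R u' x) \<in> bounded_velocities \<Omega>"
    and v: "v \<in> bounded_velocities \<Omega>" and w: "w \<in> bounded_velocities \<Omega>"
  shows "convection \<Omega> (\<lambda>x. a *\<^sub>R u x + b *\<^sub>R u' x) w v = a * convection \<Omega> u w v + b * convection \<Omega> u' w v"
proof -
  note c = bounded_velocities_component
  have 1: "transport \<Omega> j (\<lambda>x. a * u x $ j + b * u' x $ j) (\<lambda>x. w x $ i) (\<lambda>x. v x $ i)
    = a * transport \<Omega> j (\<lambda>x. u x $ j) (\<lambda>x. w x $ i) (\<lambda>x. v x $ i)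
      + b * transport \<Omega> j (\<lambda>x. u' x $ j) (\<lambda>x. w x $ i) (\<lambda>x. v x $ i)"
    if v: "v \<in> bounded_velocities \<Omega>" and w: "w \<in> bounded_velocities \<Omega>" for i j v w
    by (rule transport_lincomb_left[OF \<Omega> c(1,2)[OF u] c(1,2)[OF u'] c(1,2)[OF v] c(3)[OF w]])
  show ?thesis
    by (simp add: convection_eq_transport[OF \<Omega> l v w] convection_eq_transport[OF \<Omega> u v w]
        convection_eq_transport[OF \<Omega> u' v w] 1[OF v w] 1[OF w v] sum_distrib_left flip: sum.distrib)
       (simp add: algebra_simps add_divide_distrib diff_divide_distrib)
qed

text \<open>Each component of the form is split by the cyclic identity and bounded by the hypothesis on
  \<open>M\<close>.  The factor \<open>sqrt d\<close> arises because the gradient norms of the components of \<open>u\<close>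
  are summed without squares, whereas the sum over the components of \<open>w\<close> and \<open>v\<close> is absorbed by the
  Cauchy-Schwarz inequality.\<close>

lemma convection_interpolation:
  fixes u v w :: "real^'n \<Rightarrow> real^'n"
  assumes \<Omega>: "open \<Omega>" "bounded \<Omega>" and "0 \<le> M"
    and M: "\<And>a b c. \<lbrakk>a \<in> velocity_space \<Omega>; b \<in> velocity_space \<Omega>; c \<in> velocity_space \<Omega>\<rbrakk> \<Longrightarrow>
         convection \<Omega> a b c \<le> M * sqrt (l2_norm \<Omega> a) * sqrt (l2_norm \<Omega> (wgrad \<Omega> a))
           * l2_norm \<Omega> (wgrad \<Omega> b) * l2_norm \<Omega> (wgrad \<Omega> c)"
    and u: "u \<in> bounded_velocities \<Omega>" and v: "v \<in> bounded_velocities \<Omega>" and w: "w \<in> bounded_velocities \<Omega>"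
  shows "convection \<Omega> u w v \<le> sqrt (real CARD('n)) * M * l2_norm \<Omega> (wgrad \<Omega> u) *
     (sqrt (l2_norm \<Omega> w * l2_norm \<Omega> (wgrad \<Omega> w)) * l2_norm \<Omega> (wgrad \<Omega> v)
      + sqrt (l2_norm \<Omega> v * l2_norm \<Omega> (wgrad \<Omega> v)) * l2_norm \<Omega> (wgrad \<Omega> w))"
proof -
  note c = bounded_velocities_component
  define uc vc wc where "uc i = (\<lambda>x. u x $ i)" and "vc i = (\<lambda>x. v x $ i)" and "wc i = (\<lambda>x. w x $ i)" for i
  have bd: "uc i \<in> H10 \<Omega> \<and> essentially_bounded \<Omega> (uc i)" "vc i \<in> H10 \<Omega> \<and> essentially_bounded \<Omega> (vc i)"
      "wc i \<in> H10 \<Omega> \<and> essentially_bounded \<Omega> (wc i)" for i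
    using c[OF u] c[OF v] c[OF w] by (simp_all add: uc_def vc_def wc_def)
  let ?N = "l2_norm \<Omega>" and ?G = "grad_norm \<Omega>"
  have ax: "convection \<Omega> (\<lambda>x. axis j (a x)) (\<lambda>x. axis j (\<phi> x)) (\<lambda>x. axis j (\<psi> x)) \<le> M * (sqrt (?N a * ?G a) * ?G \<phi> * ?G \<psi>)"
    if "a \<in> H10 \<Omega> \<and> essentially_bounded \<Omega> a" "\<phi> \<in> H10 \<Omega> \<and> essentially_bounded \<Omega> \<phi>" "\<psi> \<in> H10 \<Omega> \<and> essentially_bounded \<Omega> \<psi>" for j a \<phi> \<psi>
  proof -
    have V: "(\<lambda>x. axis j (f x)) \<in> velocity_space \<Omega>" if "f \<in> H10 \<Omega> \<and> essentially_bounded \<Omega> f" for f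
      using bounded_velocities_axis[OF \<Omega>, of f j] that by (auto simp: bounded_velocities_def)
    show ?thesis
      using M[OF V[OF that(1)] V[OF that(2)] V[OF that(3)]]
      by (simp add: l2_norm_axis l2_norm_wgrad_axis[OF \<Omega>] V that real_sqrt_mult mult_ac)
  qed
  have "convection \<Omega> u w v
      = (\<Sum>i\<in>UNIV. \<Sum>j\<in>UNIV. convection \<Omega> (\<lambda>x. axis j (uc j x)) (\<lambda>x. axis j (wc i x)) (\<lambda>x. axis j (vc i x)))"
    unfolding convection_eq_transport[OF \<Omega> u v w]
    by (intro sum.cong refl, subst convection_axis[OF \<Omega>]) (use bd in \<open>auto simp: uc_def vc_def wc_def\<close>)
  also have "\<dots> \<le> (\<Sum>i\<in>UNIV. \<Sum>j\<in>UNIV. M * (sqrt (?N (vc i) * ?G (vc i)) * ?G (wc i) * ?G (uc j))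
      + M * (sqrt (?N (wc i) * ?G (wc i)) * ?G (uc j) * ?G (vc i)))"
  proof (intro sum_mono)
    fix i j
    have "convection \<Omega> (\<lambda>x. axis j (uc j x)) (\<lambda>x. axis j (wc i x)) (\<lambda>x. axis j (vc i x))
        = convection \<Omega> (\<lambda>x. axis j (vc i x)) (\<lambda>x. axis j (wc i x)) (\<lambda>x. axis j (uc j x))
          + convection \<Omega> (\<lambda>x. axis j (wc i x)) (\<lambda>x. axis j (uc j x)) (\<lambda>x. axis j (vc i x))"
      by (rule convection_axis_cyclic[OF \<Omega>]) (use bd in auto)
    also have "\<dots> \<le> M * (sqrt (?N (vc i) * ?G (vc i)) * ?G (wc i) * ?G (uc j))
      + M * (sqrt (?N (wc i) * ?G (wc i)) * ?G (uc j) * ?G (vc i))"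
      by (intro add_mono ax bd)
    finally show "convection \<Omega> (\<lambda>x. axis j (uc j x)) (\<lambda>x. axis j (wc i x)) (\<lambda>x. axis j (vc i x))
      \<le> M * (sqrt (?N (vc i) * ?G (vc i)) * ?G (wc i) * ?G (uc j))
      + M * (sqrt (?N (wc i) * ?G (wc i)) * ?G (uc j) * ?G (vc i))" .
  qed
  also have "\<dots> = M * ((\<Sum>j\<in>UNIV. ?G (uc j)) *
      ((\<Sum>i\<in>UNIV. sqrt (?N (wc i) * ?G (wc i)) * ?G (vc i)) + (\<Sum>i\<in>UNIV. sqrt (?N (vc i) * ?G (vc i)) * ?G (wc i))))"
    by (simp add: sum.distrib sum_distrib_left sum_distrib_right algebra_simps)
  also have "\<dots> \<le> M * ((sqrt (real CARD('n)) * ?N (wgrad \<Omega> u)) *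
     (sqrt (?N w * ?N (wgrad \<Omega> w)) * ?N (wgrad \<Omega> v) + sqrt (?N v * ?N (wgrad \<Omega> v)) * ?N (wgrad \<Omega> w)))"
  proof -
    have norms: "?N (wgrad \<Omega> y) = L2_set (\<lambda>i. ?G (\<lambda>x. y x $ i)) UNIV" "?N y = L2_set (\<lambda>i. ?N (\<lambda>x. y x $ i)) UNIV"
      if "y \<in> bounded_velocities \<Omega>" for y
    proof -
      have y: "y \<in> velocity_space \<Omega>" using that by (simp add: bounded_velocities_def)
      show "?N (wgrad \<Omega> y) = L2_set (\<lambda>i. ?G (\<lambda>x. y x $ i)) UNIV"
        by (simp add: L2_set_def l2_norm_nonneg flip: l2_norm_wgrad_squared[OF y])
      show "?N y = L2_set (\<lambda>i. ?N (\<lambda>x. y x $ i)) UNIV"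
        by (simp add: L2_set_def l2_norm_nonneg flip: l2_norm_componentwise[OF velocity_space_component(3)[OF y]])
    qed
    have sum1: "(\<Sum>j\<in>UNIV. ?G (uc j)) \<le> sqrt (real CARD('n)) * ?N (wgrad \<Omega> u)"
      using L2_set_mult_ineq[of "\<lambda>j. 1" "\<lambda>j. ?G (uc j)" "UNIV::'n set"]
      by (simp add: norms(1)[OF u] uc_def grad_norm_nonneg L2_set_def)
    have sum2: "(\<Sum>i\<in>UNIV. sqrt (?N (\<lambda>x. y x $ i) * ?G (\<lambda>x. y x $ i)) * ?G (\<lambda>x. z x $ i))
        \<le> sqrt (?N y * ?N (wgrad \<Omega> y)) * ?N (wgrad \<Omega> z)"
      if y: "y \<in> bounded_velocities \<Omega>" and z: "z \<in> bounded_velocities \<Omega>" for y z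
    proof -
      have "(\<Sum>i\<in>UNIV. sqrt (?N (\<lambda>x. y x $ i) * ?G (\<lambda>x. y x $ i)) * ?G (\<lambda>x. z x $ i))
        \<le> L2_set (\<lambda>i. sqrt (?N (\<lambda>x. y x $ i) * ?G (\<lambda>x. y x $ i))) UNIV * L2_set (\<lambda>i. ?G (\<lambda>x. z x $ i)) UNIV"
        using L2_set_mult_ineq[of "\<lambda>i. sqrt (?N (\<lambda>x. y x $ i) * ?G (\<lambda>x. y x $ i))" "\<lambda>i. ?G (\<lambda>x. z x $ i)" UNIV]
        by (simp add: grad_norm_nonneg l2_norm_nonneg)
      also have "L2_set (\<lambda>i. sqrt (?N (\<lambda>x. y x $ i) * ?G (\<lambda>x. y x $ i))) UNIV
          = sqrt (\<Sum>i\<in>UNIV. ?N (\<lambda>x. y x $ i) * ?G (\<lambda>x. y x $ i))"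
        by (simp add: L2_set_def grad_norm_nonneg l2_norm_nonneg)
      also have "\<dots> \<le> sqrt (?N y * ?N (wgrad \<Omega> y))"
        using L2_set_mult_ineq[of "\<lambda>i. ?N (\<lambda>x. y x $ i)" "\<lambda>i. ?G (\<lambda>x. y x $ i)" UNIV]
        by (simp add: grad_norm_nonneg l2_norm_nonneg norms[OF y])
      finally show ?thesis by (simp add: norms[OF z] mult_right_mono)
    qed
    show ?thesis
      using \<open>0 \<le> M\<close> sum1 sum2[OF w v] sum2[OF v w]
      unfolding uc_def[symmetric] vc_def[symmetric] wc_def[symmetric]
      by (intro mult_left_mono mult_mono add_mono) (auto intro!: add_nonneg_nonneg sum_nonneg mult_nonneg_nonneg simp: grad_norm_nonneg l2_norm_nonneg)
  qed
  finally show ?thesis by (simp add: mult_ac)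
qed

section \<open>Abstract estimates\<close>

text \<open>In an energy estimate \<open>n\<close>, \<open>D\<close>, \<open>m\<close> are the viscous, grad-div and nudging energies.  Because \<open>P\<close>
  multiplies only \<open>sqrt D\<close>, the grad-div energy absorbs a part of the right-hand side and \<open>n + m\<close> is
  bounded with smaller constants than the whole energy would be.\<close>

lemma young_coercive_bound:
  fixes n D m :: real
  assumes "0 \<le> n" "0 \<le> D" "0 \<le> m" and le: "n + D + m \<le> P * sqrt D + G * sqrt n"
  shows "n + m \<le> P\<^sup>2 / 3 + 4 / 3 * G\<^sup>2" and "n / 4 + (2 * m + n) \<le> P\<^sup>2 / 2 + 4 / 3 * G\<^sup>2"
proof -
  define X Y where "X = sqrt D" and "Y = sqrt n"
  have D: "D = X\<^sup>2" and n: "n = Y\<^sup>2" using assms by (simp_all add: X_def Y_def)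
  have le': "Y\<^sup>2 + m + X\<^sup>2 \<le> P * X + G * Y" 
    unfolding D[symmetric] n[symmetric] unfolding X_def Y_def using le by linarith
  have 1: "P * X - X\<^sup>2 \<le> P\<^sup>2 / 4"
    using zero_le_power2[of "X - P / 2"] by (simp add: power2_eq_square algebra_simps)
  have 2: "G * Y \<le> Y\<^sup>2 / 4 + G\<^sup>2"
    using zero_le_power2[of "Y / 2 - G"] by (simp add: power2_eq_square algebra_simps)
  have 3: "2 * (G * Y) - 3 / 4 * Y\<^sup>2 \<le> 4 / 3 * G\<^sup>2"
    using zero_le_power2[of "3 * Y - 4 * G"] by (simp add: power2_eq_square algebra_simps)
  show "n + m \<le> P\<^sup>2 / 3 + 4 / 3 * G\<^sup>2" using le' 1 2 \<open>0 \<le> m\<close> unfolding n by linarith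
  show "n / 4 + (2 * m + n) \<le> P\<^sup>2 / 2 + 4 / 3 * G\<^sup>2" using le' 1 3 unfolding n by linarith
qed

text \<open>Adding a multiple of \<open>x\<close> to \<open>v\<close> does not change \<open>c\<close>.  Choosing the multiple so that the result \<open>y\<close> is
  \<open>B\<close>-orthogonal to \<open>x\<close> gives \<open>c v = c y = l y\<close>, and \<open>B y y \<le> B v v\<close>.  A direct estimate of \<open>B x v + l v\<close>
  would lose a factor two.\<close>

lemma constrained_functional_bound:
  fixes B :: "('a \<Rightarrow> 'b::real_vector) \<Rightarrow> ('a \<Rightarrow> 'b) \<Rightarrow> real"
  assumes V: "\<And>v w a b. v \<in> V \<Longrightarrow> w \<in> V \<Longrightarrow> (\<lambda>t. a *\<^sub>R v t + b *\<^sub>R w t) \<in> V"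
    and B_lin: "\<And>u v w a b. u \<in> V \<Longrightarrow> v \<in> V \<Longrightarrow> w \<in> V \<Longrightarrow> B (\<lambda>t. a *\<^sub>R u t + b *\<^sub>R v t) w = a * B u w + b * B v w"
    and B_sym: "\<And>u v. B u v = B v u"
    and B_nonneg: "\<And>v. v \<in> V \<Longrightarrow> 0 \<le> B v v"
    and c_lin: "\<And>v w a b. v \<in> V \<Longrightarrow> w \<in> V \<Longrightarrow> c (\<lambda>t. a *\<^sub>R v t + b *\<^sub>R w t) = a * c v + b * c w"
    and x: "x \<in> V" "c x = 0"
    and eq: "\<And>v. v \<in> V \<Longrightarrow> B x v = c v - l v"
    and l: "\<And>v. v \<in> V \<Longrightarrow> \<bar>l v\<bar> \<le> F * sqrt (B v v)" and "0 \<le> F"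
    and v: "v \<in> V"
  shows "\<bar>c v\<bar> \<le> F * sqrt (B v v)"
proof -
  have expand: "B (\<lambda>s. 1 *\<^sub>R v s + t *\<^sub>R x s) (\<lambda>s. 1 *\<^sub>R v s + t *\<^sub>R x s) = B v v + 2 * t * B x v + t\<^sup>2 * B x x" for t
    using B_lin[OF v x(1) V[OF v x(1)], of 1 t 1 t] B_lin[OF v x(1) v, of 1 t] B_lin[OF v x(1) x(1), of 1 t]
    by (simp add: B_sym[of v "\<lambda>s. v s + t *\<^sub>R x s"] B_sym[of x "\<lambda>s. v s + t *\<^sub>R x s"] B_sym[of v x]
        power2_eq_square algebra_simps)
  have q: "0 \<le> B v v + 2 * t * B x v + t\<^sup>2 * B x x" for t
    using B_nonneg[OF V[OF v x(1), of 1 t]] by (simp only: expand)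
  obtain t where t: "B x v + t * B x x = 0"
  proof (cases "B x x = 0")
    case True
    have "B x v = 0"
    proof (rule ccontr)
      assume "B x v \<noteq> 0"
      then show False using q[of "- (B v v + 1) / (2 * B x v)"] True by (simp add: field_simps)
    qed
    then show ?thesis using that[of 0] by simp
  next
    case False
    then show ?thesis using that[of "- B x v / B x x"] by simp
  qed
  define y where "y = (\<lambda>s. 1 *\<^sub>R v s + t *\<^sub>R x s)"
  have y: "y \<in> V" unfolding y_def by (rule V[OF v x(1)])
  have "B x y = 0"
    using B_lin[OF v x(1) x(1), of 1 t] t by (simp add: y_def B_sym[of x "\<lambda>s. v s + t *\<^sub>R x s"] B_sym[of v x])
  then have "c y = l y" using eq[OF y] by simp
  moreover have "c y = c v" unfolding y_def using c_lin[OF v x(1), of 1 t] x(2) by simp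
  moreover have "B y y \<le> B v v"
  proof -
    have "B x v = - (t * B x x)" using t by simp
    then have "B y y = B v v - t\<^sup>2 * B x x"
      unfolding y_def expand by (simp add: power2_eq_square)
    then show ?thesis using B_nonneg[OF x(1)] by simp
  qed
  then have "F * sqrt (B y y) \<le> F * sqrt (B v v)" using \<open>0 \<le> F\<close> by (intro mult_left_mono) auto
  ultimately show ?thesis using l[OF y] by simp
qed

lemma inf_sup_bound:
  assumes infsup: "inf_sup_condition \<Omega> X\<^sub>h Q\<^sub>h \<beta>" and q: "q \<in> Q\<^sub>h" and "0 \<le> K"
    and K: "\<And>v. v \<in> X\<^sub>h \<Longrightarrow> l2_inner \<Omega> (wdiv \<Omega> v) q \<le> K * l2_norm \<Omega> (wgrad \<Omega> v)"
  shows "\<beta> * l2_norm \<Omega> q \<le> K"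
proof (cases "l2_norm \<Omega> q = 0")
  case True
  then show ?thesis using \<open>0 \<le> K\<close> by simp
next
  case False
  then have pos: "0 < l2_norm \<Omega> q" by (simp add: less_le)
  have "ereal \<beta> \<le> (SUP v\<in>{v \<in> X\<^sub>h. l2_norm \<Omega> (wgrad \<Omega> v) \<noteq> 0}.
                    ereal (l2_inner \<Omega> (wdiv \<Omega> v) q / (l2_norm \<Omega> q * l2_norm \<Omega> (wgrad \<Omega> v))))"
    using infsup q False unfolding inf_sup_condition_def by (auto simp: le_INF_iff)
  also have "\<dots> \<le> ereal (K / l2_norm \<Omega> q)"
  proof (rule SUP_least)
    fix v assume "v \<in> {v \<in> X\<^sub>h. l2_norm \<Omega> (wgrad \<Omega> v) \<noteq> 0}"
    then have "v \<in> X\<^sub>h" "0 < l2_norm \<Omega> (wgrad \<Omega> v)" by (auto simp: less_le)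
    then show "ereal (l2_inner \<Omega> (wdiv \<Omega> v) q / (l2_norm \<Omega> q * l2_norm \<Omega> (wgrad \<Omega> v))) \<le> ereal (K / l2_norm \<Omega> q)"
      using K[of v] pos by (simp add: field_simps)
  qed
  finally show ?thesis using pos by (simp add: field_simps)
qed

lemma inf_sup_nontrivial:
  assumes "inf_sup_condition \<Omega> X\<^sub>h Q\<^sub>h \<beta>"
  obtains v where "v \<in> X\<^sub>h" "0 < l2_norm \<Omega> (wgrad \<Omega> v)"
proof -
  obtain q where q: "q \<in> Q\<^sub>h" "l2_norm \<Omega> q \<noteq> 0" "0 < \<beta>" using assms by (auto simp: inf_sup_condition_def)
  have "\<exists>v\<in>X\<^sub>h. l2_norm \<Omega> (wgrad \<Omega> v) \<noteq> 0"
  proof (rule ccontr)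
    assume "\<not> ?thesis"
    then have none: "{v \<in> X\<^sub>h. l2_norm \<Omega> (wgrad \<Omega> v) \<noteq> 0} = {}" by blast
    have "ereal \<beta> \<le> (SUP v\<in>{v \<in> X\<^sub>h. l2_norm \<Omega> (wgrad \<Omega> v) \<noteq> 0}.
                    ereal (l2_inner \<Omega> (wdiv \<Omega> v) q / (l2_norm \<Omega> q * l2_norm \<Omega> (wgrad \<Omega> v))))"
      using assms q unfolding inf_sup_condition_def by (auto simp: le_INF_iff)
    then show False unfolding none by (simp add: bot_ereal_def)
  qed
  then show ?thesis using that by (auto simp: less_le)
qed

lemma dual_norm_bound:
  assumes f: "in_dual \<Omega> f" and v: "v \<in> velocity_space \<Omega>"
  shows "f v \<le> dual_norm \<Omega> f * l2_norm \<Omega> (wgrad \<Omega> v)"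
proof -
  obtain C where C: "\<And>v. v \<in> velocity_space \<Omega> \<Longrightarrow> \<bar>f v\<bar> \<le> C * l2_norm \<Omega> (wgrad \<Omega> v)"
    using f unfolding in_dual_def by blast
  show ?thesis
  proof (cases "l2_norm \<Omega> (wgrad \<Omega> v) = 0")
    case True
    then show ?thesis using C[OF v] by simp
  next
    case False
    then have pos: "0 < l2_norm \<Omega> (wgrad \<Omega> v)" by (simp add: less_le)
    have "f v / l2_norm \<Omega> (wgrad \<Omega> v) \<le> dual_norm \<Omega> f"
      unfolding dual_norm_def
    proof (rule cSUP_upper)
      show "v \<in> {v \<in> velocity_space \<Omega>. l2_norm \<Omega> (wgrad \<Omega> v) \<noteq> 0}" using v False by simp
      show "bdd_above ((\<lambda>v. f v / l2_norm \<Omega> (wgrad \<Omega> v)) ` {v \<in> velocity_space \<Omega>. l2_norm \<Omega> (wgrad \<Omega> v) \<noteq> 0})"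
      proof (rule bdd_aboveI2[where M = C])
        fix w assume w: "w \<in> {v \<in> velocity_space \<Omega>. l2_norm \<Omega> (wgrad \<Omega> v) \<noteq> 0}"
        then have "0 < l2_norm \<Omega> (wgrad \<Omega> w)" using w by (auto simp: less_le)
        then show "f w / l2_norm \<Omega> (wgrad \<Omega> w) \<le> C" using C[of w] w by (auto simp: divide_le_eq)
      qed
    qed
    then show ?thesis using pos by (simp add: divide_le_eq)
  qed
qed

text \<open>With \<open>t = 1 / sqrt \<nu>\<close> the rate constant is \<open>sqrt 2 C\<^sub>1 \<beta>\<^sup>-\<^sup>2 (204 t\<^sup>2 + 24 t + 204)\<close>, and \<open>108\<close> is the largest
  number whose multiple of \<open>(1 + t)\<^sup>2\<close> stays below the quadratic for all \<open>t\<close>; equality holds at \<open>t = 1\<close>.\<close>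

lemma rate_constant_lower_bound:
  assumes "0 < \<nu>" "0 < C\<^sub>1" "0 < \<beta>"
  shows "108 * (1 + 1 / sqrt \<nu>)\<^sup>2 * (sqrt 2 * C\<^sub>1) \<le> \<beta>\<^sup>2 * rate_constant \<nu> C\<^sub>1 \<beta>"
proof -
  define t where "t = 1 / sqrt \<nu>"
  have t: "\<nu> powi (-1) = t\<^sup>2" "\<nu> powr (-1/2) = t"
    using assms(1) by (simp_all add: t_def power_divide power_int_minus inverse_eq_divide powr_minus powr_half_sqrt)
  have "\<beta>\<^sup>2 * rate_constant \<nu> C\<^sub>1 \<beta> = (204 * t\<^sup>2 + 24 * t + 204) * (sqrt 2 * C\<^sub>1)"
    unfolding rate_constant_def t using assms(3)
    by (simp add: power_int_minus field_simps)
  moreover have "108 * (1 + t)\<^sup>2 \<le> 204 * t\<^sup>2 + 24 * t + 204"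
    using zero_le_power2[of "1 - t"] by (simp add: power2_eq_square algebra_simps)
  then have "108 * (1 + t)\<^sup>2 * (sqrt 2 * C\<^sub>1) \<le> (204 * t\<^sup>2 + 24 * t + 204) * (sqrt 2 * C\<^sub>1)"
    using assms(2) by (intro mult_right_mono) auto
  ultimately show ?thesis by (simp add: t_def)
qed

section \<open>Estimates for the nudged discrete problem\<close>

text \<open>The relations between the parameters and the discrete velocity space that make the linear part
  of the scheme coercive, uniformly in the fine mesh.\<close>

locale nudged_discretization =
  fixes \<Omega> :: "(real^'n) set" and X\<^sub>h :: "(real^'n \<Rightarrow> real^'n) set"
    and I\<^sub>H :: "(real^'n \<Rightarrow> real^'n) \<Rightarrow> (real^'n \<Rightarrow> real^'n)"
    and \<nu> \<gamma> \<mu> C\<^sub>1 C\<^sub>P H :: real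
  assumes dim: "CARD('n) \<le> 3"
    and open_domain: "open \<Omega>" and bounded_domain: "bounded \<Omega>"
    and X\<^sub>h: "X\<^sub>h \<subseteq> bounded_velocities \<Omega>"
    and X\<^sub>h_lincomb: "\<And>v w a b. v \<in> X\<^sub>h \<Longrightarrow> w \<in> X\<^sub>h \<Longrightarrow> (\<lambda>x. a *\<^sub>R v x + b *\<^sub>R w x) \<in> X\<^sub>h"
    and interp: "interpolation_operator \<Omega> H C\<^sub>1 I\<^sub>H"
    and pos: "0 < \<nu>" "0 < C\<^sub>1" "0 < H" "0 < C\<^sub>P"
    and poincare: "\<And>v. v \<in> X\<^sub>h \<Longrightarrow> l2_norm \<Omega> v \<le> C\<^sub>P * l2_norm \<Omega> (wgrad \<Omega> v)"
    and mu: "\<nu> / (2 * C\<^sub>1\<^sup>2 * H\<^sup>2) \<le> \<mu>"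
    and gamma: "2 * \<mu>\<^sup>2 * C\<^sub>1 ^ 6 * C\<^sub>P\<^sup>2 * H\<^sup>2 * inverse \<nu> \<le> \<gamma>" "\<nu> \<le> \<gamma>"
begin

definition energy :: "(real^'n \<Rightarrow> real^'n) \<Rightarrow> (real^'n \<Rightarrow> real^'n) \<Rightarrow> real" where
  "energy v w = \<nu> * l2_inner \<Omega> (wgrad \<Omega> v) (wgrad \<Omega> w) + \<gamma> * l2_inner \<Omega> (wdiv \<Omega> v) (wdiv \<Omega> w)
     + \<mu> * l2_inner \<Omega> (I\<^sub>H v) (I\<^sub>H w)"

abbreviation "viscous v \<equiv> \<nu> * (l2_norm \<Omega> (wgrad \<Omega> v))\<^sup>2"
abbreviation "graddiv v \<equiv> \<gamma> * (l2_norm \<Omega> (wdiv \<Omega> v))\<^sup>2"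
abbreviation "nudging v \<equiv> \<mu> * (l2_norm \<Omega> (I\<^sub>H v))\<^sup>2"
abbreviation "kappa \<equiv> sqrt 2 * C\<^sub>1 * H"

lemma parameters_pos: "0 < \<mu>" "0 < \<gamma>" "0 < kappa"
proof -
  have "0 < \<nu> / (2 * C\<^sub>1\<^sup>2 * H\<^sup>2)" using pos by simp
  then show "0 < \<mu>" using mu by linarith
  show "0 < \<gamma>" using pos(1) gamma(2) by linarith
  show "0 < kappa" using pos by simp
qed

lemma X\<^sub>h_velocity:
  assumes "v \<in> X\<^sub>h"
  shows "v \<in> velocity_space \<Omega>" "v \<in> L2 \<Omega>" "wgrad \<Omega> v \<in> L2 \<Omega>" "wdiv \<Omega> v \<in> L2 \<Omega>" "I\<^sub>H v \<in> L2 \<Omega>"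
proof -
  show V: "v \<in> velocity_space \<Omega>" using assms X\<^sub>h by (auto simp: bounded_velocities_def)
  show "v \<in> L2 \<Omega>" "wgrad \<Omega> v \<in> L2 \<Omega>" "wdiv \<Omega> v \<in> L2 \<Omega>" using velocity_space_L2[OF V] by simp_all
  show "I\<^sub>H v \<in> L2 \<Omega>" using interp V by (simp add: interpolation_operator_def)
qed

lemma
  assumes u: "u \<in> X\<^sub>h" and v: "v \<in> X\<^sub>h"
  shows inner_wgrad_lincomb: "w \<in> X\<^sub>h \<Longrightarrow> l2_inner \<Omega> (wgrad \<Omega> (\<lambda>x. a *\<^sub>R u x + b *\<^sub>R v x)) (wgrad \<Omega> w)
      = a * l2_inner \<Omega> (wgrad \<Omega> u) (wgrad \<Omega> w) + b * l2_inner \<Omega> (wgrad \<Omega> v) (wgrad \<Omega> w)"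
    and inner_wdiv_lincomb: "q \<in> L2 \<Omega> \<Longrightarrow> l2_inner \<Omega> (wdiv \<Omega> (\<lambda>x. a *\<^sub>R u x + b *\<^sub>R v x)) q
      = a * l2_inner \<Omega> (wdiv \<Omega> u) q + b * l2_inner \<Omega> (wdiv \<Omega> v) q"
    and inner_interp_lincomb: "w \<in> X\<^sub>h \<Longrightarrow> l2_inner \<Omega> (I\<^sub>H (\<lambda>x. a *\<^sub>R u x + b *\<^sub>R v x)) (I\<^sub>H w)
      = a * l2_inner \<Omega> (I\<^sub>H u) (I\<^sub>H w) + b * l2_inner \<Omega> (I\<^sub>H v) (I\<^sub>H w)"
proof -
  note U = X\<^sub>h_velocity[OF u] and V = X\<^sub>h_velocity[OF v] and L = X\<^sub>h_velocity[OF X\<^sub>h_lincomb[OF u v, of a b]]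
  show "l2_inner \<Omega> (wgrad \<Omega> (\<lambda>x. a *\<^sub>R u x + b *\<^sub>R v x)) (wgrad \<Omega> w)
      = a * l2_inner \<Omega> (wgrad \<Omega> u) (wgrad \<Omega> w) + b * l2_inner \<Omega> (wgrad \<Omega> v) (wgrad \<Omega> w)" if "w \<in> X\<^sub>h"
    using that by (intro l2_inner_lincomb_left_AE U V L X\<^sub>h_velocity wgrad_lincomb open_domain bounded_domain)
  show "l2_inner \<Omega> (wdiv \<Omega> (\<lambda>x. a *\<^sub>R u x + b *\<^sub>R v x)) q
      = a * l2_inner \<Omega> (wdiv \<Omega> u) q + b * l2_inner \<Omega> (wdiv \<Omega> v) q" if "q \<in> L2 \<Omega>"
    using that by (intro l2_inner_lincomb_left_AE U V L wdiv_lincomb open_domain bounded_domain)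
  have "AE x in lebesgue_on \<Omega>. I\<^sub>H (\<lambda>y. a *\<^sub>R u y + b *\<^sub>R v y) x = a *\<^sub>R I\<^sub>H u x + b *\<^sub>R I\<^sub>H v x"
    using interp U(1) V(1) by (simp add: interpolation_operator_def)
  then show "l2_inner \<Omega> (I\<^sub>H (\<lambda>x. a *\<^sub>R u x + b *\<^sub>R v x)) (I\<^sub>H w)
      = a * l2_inner \<Omega> (I\<^sub>H u) (I\<^sub>H w) + b * l2_inner \<Omega> (I\<^sub>H v) (I\<^sub>H w)" if "w \<in> X\<^sub>h"
    using that by (intro l2_inner_lincomb_left_AE U V L X\<^sub>h_velocity)
qed

lemma energy_lincomb:
  assumes "u \<in> X\<^sub>h" "v \<in> X\<^sub>h" "w \<in> X\<^sub>h"
  shows "energy (\<lambda>x. a *\<^sub>R u x + b *\<^sub>R v x) w = a * energy u w + b * energy v w"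
  using assms X\<^sub>h_velocity(4)[OF assms(3)]
  by (simp add: energy_def inner_wgrad_lincomb inner_wdiv_lincomb inner_interp_lincomb algebra_simps)

lemma energy_sym: "energy u v = energy v u"
  by (simp add: energy_def l2_inner_commute)

lemma energy_self: "energy v v = viscous v + graddiv v + nudging v"
  by (simp add: energy_def l2_norm_squared)

lemma energy_self_nonneg: "0 \<le> energy v v"
  using parameters_pos pos by (simp add: energy_self)

lemma convection_lincomb:
  assumes "c \<in> X\<^sub>h" "u \<in> X\<^sub>h" "v \<in> X\<^sub>h" "w \<in> X\<^sub>h"
  shows "convection \<Omega> c (\<lambda>x. a *\<^sub>R u x + b *\<^sub>R v x) w = a * convection \<Omega> c u w + b * convection \<Omega> c v w"
    and "convection \<Omega> c w (\<lambda>x. a *\<^sub>R u x + b *\<^sub>R v x) = a * convection \<Omega> c w u + b * convection \<Omega> c w v"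
    and "convection \<Omega> (\<lambda>x. a *\<^sub>R u x + b *\<^sub>R v x) c w = a * convection \<Omega> u c w + b * convection \<Omega> v c w"
proof -
  have l: "(\<lambda>x. a *\<^sub>R u x + b *\<^sub>R v x) \<in> bounded_velocities \<Omega>"
    using X\<^sub>h_lincomb[OF assms(2,3)] X\<^sub>h by blast
  note B = assms[THEN subsetD[OF X\<^sub>h]]
  show 1: "convection \<Omega> c (\<lambda>x. a *\<^sub>R u x + b *\<^sub>R v x) w = a * convection \<Omega> c u w + b * convection \<Omega> c v w"
    by (rule convection_lincomb_middle[OF open_domain bounded_domain B(1,4,2,3) l])
  then show "convection \<Omega> c w (\<lambda>x. a *\<^sub>R u x + b *\<^sub>R v x) = a * convection \<Omega> c w u + b * convection \<Omega> c w v"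
    by (simp add: convection_antisym[of \<Omega> c w])
  show "convection \<Omega> (\<lambda>x. a *\<^sub>R u x + b *\<^sub>R v x) c w = a * convection \<Omega> u c w + b * convection \<Omega> v c w"
    by (rule convection_lincomb_left[OF open_domain bounded_domain B(2,3) l B(4,1)])
qed

lemma l2_norm_le_interpolant:
  assumes v: "v \<in> X\<^sub>h"
  shows "l2_norm \<Omega> v \<le> l2_norm \<Omega> (I\<^sub>H v) + C\<^sub>1 * H * l2_norm \<Omega> (wgrad \<Omega> v)"
proof -
  note V = X\<^sub>h_velocity[OF v]
  have "(\<lambda>x. v x - I\<^sub>H v x) \<in> L2 \<Omega>" using L2_lincomb[OF V(2,5), of 1 "-1"] by simp
  from l2_norm_triangle[OF V(5) this]
  have "l2_norm \<Omega> v \<le> l2_norm \<Omega> (I\<^sub>H v) + l2_norm \<Omega> (\<lambda>x. v x - I\<^sub>H v x)" by simp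
  moreover have "l2_norm \<Omega> (\<lambda>x. v x - I\<^sub>H v x) \<le> C\<^sub>1 * H * l2_norm \<Omega> (wgrad \<Omega> v)"
    using interp V(1) by (simp add: interpolation_operator_def l2_norm_diff_commute[of \<Omega> v])
  ultimately show ?thesis by linarith
qed

text \<open>The nudging controls the coarse part \<open>I\<^sub>H v\<close> and the viscosity the remainder \<open>v - I\<^sub>H v\<close>, whose norm is
  at most \<open>C\<^sub>1 H \<parallel>\<nabla>v\<parallel>\<close>; the weight on the left balances the two contributions.\<close>

lemma l2_norm_le_nudging:
  assumes v: "v \<in> X\<^sub>h"
  shows "\<nu> / (2 * C\<^sub>1\<^sup>2 * H\<^sup>2) * (l2_norm \<Omega> v)\<^sup>2 \<le> 2 * nudging v + viscous v"
proof -
  have "(l2_norm \<Omega> v)\<^sup>2 \<le> (l2_norm \<Omega> (I\<^sub>H v) + C\<^sub>1 * H * l2_norm \<Omega> (wgrad \<Omega> v))\<^sup>2"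
    using l2_norm_le_interpolant[OF v] by (intro power_mono) simp_all
  also have "\<dots> \<le> 2 * (l2_norm \<Omega> (I\<^sub>H v))\<^sup>2 + 2 * (C\<^sub>1 * H * l2_norm \<Omega> (wgrad \<Omega> v))\<^sup>2"
    using sum_squares_bound[of "l2_norm \<Omega> (I\<^sub>H v)" "C\<^sub>1 * H * l2_norm \<Omega> (wgrad \<Omega> v)"]
    by (simp add: power2_sum)
  finally have "\<nu> / (2 * C\<^sub>1\<^sup>2 * H\<^sup>2) * (l2_norm \<Omega> v)\<^sup>2
      \<le> \<nu> / (2 * C\<^sub>1\<^sup>2 * H\<^sup>2) * (2 * (l2_norm \<Omega> (I\<^sub>H v))\<^sup>2 + 2 * (C\<^sub>1 * H * l2_norm \<Omega> (wgrad \<Omega> v))\<^sup>2)"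
    using pos by (intro mult_left_mono) auto
  also have "\<dots> = 2 * (\<nu> / (2 * C\<^sub>1\<^sup>2 * H\<^sup>2) * (l2_norm \<Omega> (I\<^sub>H v))\<^sup>2) + viscous v"
    using pos by (simp add: power_mult_distrib field_simps)
  also have "\<dots> \<le> 2 * nudging v + viscous v"
    using mult_right_mono[OF mu, of "(l2_norm \<Omega> (I\<^sub>H v))\<^sup>2"] by simp
  finally show ?thesis .
qed

lemma norm_product_eq:
  "\<nu> * (l2_norm \<Omega> v * l2_norm \<Omega> (wgrad \<Omega> v))
    = kappa * sqrt (\<nu> / (2 * C\<^sub>1\<^sup>2 * H\<^sup>2) * (l2_norm \<Omega> v)\<^sup>2 * viscous v)"
proof -
  have "sqrt (\<nu> / (2 * C\<^sub>1\<^sup>2 * H\<^sup>2) * (l2_norm \<Omega> v)\<^sup>2 * viscous v)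
      = sqrt ((\<nu> / kappa * (l2_norm \<Omega> v * l2_norm \<Omega> (wgrad \<Omega> v)))\<^sup>2)"
    by (intro arg_cong[of _ _ sqrt]) (simp add: power2_eq_square field_simps)
  also have "\<dots> = \<nu> / kappa * (l2_norm \<Omega> v * l2_norm \<Omega> (wgrad \<Omega> v))"
    using pos parameters_pos by (intro real_sqrt_unique) auto
  finally show ?thesis using pos by simp
qed

text \<open>The source of the factor \<open>H\<close> in the contraction rate.  The bound
  \<open>(2 b + a) a \<le> (a + b)\<^sup>2\<close> avoids the factor \<open>sqrt 2\<close> that a separate estimate of \<open>\<parallel>v\<parallel>\<close> would cost.\<close>

lemma norm_product_le_energy:
  assumes v: "v \<in> X\<^sub>h"
  shows "\<nu> * (l2_norm \<Omega> v * l2_norm \<Omega> (wgrad \<Omega> v)) \<le> kappa * (viscous v + nudging v)"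
proof -
  have n: "0 \<le> viscous v" "0 \<le> nudging v" using pos parameters_pos by simp_all
  have square: "(2 * b + a) * a \<le> (a + b)\<^sup>2" for a b :: real
    using zero_le_power2[of b] by (simp add: power2_eq_square algebra_simps)
  have "\<nu> / (2 * C\<^sub>1\<^sup>2 * H\<^sup>2) * (l2_norm \<Omega> v)\<^sup>2 * viscous v \<le> (2 * nudging v + viscous v) * viscous v"
    using l2_norm_le_nudging[OF v] n by (intro mult_right_mono)
  also have "\<dots> \<le> (viscous v + nudging v)\<^sup>2" by (rule square)
  finally have "sqrt (\<nu> / (2 * C\<^sub>1\<^sup>2 * H\<^sup>2) * (l2_norm \<Omega> v)\<^sup>2 * viscous v) \<le> viscous v + nudging v"
    using n by (intro real_le_lsqrt) auto
  then show ?thesis unfolding norm_product_eq using parameters_pos by (intro mult_left_mono) auto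
qed

text \<open>The lower bounds of \<open>\<gamma>\<close> and \<open>\<mu>\<close> give \<open>\<mu> C\<^sub>1\<^sup>4 C\<^sub>P\<^sup>2 \<le> \<gamma>\<close>, which with the Poincare inequality suffices as long as
  \<open>C\<^sub>1\<close> is not small.  For \<open>C\<^sub>1 < 1\<close> the two properties of the interpolant force
  \<open>(1 - C\<^sub>1) \<parallel>v\<parallel> \<le> C\<^sub>1 H \<parallel>\<nabla>v\<parallel>\<close>, which is combined with the Poincare inequality in a geometric mean.  The
  threshold \<open>2/3\<close> keeps the constant of both cases at most \<open>9/4\<close>.\<close>

lemma nudging_le_gamma:
  assumes v: "v \<in> X\<^sub>h"
  shows "nudging v \<le> 9 / 4 * \<gamma> * (l2_norm \<Omega> (wgrad \<Omega> v))\<^sup>2"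
proof -
  note V = X\<^sub>h_velocity[OF v]
  define a l where "a = l2_norm \<Omega> (wgrad \<Omega> v)" and "l = l2_norm \<Omega> v"
  have a: "0 \<le> a" and l: "0 \<le> l" by (simp_all add: a_def l_def)
  have I: "l2_norm \<Omega> (I\<^sub>H v) \<le> C\<^sub>1 * l" using interp V(1) by (simp add: interpolation_operator_def l_def)
  then have "(l2_norm \<Omega> (I\<^sub>H v))\<^sup>2 \<le> (C\<^sub>1 * l)\<^sup>2" by (intro power_mono) simp_all
  then have nud: "nudging v \<le> \<mu> * C\<^sub>1\<^sup>2 * l\<^sup>2" using parameters_pos by (simp add: power_mult_distrib)
  have lP: "l \<le> C\<^sub>P * a" using poincare[OF v] by (simp add: l_def a_def)
  have \<mu>: "\<nu> \<le> \<mu> * (2 * C\<^sub>1\<^sup>2 * H\<^sup>2)" using mu pos by (simp add: divide_le_eq)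
  have \<gamma>\<nu>: "2 * \<mu>\<^sup>2 * C\<^sub>1 ^ 6 * C\<^sub>P\<^sup>2 * H\<^sup>2 \<le> \<gamma> * \<nu>"
    using gamma(1) pos(1) by (simp add: field_simps)
  have "\<mu> * C\<^sub>1\<^sup>2 * l\<^sup>2 \<le> 9 / 4 * \<gamma> * a\<^sup>2"
  proof (cases "2 / 3 \<le> C\<^sub>1")
    case True
    have "\<nu> * (\<mu> * C\<^sub>1 ^ 4 * C\<^sub>P\<^sup>2) \<le> \<mu> * (2 * C\<^sub>1\<^sup>2 * H\<^sup>2) * (\<mu> * C\<^sub>1 ^ 4 * C\<^sub>P\<^sup>2)"
      using \<mu> parameters_pos pos by (intro mult_right_mono) auto
    also have "\<dots> = 2 * \<mu>\<^sup>2 * C\<^sub>1 ^ 6 * C\<^sub>P\<^sup>2 * H\<^sup>2" by (simp add: power2_eq_square eval_nat_numeral mult_ac)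
    also have "\<dots> \<le> \<nu> * \<gamma>" using \<gamma>\<nu> by (simp add: mult.commute)
    finally have 1: "\<mu> * C\<^sub>1 ^ 4 * C\<^sub>P\<^sup>2 \<le> \<gamma>" using pos(1) by simp
    have "(2 / 3)\<^sup>2 \<le> C\<^sub>1\<^sup>2" using True by (intro power_mono) auto
    then have "4 / 9 * (\<mu> * C\<^sub>1\<^sup>2 * C\<^sub>P\<^sup>2) \<le> C\<^sub>1\<^sup>2 * (\<mu> * C\<^sub>1\<^sup>2 * C\<^sub>P\<^sup>2)"
      using parameters_pos by (intro mult_right_mono) (auto simp: power2_eq_square)
    also have "\<dots> \<le> \<gamma>" using 1 by (simp add: power2_eq_square eval_nat_numeral mult_ac)
    finally have "\<mu> * C\<^sub>1\<^sup>2 * C\<^sub>P\<^sup>2 \<le> 9 / 4 * \<gamma>" by simp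
    then have "\<mu> * C\<^sub>1\<^sup>2 * C\<^sub>P\<^sup>2 * a\<^sup>2 \<le> 9 / 4 * \<gamma> * a\<^sup>2" by (rule mult_right_mono) simp
    moreover have "l\<^sup>2 \<le> (C\<^sub>P * a)\<^sup>2" using lP l by (intro power_mono)
    then have "\<mu> * C\<^sub>1\<^sup>2 * l\<^sup>2 \<le> \<mu> * C\<^sub>1\<^sup>2 * (C\<^sub>P * a)\<^sup>2" using parameters_pos by (intro mult_left_mono) auto
    ultimately show ?thesis by (simp add: power_mult_distrib mult_ac)
  next
    case False
    have "l \<le> l2_norm \<Omega> (I\<^sub>H v) + C\<^sub>1 * H * a"
      using l2_norm_le_interpolant[OF v] by (simp add: l_def a_def)
    also have "\<dots> \<le> 2 / 3 * l + C\<^sub>1 * H * a"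
      using I mult_right_mono[of C\<^sub>1 "2 / 3" l] False l by simp
    finally have lH: "l \<le> 3 * (C\<^sub>1 * H * a)" by simp
    have "l * l \<le> (C\<^sub>P * a) * (3 * (C\<^sub>1 * H * a))"
      using lP lH l a pos by (intro mult_mono) auto
    then have 1: "\<mu> * C\<^sub>1\<^sup>2 * l\<^sup>2 \<le> \<mu> * C\<^sub>1\<^sup>2 * ((C\<^sub>P * a) * (3 * (C\<^sub>1 * H * a)))"
      using parameters_pos by (intro mult_left_mono) (auto simp: power2_eq_square)
    have \<gamma>\<gamma>: "\<gamma> * \<nu> \<le> \<gamma> * \<gamma>" using mult_left_mono[OF gamma(2), of \<gamma>] parameters_pos by simp
    have square: "(3 * \<mu> * C\<^sub>1 ^ 3 * H * C\<^sub>P)\<^sup>2 = 9 / 2 * (2 * \<mu>\<^sup>2 * C\<^sub>1 ^ 6 * C\<^sub>P\<^sup>2 * H\<^sup>2)"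
      by (simp add: power2_eq_square eval_nat_numeral mult_ac)
    have "9 / 2 * (2 * \<mu>\<^sup>2 * C\<^sub>1 ^ 6 * C\<^sub>P\<^sup>2 * H\<^sup>2) \<le> 9 / 2 * (\<gamma> * \<gamma>)"
      by (rule mult_left_mono[OF order_trans[OF \<gamma>\<nu> \<gamma>\<gamma>]]) simp
    moreover have "9 / 2 * (\<gamma> * \<gamma>) \<le> (9 / 4 * \<gamma>)\<^sup>2" by (simp add: power2_eq_square)
    ultimately have "(3 * \<mu> * C\<^sub>1 ^ 3 * H * C\<^sub>P)\<^sup>2 \<le> (9 / 4 * \<gamma>)\<^sup>2" unfolding square by (rule order_trans)
    then have "3 * \<mu> * C\<^sub>1 ^ 3 * H * C\<^sub>P \<le> 9 / 4 * \<gamma>"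
      by (rule power2_le_imp_le) (use parameters_pos in simp)
    then have "3 * \<mu> * C\<^sub>1 ^ 3 * H * C\<^sub>P * a\<^sup>2 \<le> 9 / 4 * \<gamma> * a\<^sup>2" by (rule mult_right_mono) simp
    then show ?thesis using 1 by (simp add: power2_eq_square eval_nat_numeral mult_ac)
  qed
  then show ?thesis using nud by (simp add: a_def)
qed

lemma wdiv_norm_le:
  assumes v: "v \<in> X\<^sub>h"
  shows "(l2_norm \<Omega> (wdiv \<Omega> v))\<^sup>2 \<le> 3 * (l2_norm \<Omega> (wgrad \<Omega> v))\<^sup>2"
  using l2_norm_wdiv_le[OF X\<^sub>h_velocity(1)[OF v]] dim mult_right_mono[of "real CARD('n)" 3 "(l2_norm \<Omega> (wgrad \<Omega> v))\<^sup>2"]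
  by simp

lemma wgrad_norm_triangle:
  assumes v: "v \<in> X\<^sub>h" and w: "w \<in> X\<^sub>h"
  shows "l2_norm \<Omega> (wgrad \<Omega> (\<lambda>x. v x + w x)) \<le> l2_norm \<Omega> (wgrad \<Omega> v) + l2_norm \<Omega> (wgrad \<Omega> w)"
proof -
  define y where "y = (\<lambda>x. 1 *\<^sub>R v x + 1 *\<^sub>R w x)"
  have y: "y \<in> X\<^sub>h" unfolding y_def by (rule X\<^sub>h_lincomb[OF v w])
  define N where "N v = l2_norm \<Omega> (wgrad \<Omega> v)" for v
  have "(N y)\<^sup>2 = l2_inner \<Omega> (wgrad \<Omega> v) (wgrad \<Omega> y) + l2_inner \<Omega> (wgrad \<Omega> w) (wgrad \<Omega> y)"
    using inner_wgrad_lincomb[OF v w y, of 1 1] unfolding y_def[symmetric] by (simp add: N_def l2_norm_squared)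
  also have "\<dots> \<le> N v * N y + N w * N y"
    using l2_Cauchy_Schwarz[OF X\<^sub>h_velocity(3)[OF v] X\<^sub>h_velocity(3)[OF y]]
      l2_Cauchy_Schwarz[OF X\<^sub>h_velocity(3)[OF w] X\<^sub>h_velocity(3)[OF y]]
    by (simp add: N_def abs_le_iff)
  finally have "N y * N y \<le> (N v + N w) * N y" by (simp add: power2_eq_square algebra_simps)
  moreover have "0 \<le> N v" "0 \<le> N w" "0 \<le> N y" by (simp_all add: N_def)
  ultimately have "N y \<le> N v + N w"
    by (cases "N y = 0") (auto intro: mult_right_le_imp_le simp: less_le)
  then show ?thesis by (simp add: N_def y_def)
qed

text \<open>The viscous, grad-div and nudging parts contribute \<open>1 + 3 + 9/4\<close>.\<close>

lemma energy_le_gamma: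
  assumes v: "v \<in> X\<^sub>h"
  shows "energy v v \<le> 25 / 4 * \<gamma> * (l2_norm \<Omega> (wgrad \<Omega> v))\<^sup>2"
proof -
  have "viscous v \<le> \<gamma> * (l2_norm \<Omega> (wgrad \<Omega> v))\<^sup>2" using gamma(2) by (intro mult_right_mono) auto
  moreover note wdiv_norm_le[OF v]
  then have "graddiv v \<le> \<gamma> * (3 * (l2_norm \<Omega> (wgrad \<Omega> v))\<^sup>2)" using parameters_pos by (intro mult_left_mono) auto
  ultimately show ?thesis using nudging_le_gamma[OF v] by (simp add: energy_self)
qed

text \<open>Both half powers in the interpolation inequality for the convective form are converted into
  \<open>sqrt kappa\<close> times an energy norm.\<close>

lemma convection_le_energy:
  assumes "0 \<le> M"
    and M: "\<And>a b c. \<lbrakk>a \<in> velocity_space \<Omega>; b \<in> velocity_space \<Omega>; c \<in> velocity_space \<Omega>\<rbrakk> \<Longrightarrow>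
         convection \<Omega> a b c \<le> M * sqrt (l2_norm \<Omega> a) * sqrt (l2_norm \<Omega> (wgrad \<Omega> a))
           * l2_norm \<Omega> (wgrad \<Omega> b) * l2_norm \<Omega> (wgrad \<Omega> c)"
    and c: "c \<in> X\<^sub>h" and e: "e \<in> X\<^sub>h" and v: "v \<in> X\<^sub>h" and A: "M * l2_norm \<Omega> (wgrad \<Omega> c) \<le> A * \<nu>"
  shows "\<bar>convection \<Omega> c e v\<bar>
     \<le> 2 * sqrt 3 * A * sqrt kappa * sqrt (viscous e + nudging e) * sqrt (viscous v + nudging v)"
proof -
  define E W where "E = viscous e + nudging e" and "W = viscous v + nudging v"
  define S where "S e v = sqrt (l2_norm \<Omega> e * l2_norm \<Omega> (wgrad \<Omega> e)) * l2_norm \<Omega> (wgrad \<Omega> v)" for e v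
  have S_nonneg: "0 \<le> S e v" for e v by (simp add: S_def)
  have S: "\<nu> * S e v \<le> sqrt kappa * sqrt (viscous e + nudging e) * sqrt (viscous v + nudging v)"
    if e: "e \<in> X\<^sub>h" for e v
  proof -
    have "\<nu> * S e v = sqrt (\<nu> * (l2_norm \<Omega> e * l2_norm \<Omega> (wgrad \<Omega> e))) * (sqrt \<nu> * l2_norm \<Omega> (wgrad \<Omega> v))"
      using pos(1) by (simp add: S_def real_sqrt_mult)
    also have "\<dots> \<le> sqrt (kappa * (viscous e + nudging e)) * sqrt (viscous v + nudging v)"
    proof (intro mult_mono)
      show "sqrt (\<nu> * (l2_norm \<Omega> e * l2_norm \<Omega> (wgrad \<Omega> e))) \<le> sqrt (kappa * (viscous e + nudging e))"
        using norm_product_le_energy[OF e] by simp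
      have "sqrt \<nu> * l2_norm \<Omega> (wgrad \<Omega> v) = sqrt (viscous v)" by (simp add: real_sqrt_mult)
      also have "\<dots> \<le> sqrt (viscous v + nudging v)" using parameters_pos by simp
      finally show "sqrt \<nu> * l2_norm \<Omega> (wgrad \<Omega> v) \<le> sqrt (viscous v + nudging v)" .
    qed (use pos in \<open>auto intro!: mult_nonneg_nonneg add_nonneg_nonneg simp: parameters_pos less_imp_le\<close>)
    finally show ?thesis by (simp add: real_sqrt_mult)
  qed
  have bd: "convection \<Omega> c x y \<le> sqrt 3 * (M * l2_norm \<Omega> (wgrad \<Omega> c)) * (S x y + S y x)"
    if x: "x \<in> X\<^sub>h" and y: "y \<in> X\<^sub>h" for x y
  proof -
    note B = subsetD[OF X\<^sub>h]
    have "convection \<Omega> c x y \<le> sqrt (real CARD('n)) * M * l2_norm \<Omega> (wgrad \<Omega> c) * (S x y + S y x)"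
      using convection_interpolation[OF open_domain bounded_domain \<open>0 \<le> M\<close> M B[OF c] B[OF y] B[OF x]]
      by (simp add: S_def)
    also have "\<dots> = sqrt (real CARD('n)) * (M * l2_norm \<Omega> (wgrad \<Omega> c) * (S x y + S y x))" by (simp add: mult.assoc)
    also have "\<dots> \<le> sqrt 3 * (M * l2_norm \<Omega> (wgrad \<Omega> c) * (S x y + S y x))"
      using dim \<open>0 \<le> M\<close> S_nonneg by (intro mult_right_mono mult_nonneg_nonneg add_nonneg_nonneg) auto
    finally show ?thesis by (simp add: mult.assoc)
  qed
  have "\<bar>convection \<Omega> c e v\<bar> \<le> sqrt 3 * (M * l2_norm \<Omega> (wgrad \<Omega> c)) * (S e v + S v e)"
    using bd[OF e v] bd[OF v e] by (simp add: convection_antisym[of \<Omega> c v e] add.commute abs_le_iff)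
  also have "\<dots> \<le> sqrt 3 * (A * \<nu>) * (S e v + S v e)"
    using A S_nonneg by (intro mult_right_mono mult_left_mono add_nonneg_nonneg) auto
  also have "\<dots> = sqrt 3 * A * (\<nu> * S e v + \<nu> * S v e)" by (simp add: algebra_simps)
  also have "\<dots> \<le> sqrt 3 * A * (sqrt kappa * sqrt E * sqrt W + sqrt kappa * sqrt W * sqrt E)"
  proof (intro mult_left_mono add_mono)
    show "\<nu> * S e v \<le> sqrt kappa * sqrt E * sqrt W" "\<nu> * S v e \<le> sqrt kappa * sqrt W * sqrt E"
      using S[OF e] S[OF v] by (simp_all add: E_def W_def)
    have "0 \<le> A * \<nu>" using A \<open>0 \<le> M\<close> by (meson l2_norm_nonneg mult_nonneg_nonneg order_trans)
    then show "0 \<le> sqrt 3 * A" using pos(1) by (simp add: zero_le_mult_iff)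
  qed
  finally show ?thesis by (simp add: E_def W_def algebra_simps)
qed

lemma convection_le_error:
  assumes "0 \<le> M"
    and M: "\<And>a b c. \<lbrakk>a \<in> velocity_space \<Omega>; b \<in> velocity_space \<Omega>; c \<in> velocity_space \<Omega>\<rbrakk> \<Longrightarrow>
         convection \<Omega> a b c \<le> M * sqrt (l2_norm \<Omega> a) * sqrt (l2_norm \<Omega> (wgrad \<Omega> a))
           * l2_norm \<Omega> (wgrad \<Omega> b) * l2_norm \<Omega> (wgrad \<Omega> c)"
    and c: "c \<in> X\<^sub>h" and u: "u \<in> X\<^sub>h" and v: "v \<in> X\<^sub>h" and A: "M * l2_norm \<Omega> (wgrad \<Omega> u) \<le> A * \<nu>"
  shows "\<bar>convection \<Omega> c u v\<bar> \<le> A * sqrt (\<nu> * (l2_norm \<Omega> c * l2_norm \<Omega> (wgrad \<Omega> c))) * sqrt (viscous v)"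
proof -
  define S where "S = sqrt (l2_norm \<Omega> c * l2_norm \<Omega> (wgrad \<Omega> c))"
  note V = X\<^sub>h_velocity(1)
  have "\<bar>convection \<Omega> c u v\<bar> \<le> (M * l2_norm \<Omega> (wgrad \<Omega> u)) * (S * l2_norm \<Omega> (wgrad \<Omega> v))"
    using M[OF V[OF c] V[OF u] V[OF v]] M[OF V[OF c] V[OF v] V[OF u]]
    by (simp add: S_def real_sqrt_mult convection_antisym[of \<Omega> c v u] abs_le_iff mult_ac)
  also have "\<dots> \<le> (A * \<nu>) * (S * l2_norm \<Omega> (wgrad \<Omega> v))"
    using A by (intro mult_right_mono) (auto simp: S_def)
  also have "\<dots> = A * (sqrt \<nu> * S) * (sqrt \<nu> * l2_norm \<Omega> (wgrad \<Omega> v))"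
    using pos(1) by simp
  finally show ?thesis by (simp add: S_def real_sqrt_mult)
qed

lemma pressure_divergence_le:
  assumes "q \<in> L2 \<Omega>" "v \<in> X\<^sub>h"
  shows "\<bar>l2_inner \<Omega> q (wdiv \<Omega> v)\<bar> \<le> l2_norm \<Omega> q / sqrt \<gamma> * sqrt (graddiv v)"
  using l2_Cauchy_Schwarz[OF assms(1) X\<^sub>h_velocity(4)[OF assms(2)]] parameters_pos
  by (simp add: real_sqrt_mult)

text \<open>The first and the third step of the algorithm have the same error equation, with
  different pressures \<open>r\<close>.  The convective terms are split as
  \<open>b(u,u,v) - b(c,z,v) = b(c, u - z, v) + b(u - c, u, v)\<close>.\<close>

lemma error_equation:
  assumes sol: "steady_NSE_solution \<Omega> X\<^sub>h Q\<^sub>h \<nu> \<gamma> f u p" and "Q\<^sub>h \<subseteq> L2 \<Omega>"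
    and z: "nudged_Picard_velocity \<Omega> X\<^sub>h \<nu> \<gamma> \<mu> f I\<^sub>H u c r z" and c: "c \<in> X\<^sub>h" and r: "r \<in> Q\<^sub>h" and v: "v \<in> X\<^sub>h"
  shows "energy (\<lambda>x. u x - z x) v = l2_inner \<Omega> (\<lambda>x. p x - r x) (wdiv \<Omega> v)
     - convection \<Omega> c (\<lambda>x. u x - z x) v - convection \<Omega> (\<lambda>x. u x - c x) u v"
proof -
  have u: "u \<in> X\<^sub>h" and p: "p \<in> L2 \<Omega>" and zX: "z \<in> X\<^sub>h" and rL: "r \<in> L2 \<Omega>"
    using sol z r \<open>Q\<^sub>h \<subseteq> L2 \<Omega>\<close> by (auto simp: steady_NSE_solution_def nudged_Picard_velocity_def)
  have 1: "energy (\<lambda>x. u x - z x) v = energy u v - energy z v"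
    using energy_lincomb[OF u zX v, of 1 "-1"] by simp
  have 2: "convection \<Omega> c (\<lambda>x. u x - z x) v = convection \<Omega> c u v - convection \<Omega> c z v"
    using convection_lincomb(1)[OF c u zX v, of 1 "-1"] by simp
  have 3: "convection \<Omega> (\<lambda>x. u x - c x) u v = convection \<Omega> u u v - convection \<Omega> c u v"
    using convection_lincomb(3)[OF u u c v, of 1 "-1"] by simp
  have 4: "l2_inner \<Omega> (\<lambda>x. p x - r x) (wdiv \<Omega> v) = l2_inner \<Omega> p (wdiv \<Omega> v) - l2_inner \<Omega> r (wdiv \<Omega> v)"
    using l2_inner_lincomb_left[OF p rL X\<^sub>h_velocity(4)[OF v], of 1 "-1"] by simp
  have 5: "\<nu> * l2_inner \<Omega> (wgrad \<Omega> u) (wgrad \<Omega> v) + convection \<Omega> u u v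
        - l2_inner \<Omega> p (wdiv \<Omega> v) + \<gamma> * l2_inner \<Omega> (wdiv \<Omega> u) (wdiv \<Omega> v) = f v"
    using sol v by (simp add: steady_NSE_solution_def)
  have 6: "\<nu> * l2_inner \<Omega> (wgrad \<Omega> z) (wgrad \<Omega> v) + \<gamma> * l2_inner \<Omega> (wdiv \<Omega> z) (wdiv \<Omega> v)
          + convection \<Omega> c z v + \<mu> * l2_inner \<Omega> (I\<^sub>H z) (I\<^sub>H v)
        = f v + \<mu> * l2_inner \<Omega> (I\<^sub>H u) (I\<^sub>H v) + l2_inner \<Omega> r (wdiv \<Omega> v)"
    using z v by (simp add: nudged_Picard_velocity_def)
  show ?thesis unfolding 1 2 3 4 using 5 6 by (simp add: energy_def)
qed

lemma energy_estimate:
  assumes v: "v \<in> X\<^sub>h" and q: "q \<in> L2 \<Omega>" and g: "\<bar>g\<bar> \<le> G * sqrt (viscous v)"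
    and eq: "energy v v = l2_inner \<Omega> q (wdiv \<Omega> v) - g"
  shows "viscous v + nudging v \<le> (l2_norm \<Omega> q / sqrt \<gamma>)\<^sup>2 / 3 + 4 / 3 * G\<^sup>2"
    and "viscous v / 4 + (2 * nudging v + viscous v) \<le> (l2_norm \<Omega> q / sqrt \<gamma>)\<^sup>2 / 2 + 4 / 3 * G\<^sup>2"
proof -
  have "viscous v + graddiv v + nudging v \<le> l2_norm \<Omega> q / sqrt \<gamma> * sqrt (graddiv v) + G * sqrt (viscous v)"
    using pressure_divergence_le[OF q v] g eq by (simp add: energy_self abs_le_iff)
  from young_coercive_bound[OF _ _ _ this]
  show "viscous v + nudging v \<le> (l2_norm \<Omega> q / sqrt \<gamma>)\<^sup>2 / 3 + 4 / 3 * G\<^sup>2"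
    and "viscous v / 4 + (2 * nudging v + viscous v) \<le> (l2_norm \<Omega> q / sqrt \<gamma>)\<^sup>2 / 2 + 4 / 3 * G\<^sup>2"
    using pos parameters_pos by auto
qed

text \<open>The inf-sup quotient never exceeds the norm of the divergence as a map on gradients.  This
  serves to put the factor \<open>\<beta>\<^sup>-\<^sup>2\<close> also on the part of the error that is estimated without the
  inf-sup condition.\<close>

lemma inf_sup_constant_le:
  assumes inf_sup: "inf_sup_condition \<Omega> X\<^sub>h Q\<^sub>h \<beta>" and "Q\<^sub>h \<subseteq> L2 \<Omega>"
  shows "\<beta>\<^sup>2 \<le> 3"
proof -
  obtain q where q: "q \<in> Q\<^sub>h" "l2_norm \<Omega> q \<noteq> 0" and beta: "0 < \<beta>"
    using inf_sup unfolding inf_sup_condition_def by blast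
  have "\<beta> * l2_norm \<Omega> q \<le> sqrt 3 * l2_norm \<Omega> q"
  proof (rule inf_sup_bound[OF inf_sup q(1)])
    fix v assume v: "v \<in> X\<^sub>h"
    have "l2_norm \<Omega> (wdiv \<Omega> v) \<le> sqrt 3 * l2_norm \<Omega> (wgrad \<Omega> v)"
      by (rule power2_le_imp_le) (use wdiv_norm_le[OF v] in \<open>simp_all add: power_mult_distrib\<close>)
    then have "l2_norm \<Omega> (wdiv \<Omega> v) * l2_norm \<Omega> q \<le> sqrt 3 * l2_norm \<Omega> (wgrad \<Omega> v) * l2_norm \<Omega> q"
      by (rule mult_right_mono) simp
    moreover have "l2_inner \<Omega> (wdiv \<Omega> v) q \<le> l2_norm \<Omega> (wdiv \<Omega> v) * l2_norm \<Omega> q"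
      using l2_Cauchy_Schwarz[OF X\<^sub>h_velocity(4)[OF v] subsetD[OF \<open>Q\<^sub>h \<subseteq> L2 \<Omega>\<close> q(1)]] by (simp add: abs_le_iff)
    ultimately show "l2_inner \<Omega> (wdiv \<Omega> v) q \<le> sqrt 3 * l2_norm \<Omega> q * l2_norm \<Omega> (wgrad \<Omega> v)"
      by (simp add: mult_ac)
  qed simp
  moreover have "0 < l2_norm \<Omega> q" using q(2) by (simp add: less_le)
  ultimately have "\<beta> \<le> sqrt 3" by (rule mult_right_le_imp_le)
  then have "\<beta>\<^sup>2 \<le> (sqrt 3)\<^sup>2" using beta by (intro power_mono) auto
  then show ?thesis by simp
qed

end

section \<open>The contraction estimate\<close>

theorem theorem3p1:
  fixes \<Omega> :: "(real^'n) set"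
    and \<tau>\<^sub>h \<tau>\<^sub>H :: "(real^'n) set set"
    and X\<^sub>h :: "(real^'n \<Rightarrow> real^'n) set" and Q\<^sub>h :: "(real^'n \<Rightarrow> real) set"
    and f :: "(real^'n \<Rightarrow> real^'n) \<Rightarrow> real"
    and I\<^sub>H :: "(real^'n \<Rightarrow> real^'n) \<Rightarrow> (real^'n \<Rightarrow> real^'n)"
    and u u_old u_new :: "real^'n \<Rightarrow> real^'n" and p p_old p_new :: "real^'n \<Rightarrow> real"
    and \<nu> \<gamma> \<mu> \<beta> M C\<^sub>P C\<^sub>1 h H \<sigma> c\<^sub>0 c\<^sub>1 \<alpha> R lam :: real
  assumes dim: "CARD('n) \<in> {2, 3}"
    and domain: "bounded_domain \<Omega>"
    and poincare: "C\<^sub>P > 0"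
      "\<And>v. v \<in> velocity_space \<Omega> \<Longrightarrow> l2_norm \<Omega> v \<le> C\<^sub>P * l2_norm \<Omega> (wgrad \<Omega> v)"
    and M_bounds:
      "\<And>a b c. \<lbrakk>a \<in> velocity_space \<Omega>; b \<in> velocity_space \<Omega>; c \<in> velocity_space \<Omega>\<rbrakk> \<Longrightarrow>
         convection \<Omega> a b c \<le> M * sqrt (l2_norm \<Omega> a) * sqrt (l2_norm \<Omega> (wgrad \<Omega> a))
           * l2_norm \<Omega> (wgrad \<Omega> b) * l2_norm \<Omega> (wgrad \<Omega> c)"
      "\<And>a b c. \<lbrakk>a \<in> velocity_space \<Omega>; b \<in> velocity_space \<Omega>; c \<in> velocity_space \<Omega>\<rbrakk> \<Longrightarrow>
         convection \<Omega> a b c \<le> M * l2_norm \<Omega> (wgrad \<Omega> a)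
           * l2_norm \<Omega> (wgrad \<Omega> b) * l2_norm \<Omega> (wgrad \<Omega> c)"
    and fine_mesh: "regular_triangulation \<Omega> \<sigma> h \<tau>\<^sub>h"
    and fe_spaces: "X\<^sub>h \<subseteq> velocity_space \<Omega>" "Q\<^sub>h \<subseteq> L20 \<Omega>"
      "finite_element_space \<tau>\<^sub>h X\<^sub>h" "finite_element_space \<tau>\<^sub>h Q\<^sub>h"
    and inf_sup: "inf_sup_condition \<Omega> X\<^sub>h Q\<^sub>h \<beta>"
    and data: "\<nu> > 0" "\<gamma> \<ge> 0" "\<mu> \<ge> 0" "in_dual \<Omega> f"
    and alpha: "\<alpha> = M * \<nu> powi (-2) * dual_norm \<Omega> f"
    and coarse: "H > 0" "coarse_mesh \<Omega> c\<^sub>0 c\<^sub>1 H \<tau>\<^sub>H" "mesh_nodes \<tau>\<^sub>H \<subseteq> mesh_nodes \<tau>\<^sub>h"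
    and interp: "C\<^sub>1 > 0" "interpolation_operator \<Omega> H C\<^sub>1 I\<^sub>H"
    and R: "R = rate_constant \<nu> C\<^sub>1 \<beta>"
    and solution: "steady_NSE_solution \<Omega> X\<^sub>h Q\<^sub>h \<nu> \<gamma> f u p"
    and old: "u_old \<in> X\<^sub>h" "p_old \<in> Q\<^sub>h"
      "\<nu> * (l2_norm \<Omega> (wgrad \<Omega> (\<lambda>x. u_old x - u x)))\<^sup>2 \<le> (l2_norm \<Omega> (wgrad \<Omega> u))\<^sup>2"
    and H_bound:
      "ereal H \<le> min (1 / ereal (\<alpha>\<^sup>2 * R)) (101 / ereal (204 * sqrt 2 * C\<^sub>1 * \<alpha>\<^sup>2))"
    and mu_bound: "max (\<nu> * \<alpha>\<^sup>2) (\<nu> / (2 * C\<^sub>1\<^sup>2 * H\<^sup>2)) \<le> \<mu>"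
    and gamma_bound: "\<gamma> \<ge> max (2 * \<mu>\<^sup>2 * C\<^sub>1 ^ 6 * C\<^sub>P\<^sup>2 * H\<^sup>2 * inverse \<nu>) \<nu>"
    and step: "CDA_IPY_step \<Omega> X\<^sub>h Q\<^sub>h \<nu> \<gamma> \<mu> f I\<^sub>H u u_old p_old u_new p_new"
    and lam: "lam = min \<mu> (\<nu> / (2 * C\<^sub>1\<^sup>2 * H\<^sup>2))"
  shows "lam = \<nu> / (2 * C\<^sub>1\<^sup>2 * H\<^sup>2) \<and>
    weighted_error \<Omega> \<nu> lam \<gamma> (\<lambda>x. u x - u_new x) (\<lambda>x. p x - p_new x)
      \<le> \<alpha>\<^sup>2 * H * R * weighted_error \<Omega> \<nu> lam \<gamma> (\<lambda>x. u x - u_old x) (\<lambda>x. p x - p_old x)"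
proof -
  have \<Omega>: "open \<Omega>" "bounded \<Omega>" using domain by (auto simp: bounded_domain_def)
  have X_bounded: "X\<^sub>h \<subseteq> bounded_velocities \<Omega>"
    using fe_spaces(1) finite_element_essentially_bounded[OF fine_mesh fe_spaces(3) _ \<Omega>]
    by (auto simp: bounded_velocities_def)
  have X_lincomb: "(\<lambda>x. a *\<^sub>R v x + b *\<^sub>R w x) \<in> X\<^sub>h" if "v \<in> X\<^sub>h" "w \<in> X\<^sub>h" for v w a b
    using fe_spaces(3) that unfolding finite_element_space_def by blast
  have Q_lincomb: "(\<lambda>x. a *\<^sub>R q x + b *\<^sub>R r x) \<in> Q\<^sub>h" if "q \<in> Q\<^sub>h" "r \<in> Q\<^sub>h" for q r a b
    using fe_spaces(4) that unfolding finite_element_space_def by blast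
  have Q_L2: "Q\<^sub>h \<subseteq> L2 \<Omega>" using fe_spaces(2) by (auto simp: L20_def)
  interpret nudged_discretization \<Omega> X\<^sub>h I\<^sub>H \<nu> \<gamma> \<mu> C\<^sub>1 C\<^sub>P H
  proof
    show "CARD('n) \<le> 3" using dim by auto
    show "\<And>v. v \<in> X\<^sub>h \<Longrightarrow> l2_norm \<Omega> v \<le> C\<^sub>P * l2_norm \<Omega> (wgrad \<Omega> v)"
      using poincare(2) fe_spaces(1) by blast
    show "\<nu> / (2 * C\<^sub>1\<^sup>2 * H\<^sup>2) \<le> \<mu>" using mu_bound by simp
    show "2 * \<mu>\<^sup>2 * C\<^sub>1 ^ 6 * C\<^sub>P\<^sup>2 * H\<^sup>2 * inverse \<nu> \<le> \<gamma>" "\<nu> \<le> \<gamma>" using gamma_bound by simp_all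
  qed (use \<Omega> X_bounded X_lincomb interp data coarse poincare in auto)
  have lam_eq: "lam = \<nu> / (2 * C\<^sub>1\<^sup>2 * H\<^sup>2)" using lam mu by simp
  obtain z w \<delta> where
    z: "nudged_Picard_velocity \<Omega> X\<^sub>h \<nu> \<gamma> \<mu> f I\<^sub>H u u_old p_old z" and
    w: "w \<in> X\<^sub>h" and \<delta>: "\<delta> \<in> Q\<^sub>h" and
    w_eq: "\<And>v. v \<in> X\<^sub>h \<Longrightarrow> \<nu> * l2_inner \<Omega> (wgrad \<Omega> w) (wgrad \<Omega> v) + \<gamma> * l2_inner \<Omega> (wdiv \<Omega> w) (wdiv \<Omega> v)
             - l2_inner \<Omega> \<delta> (wdiv \<Omega> v) + \<mu> * l2_inner \<Omega> (I\<^sub>H w) (I\<^sub>H v) = 0" and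
    w_div: "\<And>q. q \<in> Q\<^sub>h \<Longrightarrow> l2_inner \<Omega> (wdiv \<Omega> w) q = - l2_inner \<Omega> (wdiv \<Omega> z) q" and
    p_new: "p_new = (\<lambda>x. p_old x + \<delta> x)" and
    u_new: "nudged_Picard_velocity \<Omega> X\<^sub>h \<nu> \<gamma> \<mu> f I\<^sub>H u u_old p_new u_new"
    using step unfolding CDA_IPY_step_def by blast
  have u: "u \<in> X\<^sub>h" and p: "p \<in> Q\<^sub>h" and u_div: "\<And>q. q \<in> Q\<^sub>h \<Longrightarrow> l2_inner \<Omega> (wdiv \<Omega> u) q = 0"
    using solution by (auto simp: steady_NSE_solution_def)
  have zX: "z \<in> X\<^sub>h" and u_newX: "u_new \<in> X\<^sub>h" using z u_new by (auto simp: nudged_Picard_velocity_def)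
  have p_newQ: "p_new \<in> Q\<^sub>h" using Q_lincomb[OF old(2) \<delta>, of 1 1] by (simp add: p_new)

  define e_old e_z e_new where "e_old = (\<lambda>x. u x - u_old x)" and "e_z = (\<lambda>x. u x - z x)" and "e_new = (\<lambda>x. u x - u_new x)"
  define r_old r_new where "r_old = (\<lambda>x. p x - p_old x)" and "r_new = (\<lambda>x. p x - p_new x)"
  have diffX: "(\<lambda>x. a x - b x) \<in> X\<^sub>h" if "a \<in> X\<^sub>h" "b \<in> X\<^sub>h" for a b
    using X_lincomb[OF that, of 1 "-1"] by simp
  have diffQ: "(\<lambda>x. a x - b x) \<in> Q\<^sub>h" if "a \<in> Q\<^sub>h" "b \<in> Q\<^sub>h" for a b
    using Q_lincomb[OF that, of 1 "-1"] by simp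
  have eX: "e_old \<in> X\<^sub>h" "e_z \<in> X\<^sub>h" "e_new \<in> X\<^sub>h"
    unfolding e_old_def e_z_def e_new_def by (intro diffX u old(1) zX u_newX)+
  have rQ: "r_old \<in> Q\<^sub>h" "r_new \<in> Q\<^sub>h" unfolding r_old_def r_new_def by (intro diffQ p old(2) p_newQ)+
  note rL2 = rQ[THEN subsetD[OF Q_L2]]

  \<comment> \<open>The form vanishes when its last two arguments agree, so the bound itself forces the sign of
      \<open>M\<close> as soon as some discrete velocity has a non-zero gradient.\<close>
  have M_nonneg: "0 \<le> M"
  proof -
    obtain v where v: "v \<in> X\<^sub>h" "0 < l2_norm \<Omega> (wgrad \<Omega> v)" using inf_sup_nontrivial[OF inf_sup] .
    have "0 \<le> M * (l2_norm \<Omega> (wgrad \<Omega> v) * l2_norm \<Omega> (wgrad \<Omega> v) * l2_norm \<Omega> (wgrad \<Omega> v))"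
      using M_bounds(2)[of v v v] X\<^sub>h_velocity(1)[OF v(1)] convection_antisym[of \<Omega> v v v] by (simp add: mult_ac)
    moreover have "0 < l2_norm \<Omega> (wgrad \<Omega> v) * l2_norm \<Omega> (wgrad \<Omega> v) * l2_norm \<Omega> (wgrad \<Omega> v)"
      using v(2) by simp
    ultimately show ?thesis by (simp only: zero_le_mult_iff) linarith
  qed
  define t A where "t = 1 / sqrt \<nu>" and "A = \<alpha> * (1 + t)"
  have t: "0 < t" using pos by (simp add: t_def)
  have dual_nonneg: "0 \<le> dual_norm \<Omega> f"
  proof -
    obtain v where v: "v \<in> X\<^sub>h" "0 < l2_norm \<Omega> (wgrad \<Omega> v)" using inf_sup_nontrivial[OF inf_sup] .
    define w where "w = (\<lambda>x. (-1) *\<^sub>R v x + 0 *\<^sub>R v x)"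
    have w: "w \<in> X\<^sub>h" unfolding w_def by (rule X_lincomb[OF v(1) v(1)])
    have "l2_inner \<Omega> (wgrad \<Omega> w) (wgrad \<Omega> w) = l2_inner \<Omega> (wgrad \<Omega> v) (wgrad \<Omega> v)"
      using inner_wgrad_lincomb[OF v(1) v(1) w, of "-1" 0] inner_wgrad_lincomb[OF v(1) v(1) v(1), of "-1" 0]
      unfolding w_def[symmetric] by (simp add: l2_inner_commute[of \<Omega> "wgrad \<Omega> v" "wgrad \<Omega> w"])
    then have "l2_norm \<Omega> (wgrad \<Omega> w) = l2_norm \<Omega> (wgrad \<Omega> v)" by (simp add: l2_norm_def)
    moreover have "f w = (-1) * f v + 0 * f v"
      using data(4) X\<^sub>h_velocity(1)[OF v(1)] unfolding in_dual_def w_def by blast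
    ultimately have "0 \<le> dual_norm \<Omega> f * l2_norm \<Omega> (wgrad \<Omega> v)"
      using dual_norm_bound[OF data(4) X\<^sub>h_velocity(1)[OF v(1)]] dual_norm_bound[OF data(4) X\<^sub>h_velocity(1)[OF w]]
      by simp
    then show ?thesis using v(2) by (simp add: zero_le_mult_iff)
  qed
  have alpha_nonneg: "0 \<le> \<alpha>" using M_nonneg dual_nonneg pos by (simp add: alpha)
  have A: "0 \<le> A" "\<alpha> \<le> A" using alpha_nonneg t by (simp_all add: A_def mult_left_le algebra_simps)
  \<comment> \<open>The energy bound \<open>\<nu> \<parallel>\<nabla>u\<parallel> \<le> \<parallel>f\<parallel>\<^sub>-\<^sub>1\<close>, from testing the Navier-Stokes equations with \<open>u\<close>.\<close>
  have Mu: "M * l2_norm \<Omega> (wgrad \<Omega> u) \<le> \<alpha> * \<nu>"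
  proof -
    define a where "a = l2_norm \<Omega> (wgrad \<Omega> u)"
    have a: "0 \<le> a" by (simp add: a_def)
    have "\<nu> * a\<^sup>2 + \<gamma> * (l2_norm \<Omega> (wdiv \<Omega> u))\<^sup>2 = f u"
    proof -
      have "\<nu> * l2_inner \<Omega> (wgrad \<Omega> u) (wgrad \<Omega> u) + convection \<Omega> u u u
          - l2_inner \<Omega> p (wdiv \<Omega> u) + \<gamma> * l2_inner \<Omega> (wdiv \<Omega> u) (wdiv \<Omega> u) = f u"
        using solution u unfolding steady_NSE_solution_def by blast
      then show ?thesis
        using u_div[OF p] convection_antisym[of \<Omega> u u u] l2_inner_commute[of \<Omega> p "wdiv \<Omega> u"]
        by (simp add: a_def l2_norm_squared)
    qed
    then have "\<nu> * a\<^sup>2 \<le> dual_norm \<Omega> f * a"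
      using dual_norm_bound[OF data(4) X\<^sub>h_velocity(1)[OF u]] parameters_pos(2)
        zero_le_power2[of "l2_norm \<Omega> (wdiv \<Omega> u)"]
      by (smt (verit) a_def mult_nonneg_nonneg)
    then have "(\<nu> * a) * a \<le> dual_norm \<Omega> f * a" by (simp add: power2_eq_square mult.assoc)
    then have "\<nu> * a \<le> dual_norm \<Omega> f"
      using a dual_nonneg by (cases "a = 0") (simp_all add: mult_le_cancel_right)
    then have "M * (\<nu> * a) \<le> M * dual_norm \<Omega> f" using M_nonneg by (rule mult_left_mono)
    also have "\<dots> = \<alpha> * \<nu> * \<nu>" using pos by (simp add: alpha power_int_minus power2_eq_square field_simps)
    finally have "(M * a) * \<nu> \<le> (\<alpha> * \<nu>) * \<nu>" by (simp add: mult_ac)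
    then show ?thesis using pos by (simp add: a_def)
  qed
  \<comment> \<open>The previous iterate is controlled by \<open>u\<close> through the assumed bound of their distance,
      which produces the factor \<open>1 + \<nu>\<^sup>-\<^sup>1\<^sup>/\<^sup>2\<close>.\<close>
  have Mu_old: "M * l2_norm \<Omega> (wgrad \<Omega> u_old) \<le> A * \<nu>"
  proof -
    define a b where "a = l2_norm \<Omega> (wgrad \<Omega> u)" and "b = l2_norm \<Omega> (wgrad \<Omega> (\<lambda>x. u_old x - u x))"
    have "(sqrt \<nu> * b)\<^sup>2 \<le> a\<^sup>2" using old(3) pos by (simp add: a_def b_def power_mult_distrib)
    then have "sqrt \<nu> * b \<le> a" by (rule power2_le_imp_le) (simp add: a_def)
    then have b: "b \<le> t * a" using pos by (simp add: t_def field_simps)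
    have "l2_norm \<Omega> (wgrad \<Omega> u_old) \<le> a + b"
      using wgrad_norm_triangle[OF u diffX[OF old(1) u]] by (simp add: a_def b_def)
    then have "l2_norm \<Omega> (wgrad \<Omega> u_old) \<le> a * (1 + t)" using b by (simp add: algebra_simps)
    then have "M * l2_norm \<Omega> (wgrad \<Omega> u_old) \<le> M * (a * (1 + t))" using M_nonneg by (rule mult_left_mono)
    also have "\<dots> = (M * a) * (1 + t)" by simp
    also have "\<dots> \<le> (\<alpha> * \<nu>) * (1 + t)" using Mu t unfolding a_def by (intro mult_right_mono) auto
    finally show ?thesis by (simp add: A_def mult_ac)
  qed

  define E E\<^sub>1 where "E = weighted_error \<Omega> \<nu> lam \<gamma> e_old r_old"
    and "E\<^sub>1 = \<nu> / 4 * (l2_norm \<Omega> (wgrad \<Omega> e_old))\<^sup>2 + lam * (l2_norm \<Omega> e_old)\<^sup>2"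
  have lam_pos: "0 < lam" using pos by (simp add: lam_eq)
  have pressure_norm: "(l2_norm \<Omega> q / sqrt \<gamma>)\<^sup>2 = inverse \<gamma> * (l2_norm \<Omega> q)\<^sup>2" for q :: "real^'n \<Rightarrow> real"
    using parameters_pos by (simp add: power_divide inverse_eq_divide)
  have E\<^sub>1: "0 \<le> E\<^sub>1" using pos lam_pos by (simp add: E\<^sub>1_def)
  have E_split: "E = E\<^sub>1 + (l2_norm \<Omega> r_old / sqrt \<gamma>)\<^sup>2 / 2"
    unfolding pressure_norm by (simp add: E_def E\<^sub>1_def weighted_error_def)
  then have E: "E\<^sub>1 \<le> E" "0 \<le> E" using E\<^sub>1 by simp_all
  define G where "G = \<alpha> * sqrt (\<nu> * (l2_norm \<Omega> e_old * l2_norm \<Omega> (wgrad \<Omega> e_old)))"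
  have G_nonneg: "0 \<le> G" using alpha_nonneg pos by (simp add: G_def)
  have old_product: "\<nu> * (l2_norm \<Omega> e_old * l2_norm \<Omega> (wgrad \<Omega> e_old)) \<le> kappa * E\<^sub>1"
  proof -
    have "sqrt (x * y) \<le> y / 4 + x" if "0 \<le> x" "0 \<le> y" for x y :: real
    proof (rule real_le_lsqrt)
      show "x * y \<le> (y / 4 + x)\<^sup>2"
        using zero_le_power2[of "y / 4 - x"] by (simp add: power2_eq_square algebra_simps)
    qed (use that in auto)
    from this[of "lam * (l2_norm \<Omega> e_old)\<^sup>2" "viscous e_old"]
    have "sqrt (lam * (l2_norm \<Omega> e_old)\<^sup>2 * viscous e_old) \<le> E\<^sub>1"
      using lam_pos pos by (simp add: E\<^sub>1_def)
    then show ?thesis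
      unfolding norm_product_eq lam_eq[symmetric] using parameters_pos by (intro mult_left_mono) auto
  qed
  have G_sq: "G\<^sup>2 \<le> \<alpha>\<^sup>2 * kappa * E\<^sub>1"
  proof -
    have "G\<^sup>2 = \<alpha>\<^sup>2 * (\<nu> * (l2_norm \<Omega> e_old * l2_norm \<Omega> (wgrad \<Omega> e_old)))"
      using pos by (simp add: G_def power_mult_distrib)
    then show ?thesis using mult_left_mono[OF old_product, of "\<alpha>\<^sup>2"] by (simp add: mult.assoc)
  qed
  \<comment> \<open>The second restriction on \<open>H\<close> says that \<open>\<alpha>\<^sup>2 kappa \<le> 101/204\<close>.  If \<open>\<alpha> = 0\<close>, that
      restriction reads \<open>H \<le> \<infinity>\<close>.\<close>
  have kappa_small: "\<alpha>\<^sup>2 * kappa \<le> 1 / 2"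
  proof (cases "\<alpha> = 0")
    case False
    define c where "c = 204 * sqrt 2 * C\<^sub>1 * \<alpha>\<^sup>2"
    have c: "0 < c" using False pos by (simp add: c_def)
    have "ereal H \<le> ereal 101 / ereal c"
      using order_trans[OF H_bound min.cobounded2] unfolding c_def numeral_eq_ereal .
    then have "H * c \<le> 101" using c by (simp add: le_divide_eq)
    then show ?thesis by (simp add: c_def mult_ac)
  qed simp
  have G_half: "G\<^sup>2 \<le> E\<^sub>1 / 2"
    using G_sq mult_right_mono[OF kappa_small E\<^sub>1] by simp
  have g_bound: "\<bar>convection \<Omega> e_old u v\<bar> \<le> G * sqrt (viscous v)" if "v \<in> X\<^sub>h" for v
    unfolding G_def by (rule convection_le_error[OF M_nonneg M_bounds(1) eX(1) u that Mu])

  have z_eq: "energy e_z v = l2_inner \<Omega> r_old (wdiv \<Omega> v) - convection \<Omega> u_old e_z v - convection \<Omega> e_old u v"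
    if "v \<in> X\<^sub>h" for v
    unfolding e_z_def r_old_def e_old_def by (rule error_equation[OF solution Q_L2 z old(1,2) that])
  \<comment> \<open>The constants of \<open>young_coercive_bound\<close>, with \<open>P\<^sup>2 = 2 (E - E\<^sub>1)\<close> and \<open>G\<^sup>2 \<le> E\<^sub>1 / 2\<close>, add up to
      \<open>2/3 (E - E\<^sub>1) + 2/3 E\<^sub>1\<close>.\<close>
  have z_energy: "viscous e_z + nudging e_z \<le> 2 / 3 * E"
  proof -
    have "energy e_z e_z = l2_inner \<Omega> r_old (wdiv \<Omega> e_z) - convection \<Omega> e_old u e_z"
      using z_eq[OF eX(2)] convection_antisym[of \<Omega> u_old e_z e_z] by simp
    from energy_estimate(1)[OF eX(2) rL2(1) g_bound[OF eX(2)] this]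
    show ?thesis using G_half E_split by simp
  qed
  \<comment> \<open>The summand \<open>2 sqrt 2 = 2 sqrt 3 sqrt (2/3)\<close> stems from the convection of \<open>e_z\<close>, and \<open>1\<close> from
      that of the old error.\<close>
  define F where "F = (2 * sqrt 2 + 1) * (A * sqrt (kappa * E))"
  have F: "0 \<le> F" using A E parameters_pos by (simp add: F_def)
  have residual: "\<bar>convection \<Omega> u_old e_z v + convection \<Omega> e_old u v\<bar> \<le> F * sqrt (energy v v)" if v: "v \<in> X\<^sub>h" for v
  proof -
    define Y where "Y = sqrt (energy v v)"
    have Y: "0 \<le> Y" by (simp add: Y_def energy_self_nonneg)
    have nn: "0 \<le> viscous v" "0 \<le> nudging v" "0 \<le> graddiv v" using pos parameters_pos by simp_all
    have Y1: "sqrt (viscous v + nudging v) \<le> Y" and Y2: "sqrt (viscous v) \<le> Y"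
      using nn by (simp_all add: Y_def energy_self)
    have "\<bar>convection \<Omega> u_old e_z v\<bar>
        \<le> 2 * sqrt 3 * A * sqrt kappa * sqrt (viscous e_z + nudging e_z) * sqrt (viscous v + nudging v)"
      by (rule convection_le_energy[OF M_nonneg M_bounds(1) old(1) eX(2) v Mu_old])
    also have "\<dots> \<le> 2 * sqrt 3 * A * sqrt kappa * sqrt (2 / 3 * E) * Y"
    proof (rule mult_mono)
      show "2 * sqrt 3 * A * sqrt kappa * sqrt (viscous e_z + nudging e_z) \<le> 2 * sqrt 3 * A * sqrt kappa * sqrt (2 / 3 * E)"
        by (rule mult_left_mono) (use z_energy A parameters_pos in auto)
      show "0 \<le> 2 * sqrt 3 * A * sqrt kappa * sqrt (2 / 3 * E)" using A E parameters_pos by simp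
    qed (use Y1 nn in auto)
    also have "\<dots> = 2 * sqrt 2 * (A * sqrt (kappa * E)) * Y"
    proof -
      have "sqrt 3 * sqrt (2 / 3 * E) = sqrt 2 * sqrt E" by (simp flip: real_sqrt_mult)
      then have "2 * A * sqrt kappa * (sqrt 3 * sqrt (2 / 3 * E)) * Y = 2 * A * sqrt kappa * (sqrt 2 * sqrt E) * Y" by simp
      then show ?thesis by (simp only: real_sqrt_mult mult_ac)
    qed
    finally have 1: "\<bar>convection \<Omega> u_old e_z v\<bar> \<le> 2 * sqrt 2 * (A * sqrt (kappa * E)) * Y" .
    have "G \<le> A * sqrt (kappa * E)"
    proof -
      have "\<nu> * (l2_norm \<Omega> e_old * l2_norm \<Omega> (wgrad \<Omega> e_old)) \<le> kappa * E"
        by (rule order_trans[OF old_product mult_left_mono[OF E(1)]]) (use parameters_pos in simp)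
      then show ?thesis unfolding G_def using A alpha_nonneg E parameters_pos pos by (intro mult_mono) auto
    qed
    then have 2: "\<bar>convection \<Omega> e_old u v\<bar> \<le> (A * sqrt (kappa * E)) * Y"
      using order_trans[OF g_bound[OF v] mult_mono[OF _ Y2]] G_nonneg nn(1) by simp
    show ?thesis using 1 2 by (simp add: F_def Y_def[symmetric] algebra_simps abs_le_iff)
  qed

  \<comment> \<open>The error of the velocity \<open>z + w\<close>, which is discretely divergence free like \<open>u\<close>.\<close>
  define x where "x = (\<lambda>y. 1 *\<^sub>R e_z y + (-1) *\<^sub>R w y)"
  have x: "x \<in> X\<^sub>h" unfolding x_def by (rule X_lincomb[OF eX(2) w])
  have r_new_eq: "l2_inner \<Omega> r_new q = l2_inner \<Omega> r_old q - l2_inner \<Omega> \<delta> q" if "q \<in> L2 \<Omega>" for q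
  proof -
    have "r_new = (\<lambda>x. 1 *\<^sub>R r_old x + (-1) *\<^sub>R \<delta> x)" by (auto simp: r_new_def r_old_def p_new)
    then show ?thesis using l2_inner_lincomb_left[OF rL2(1) subsetD[OF Q_L2 \<delta>] that, of 1 "-1"] by simp
  qed
  have pressure_functional: "\<bar>l2_inner \<Omega> r_new (wdiv \<Omega> v)\<bar> \<le> F * sqrt (energy v v)" if v: "v \<in> X\<^sub>h" for v
  proof (rule constrained_functional_bound[where V = X\<^sub>h and B = energy and x = x
        and c = "\<lambda>v. l2_inner \<Omega> r_new (wdiv \<Omega> v)"
        and l = "\<lambda>v. convection \<Omega> u_old e_z v + convection \<Omega> e_old u v"])
    show "l2_inner \<Omega> r_new (wdiv \<Omega> (\<lambda>t. a *\<^sub>R v t + b *\<^sub>R w t))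
        = a * l2_inner \<Omega> r_new (wdiv \<Omega> v) + b * l2_inner \<Omega> r_new (wdiv \<Omega> w)"
      if "v \<in> X\<^sub>h" "w \<in> X\<^sub>h" for v w a b
      using inner_wdiv_lincomb[OF that rL2(2), of a b] by (simp only: l2_inner_commute[of \<Omega> r_new])
    have "l2_inner \<Omega> (wdiv \<Omega> e_z) r_new = l2_inner \<Omega> (wdiv \<Omega> u) r_new - l2_inner \<Omega> (wdiv \<Omega> z) r_new"
      using inner_wdiv_lincomb[OF u zX rL2(2), of 1 "-1"] by (simp add: e_z_def)
    then show "l2_inner \<Omega> r_new (wdiv \<Omega> x) = 0"
      using inner_wdiv_lincomb[OF eX(2) w rL2(2), of 1 "-1"] u_div[OF rQ(2)] w_div[OF rQ(2)]
      unfolding l2_inner_commute[of \<Omega> r_new] x_def[symmetric] by simp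
    show "energy x v = l2_inner \<Omega> r_new (wdiv \<Omega> v) - (convection \<Omega> u_old e_z v + convection \<Omega> e_old u v)"
      if v: "v \<in> X\<^sub>h" for v
    proof -
      have "energy x v = energy e_z v - energy w v"
        using energy_lincomb[OF eX(2) w v, of 1 "-1"] by (simp add: x_def)
      moreover have "energy w v = l2_inner \<Omega> \<delta> (wdiv \<Omega> v)" using w_eq[OF v] by (simp add: energy_def)
      ultimately show ?thesis using z_eq[OF v] r_new_eq[OF X\<^sub>h_velocity(4)[OF v]] by simp
    qed
  qed ((fact X_lincomb energy_lincomb energy_sym x residual F v | rule energy_self_nonneg)+)

  define P where "P = l2_norm \<Omega> r_new / sqrt \<gamma>"
  have beta: "0 < \<beta>" using inf_sup by (simp add: inf_sup_condition_def)
  have "\<beta> * l2_norm \<Omega> r_new \<le> F * (5 / 2 * sqrt \<gamma>)"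
  proof (rule inf_sup_bound[OF inf_sup rQ(2)])
    show "0 \<le> F * (5 / 2 * sqrt \<gamma>)" using F parameters_pos by simp
    fix v assume v: "v \<in> X\<^sub>h"
    have "sqrt (energy v v) \<le> sqrt ((5 / 2)\<^sup>2 * \<gamma> * (l2_norm \<Omega> (wgrad \<Omega> v))\<^sup>2)"
      using energy_le_gamma[OF v] by (simp add: power2_eq_square)
    also have "\<dots> = 5 / 2 * sqrt \<gamma> * l2_norm \<Omega> (wgrad \<Omega> v)" by (simp add: real_sqrt_mult)
    finally have "F * sqrt (energy v v) \<le> F * (5 / 2 * sqrt \<gamma> * l2_norm \<Omega> (wgrad \<Omega> v))"
      using F by (rule mult_left_mono)
    then show "l2_inner \<Omega> (wdiv \<Omega> v) r_new \<le> F * (5 / 2 * sqrt \<gamma>) * l2_norm \<Omega> (wgrad \<Omega> v)"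
      using pressure_functional[OF v] by (simp add: l2_inner_commute[of \<Omega> "wdiv \<Omega> v"] mult_ac abs_le_iff)
  qed
  then have "\<beta> * P \<le> 5 / 2 * F" using parameters_pos by (simp add: P_def field_simps)
  then have "(\<beta> * P)\<^sup>2 \<le> (5 / 2 * F)\<^sup>2"
    using beta parameters_pos by (intro power_mono) (auto simp: P_def)
  then have betaP: "\<beta>\<^sup>2 * P\<^sup>2 \<le> 25 / 4 * F\<^sup>2" by (simp add: power_mult_distrib power_divide)
  have beta_le: "\<beta>\<^sup>2 \<le> 3" by (rule inf_sup_constant_le[OF inf_sup Q_L2])

  have "energy e_new e_new = l2_inner \<Omega> r_new (wdiv \<Omega> e_new) - convection \<Omega> u_old e_new e_new - convection \<Omega> e_old u e_new"
    unfolding e_new_def r_new_def e_old_def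
    by (rule error_equation[OF solution Q_L2 u_new old(1) p_newQ eX(3)[unfolded e_new_def]])
  then have "energy e_new e_new = l2_inner \<Omega> r_new (wdiv \<Omega> e_new) - convection \<Omega> e_old u e_new"
    using convection_antisym[of \<Omega> u_old e_new e_new] by simp
  from energy_estimate(2)[OF eX(3) rL2(2) g_bound[OF eX(3)] this] l2_norm_le_nudging[OF eX(3)]
  have E_new: "weighted_error \<Omega> \<nu> lam \<gamma> e_new r_new \<le> P\<^sup>2 + 4 / 3 * G\<^sup>2"
    unfolding P_def by (simp add: weighted_error_def lam_eq pressure_norm)
  \<comment> \<open>The total constant is \<open>25/4 * 15 + 4 < 108\<close>.\<close>
  have final: "\<beta>\<^sup>2 * (P\<^sup>2 + 4 / 3 * G\<^sup>2) \<le> 108 * (1 + t)\<^sup>2 * kappa * (\<alpha>\<^sup>2 * E)"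
  proof -
    define Z where "Z = (1 + t)\<^sup>2 * kappa * (\<alpha>\<^sup>2 * E)"
    have Z: "0 \<le> Z" using E pos parameters_pos by (simp add: Z_def)
    have "0 \<le> kappa * E" using E pos parameters_pos by (intro mult_nonneg_nonneg) simp_all
    then have "F\<^sup>2 = (2 * sqrt 2 + 1)\<^sup>2 * (A\<^sup>2 * (kappa * E))"
      unfolding F_def power_mult_distrib[of _ "A * sqrt (kappa * E)"] power_mult_distrib[of A] by simp
    also have "A\<^sup>2 * (kappa * E) = Z"
      by (simp only: A_def Z_def power_mult_distrib mult_ac)
    finally have "F\<^sup>2 = (2 * sqrt 2 + 1)\<^sup>2 * Z" .
    moreover have "(2 * sqrt 2 + 1)\<^sup>2 \<le> 15"
    proof -
      have "sqrt 2 \<le> 3 / 2" by (rule real_le_lsqrt) (auto simp: power2_eq_square)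
      then show ?thesis by (simp add: power2_sum power_mult_distrib)
    qed
    ultimately have "F\<^sup>2 \<le> 15 * Z" using Z by (simp add: mult_right_mono)
    moreover have "\<beta>\<^sup>2 * (4 / 3 * G\<^sup>2) \<le> 4 * Z"
    proof -
      have "G\<^sup>2 \<le> \<alpha>\<^sup>2 * kappa * E"
        by (rule order_trans[OF G_sq mult_left_mono[OF E(1)]]) (use parameters_pos in simp)
      also have "\<dots> \<le> (1 + t)\<^sup>2 * (\<alpha>\<^sup>2 * kappa * E)"
      proof -
        have "1 \<le> (1 + t)\<^sup>2" using t by (simp add: one_le_power)
        moreover have "0 \<le> \<alpha>\<^sup>2 * kappa * E" using E pos by (intro mult_nonneg_nonneg) simp_all
        ultimately show ?thesis using mult_right_mono[of 1 "(1 + t)\<^sup>2" "\<alpha>\<^sup>2 * kappa * E"] by simp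
      qed
      finally have GZ: "G\<^sup>2 \<le> Z" by (simp add: Z_def mult_ac)
      have "\<beta>\<^sup>2 * (4 / 3 * G\<^sup>2) \<le> 3 * (4 / 3 * Z)"
        using beta_le GZ by (intro mult_mono) auto
      then show ?thesis by simp
    qed
    ultimately have "\<beta>\<^sup>2 * P\<^sup>2 + \<beta>\<^sup>2 * (4 / 3 * G\<^sup>2) \<le> 108 * Z" using betaP Z by linarith
    then show ?thesis by (simp only: Z_def distrib_left mult.assoc)
  qed
  have "\<beta>\<^sup>2 * weighted_error \<Omega> \<nu> lam \<gamma> e_new r_new \<le> \<beta>\<^sup>2 * (P\<^sup>2 + 4 / 3 * G\<^sup>2)"
    using E_new by (rule mult_left_mono) simp
  also note final
  also have "108 * (1 + t)\<^sup>2 * kappa * (\<alpha>\<^sup>2 * E) = (108 * (1 + t)\<^sup>2 * (sqrt 2 * C\<^sub>1)) * (\<alpha>\<^sup>2 * H * E)"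
    by (simp only: mult_ac)
  also have "\<dots> \<le> (\<beta>\<^sup>2 * R) * (\<alpha>\<^sup>2 * H * E)"
    using rate_constant_lower_bound[OF pos(1) pos(2) beta] E pos
    unfolding R t_def by (intro mult_right_mono) auto
  also have "\<dots> = \<beta>\<^sup>2 * (\<alpha>\<^sup>2 * H * R * E)" by (simp only: mult_ac)
  finally have "weighted_error \<Omega> \<nu> lam \<gamma> e_new r_new \<le> \<alpha>\<^sup>2 * H * R * E" using beta by simp
  then show ?thesis
    using lam_eq by (simp add: E_def e_new_def e_old_def r_new_def r_old_def)
qed

end
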